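(* For every fake weighted projective plane $Z_1$ of integral degree $\mathcal{K}_{Z_1}^2\in\mathbb{Z}$, there is a pair $(Q_1,Q_2)$ of adjacent degree matrices with $Z_1\cong Z(Q_1)$.
   Context: The ground field $\mathbb{K}$ is algebraically closed of characteristic zero. A fake weighted projective plane is a ($\mathbb{Q}$-factorial) projective toric surface of Picard number one. **Generator matrices.** A projective generator matrix is an integral $n\times(n+1)$ matrix $P=[v_0,\dots,v_n]$ with pairwise distinct primitive columns generating $\mathbb{Q}^n$ as a convex cone. $Z(P)$ denotes the toric variety of the fan in $\mathbb{Z}^n$ with maximal cones $\mathrm{cone}(v_j;\,j\ne i)$, $i=0,\dots,n$. **Degree matrices.** A degree matrix in $K=\mathbb{Z}\oplus\mathbb{Z}/\mu\mathbb{Z}$ is a matrix $Q=[q_0,q_1,q_2]$ with columns $q_i=(u_i,\bar\eta_i)\in\mathbb{Z}_{>0}\oplus\mathbb{Z}/\mu\mathbb{Z}$, any two of which generate $K$ (second row omitted for $\mu=1$). A $2\times3$ projective generator matrix $P$ and a degree matrix $Q$ correspond to each other if $0\to\mathbb{Z}^2\xrightarrow{P^*}\mathbb{Z}^3\xrightarrow{Q}K\to0$ is exact, where $P^*$ is the transpose and $Q$ is the map $e_i\mapsto q_i$; then $Z(Q):=Z(P)$ up to isomorphism. The fake weight vector is $w(Q)=(w_0,w_1,w_2)$, $w_i=[K:\mathbb{Z}q_i]$; one has $w(Q)=\mu\cdot(u_0,u_1,u_2)$. **Adjusted.** $S(a)=\{w\in\mathbb{Z}_{>0}^3;\ (w_0+w_1+w_2)^2=a\,w_0w_1w_2\}$,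 nonempty only for $a\in\{1,2,3,4,5,6,8,9\}$. Let $w\in S(a)$, $\mu=\gcd(w_0,w_1,w_2)$, $u=\mu^{-1}w$; then $u\in S(\mu a)$ with $\mu a\in\{5,6,8,9\}$. We call $w$ adjusted if: $u_0\le u_1\le u_2$ in case $\mu a=9$; $u_0\le u_1$ and $2\mid u_2$ in case $\mu a=8$; $2\mid u_1$ and $3\mid u_2$ in case $\mu a=6$; $u_0\le u_1$ and $5\mid u_2$ in case $\mu a=5$. A degree matrix $Q$ with $w(Q)=w\in S(a)$ is adjusted if $w$ is adjusted and, for $a\le4$, $Q=\begin{bmatrix}u_0&u_1&u_2\\ \bar0&\bar1&\bar\eta\end{bmatrix}$ with $1\le\eta<\mu$, where in addition $\bar\eta=\bar2$ if $u=(1,1,1)$; $\bar\eta\in\{\bar2,\bar5\}$ if $u=(1,1,4)$; $\bar\eta\in\{\bar1,\bar3,\bar5\}$ if $u=(1,1,2)$. **Adjacency.** Consider $3\times4$ projective generator matrices $$P=\begin{bmatrix}-1&-1&l_1&0\\-1&-1&0&l_2\\0&d_0&d_1&d_2\end{bmatrix},\quad 1\le d_1\le l_1\le l_2,\ \gcd(l_i,d_i)=1,\ d_0+\tfrac{d_1}{l_1}+\tfrac{d_2}{l_2}<0<\tfrac{d_1}{l_1}+\tfrac{d_2}{l_2},$$ and the associated matrices $$\tilde P_1=\begin{bmatrix}l_1&l_1&-l_2\\d_1&d_1+l_1d_0&d_2\end{bmatrix},\qquad\tilde P_2=\begin{bmatrix}l_2&l_2&-l_1\\d_2&d_2+l_2d_0&d_1\end{bmatrix}.$$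 Degree matrices $Q_1,Q_2$ are adjacent if: (i) there are a $3\times4$ projective generator matrix $P=\begin{bmatrix}-1&-1&l_1&0\\-1&-1&0&l_2\\0&d_0&d_1&d_2\end{bmatrix}$ with $1\le d_1\le l_1\le l_2$, $\gcd(l_i,d_i)=1$, $d_0+\tfrac{d_1}{l_1}+\tfrac{d_2}{l_2}<0<\tfrac{d_1}{l_1}+\tfrac{d_2}{l_2}$, and corresponding generator matrices $P_1$ of $Q_1$ and $P_2$ of $Q_2$ such that $P_1,P_2$ are the matrices $\tilde P_1,\tilde P_2$ associated with $P$ (in some order); (ii) $w_0\le w_1$ holds for the first two components, which are common to $w(Q_1)$ and $w(Q_2)$; (iii) up to permuting columns, each of $Q_1,Q_2$ is adjusted. *)

theory Defs
  imports "HOL-Analysis.Analysis" "HOL-Algebra.Elementary_Groups" "HOL-Computational_Algebra.Polynomial"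
begin

text \<open>
  Conventions. The lattice is \<open>N = \<int>\<^sup>n\<close>, realised as \<open>int ^ 'n\<close> inside \<open>real ^ 'n\<close>, and the dual
  lattice is \<open>M = \<int>\<^sup>n\<close>, paired with \<open>N\<close> by the standard inner product. The index type \<open>3\<close> is
  numbered \<open>1, 2, 3\<close>, so the mathematical indices \<open>0, 1, 2\<close> appear here as \<open>1, 2, 3\<close>.
\<close>

definition real_vec :: "int ^ 'n \<Rightarrow> real ^ 'n" where
  "real_vec v = (\<chi> i. real_of_int (v $ i))"

definition primitive_vec :: "int ^ 'n \<Rightarrow> bool" where
  "primitive_vec v \<longleftrightarrow> Gcd (range (\<lambda>i. v $ i)) = 1"

definition pairing :: "int ^ 'n \<Rightarrow> int ^ 'n \<Rightarrow> int" where
  "pairing m v = (\<Sum>i\<in>UNIV. m $ i * v $ i)"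


section \<open>Fans and toric varieties\<close>

definition rational_cone :: "(real ^ 'n) set \<Rightarrow> bool" where
  "rational_cone \<sigma> \<longleftrightarrow> (\<exists>F. finite F \<and> \<sigma> = convex_cone hull (real_vec ` F))"

definition pointed_cone :: "(real ^ 'n) set \<Rightarrow> bool" where
  "pointed_cone \<sigma> \<longleftrightarrow> (\<forall>x. x \<in> \<sigma> \<and> - x \<in> \<sigma> \<longrightarrow> x = 0)"

text \<open>In \<^const>\<open>face_of\<close> the empty set counts as a face; faces of cones are meant to be nonempty.\<close>

definition fan :: "(real ^ 'n) set set \<Rightarrow> bool" where
  "fan \<Sigma> \<longleftrightarrow> finite \<Sigma> \<and> \<Sigma> \<noteq> {} \<and>
     (\<forall>\<sigma>\<in>\<Sigma>. rational_cone \<sigma> \<and> pointed_cone \<sigma>) \<and>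
     (\<forall>\<sigma>\<in>\<Sigma>. \<forall>\<tau>. \<tau> face_of \<sigma> \<and> \<tau> \<noteq> {} \<longrightarrow> \<tau> \<in> \<Sigma>) \<and>
     (\<forall>\<sigma>\<in>\<Sigma>. \<forall>\<tau>\<in>\<Sigma>. \<sigma> \<inter> \<tau> face_of \<sigma> \<and> \<sigma> \<inter> \<tau> face_of \<tau>)"

text \<open>
  Varieties over an algebraically closed field are treated as spaces with functions: a topology on the
  set of closed points, and for every open set \<open>U\<close> the functions that are regular on \<open>U\<close>. Functions
  are total here; only their values on \<open>U\<close> matter for being regular on \<open>U\<close>.
\<close>

record ('p, 'k) space_with_functions =
  zariski :: "'p topology"
  regular_on :: "'p set \<Rightarrow> ('p \<Rightarrow> 'k) set"

definition isomorphic_spaces ::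
  "('p, 'k) space_with_functions \<Rightarrow> ('q, 'k) space_with_functions \<Rightarrow> bool" where
  "isomorphic_spaces X Y \<longleftrightarrow>
     (\<exists>\<phi>. homeomorphic_map (zariski X) (zariski Y) \<phi> \<and>
        (\<forall>V f. openin (zariski Y) V \<longrightarrow>
           (f \<in> regular_on Y V \<longleftrightarrow>
            f \<circ> \<phi> \<in> regular_on X {p \<in> topspace (zariski X). \<phi> p \<in> V})))"

definition cone_monoid :: "(real ^ 'n) set \<Rightarrow> (int ^ 'n) set" where
  "cone_monoid \<sigma> = {m. \<forall>x\<in>\<sigma>. real_vec m \<bullet> x \<ge> 0}"

text \<open>
  The closed points of the affine toric variety \<open>Spec k[\<sigma>\<^sup>\<or> \<inter> M]\<close> are the monoid homomorphisms from
  \<open>\<sigma>\<^sup>\<or> \<inter> M\<close> to the multiplicative monoid of \<open>k\<close>.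
\<close>

definition affine_toric_points :: "(real ^ 'n) set \<Rightarrow> (int ^ 'n \<Rightarrow> 'k::field) set" where
  "affine_toric_points \<sigma> =
     {\<gamma> \<in> cone_monoid \<sigma> \<rightarrow>\<^sub>E UNIV. \<gamma> 0 = 1 \<and>
        (\<forall>m\<in>cone_monoid \<sigma>. \<forall>m'\<in>cone_monoid \<sigma>. \<gamma> (m + m') = \<gamma> m * \<gamma> m')}"

definition affine_toric_functions :: "(real ^ 'n) set \<Rightarrow> ((int ^ 'n \<Rightarrow> 'k::field) \<Rightarrow> 'k) set" where
  "affine_toric_functions \<sigma> =
     {(\<lambda>\<gamma>. \<Sum>m\<in>F. c m * \<gamma> m) | F c. finite F \<and> F \<subseteq> cone_monoid \<sigma>}"

text \<open>
  The charts belonging to \<open>\<sigma>\<close> and \<open>\<sigma>'\<close> are glued along the one of \<open>\<sigma> \<inter> \<sigma>'\<close>, which sits in both by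
  restriction of monoid homomorphisms.
\<close>

type_synonym ('n, 'k) toric_point = "((real ^ 'n) set \<times> (int ^ 'n \<Rightarrow> 'k)) set"

definition toric_glue ::
  "(real ^ 'n) set set \<Rightarrow>
     (((real ^ 'n) set \<times> (int ^ 'n \<Rightarrow> 'k::field)) \<times> ((real ^ 'n) set \<times> (int ^ 'n \<Rightarrow> 'k))) set" where
  "toric_glue \<Sigma> =
     {((\<sigma>, \<gamma>), (\<sigma>', \<gamma>')). \<sigma> \<in> \<Sigma> \<and> \<sigma>' \<in> \<Sigma> \<and>
        (\<exists>\<delta>\<in>affine_toric_points (\<sigma> \<inter> \<sigma>').
           \<gamma> = restrict \<delta> (cone_monoid \<sigma>) \<and> \<gamma>' = restrict \<delta> (cone_monoid \<sigma>'))}"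

definition toric_chart ::
  "(real ^ 'n) set set \<Rightarrow> (real ^ 'n) set \<Rightarrow> (int ^ 'n \<Rightarrow> 'k::field) \<Rightarrow> ('n, 'k) toric_point" where
  "toric_chart \<Sigma> \<sigma> \<gamma> = toric_glue \<Sigma> `` {(\<sigma>, \<gamma>)}"

text \<open>
  The principal open sets of the charts form a basis of the Zariski topology. A function is regular
  if locally, in some chart, it is a quotient of elements of the coordinate ring.
\<close>

definition toric_topology :: "(real ^ 'n) set set \<Rightarrow> ('n, 'k::field) toric_point topology" where
  "toric_topology \<Sigma> = topology_generated_by
     {toric_chart \<Sigma> \<sigma> ` {\<gamma> \<in> affine_toric_points \<sigma>. f \<gamma> \<noteq> 0} | \<sigma> f.
        \<sigma> \<in> \<Sigma> \<and> f \<in> affine_toric_functions \<sigma>}"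

definition toric_regular ::
  "(real ^ 'n) set set \<Rightarrow> ('n, 'k::field) toric_point set \<Rightarrow> (('n, 'k) toric_point \<Rightarrow> 'k) set" where
  "toric_regular \<Sigma> U =
     {\<phi>. \<forall>p\<in>U. \<exists>\<sigma>\<in>\<Sigma>. \<exists>V. \<exists>f\<in>affine_toric_functions \<sigma>. \<exists>g\<in>affine_toric_functions \<sigma>.
        openin (toric_topology \<Sigma>) V \<and> p \<in> V \<and> V \<subseteq> U \<and> V \<subseteq> toric_chart \<Sigma> \<sigma> ` affine_toric_points \<sigma> \<and>
        (\<forall>\<gamma>\<in>affine_toric_points \<sigma>. toric_chart \<Sigma> \<sigma> \<gamma> \<in> V \<longrightarrow>
           g \<gamma> \<noteq> 0 \<and> \<phi> (toric_chart \<Sigma> \<sigma> \<gamma>) = f \<gamma> / g \<gamma>)}"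

definition toric_variety ::
  "(real ^ 'n) set set \<Rightarrow> (('n, 'k::field) toric_point, 'k) space_with_functions" where
  "toric_variety \<Sigma> = \<lparr>zariski = toric_topology \<Sigma>, regular_on = toric_regular \<Sigma>\<rparr>"


section \<open>Divisors and fake weighted projective planes\<close>

text \<open>
  A torus invariant Weil divisor is a function on the primitive ray generators of the fan; its values
  elsewhere are irrelevant.
\<close>

definition ray_gens :: "(real ^ 'n) set set \<Rightarrow> (int ^ 'n) set" where
  "ray_gens \<Sigma> = {v. primitive_vec v \<and> convex_cone hull {real_vec v} \<in> \<Sigma>}"

definition principal_divisor :: "(real ^ 'n) set set \<Rightarrow> (int ^ 'n \<Rightarrow> int) \<Rightarrow> bool" where
  "principal_divisor \<Sigma> D \<longleftrightarrow> (\<exists>m. \<forall>v\<in>ray_gens \<Sigma>. D v = pairing m v)"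

definition cartier_divisor :: "(real ^ 'n) set set \<Rightarrow> (int ^ 'n \<Rightarrow> int) \<Rightarrow> bool" where
  "cartier_divisor \<Sigma> D \<longleftrightarrow>
     (\<forall>\<sigma>\<in>\<Sigma>. \<exists>m. \<forall>v\<in>ray_gens \<Sigma>. real_vec v \<in> \<sigma> \<longrightarrow> D v = pairing m v)"

definition q_factorial_fan :: "(real ^ 'n) set set \<Rightarrow> bool" where
  "q_factorial_fan \<Sigma> \<longleftrightarrow> (\<forall>D. \<exists>k::int. k > 0 \<and> cartier_divisor \<Sigma> (\<lambda>v. k * D v))"

text \<open>
  The toric variety is projective iff the fan is complete and carries a strictly convex integral
  support function, that is, an ample divisor.
\<close>

definition projective_fan :: "(real ^ 'n) set set \<Rightarrow> bool" where
  "projective_fan \<Sigma> \<longleftrightarrow> \<Union>\<Sigma> = UNIV \<and>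
     (\<exists>\<psi>. \<forall>\<sigma>\<in>\<Sigma>. (\<forall>\<tau>\<in>\<Sigma>. \<not> \<sigma> \<subset> \<tau>) \<longrightarrow>
        (\<exists>m :: int ^ 'n. (\<forall>x\<in>\<sigma>. \<psi> x = real_vec m \<bullet> x) \<and> (\<forall>x. x \<notin> \<sigma> \<longrightarrow> \<psi> x < real_vec m \<bullet> x)))"

text \<open>
  The Picard group is the group of invariant Cartier divisors modulo principal ones, and the Picard
  number is its rank: the supremum of the sizes of families that are independent over \<open>\<int>\<close>.
\<close>

definition picard_number :: "(real ^ 'n) set set \<Rightarrow> enat" where
  "picard_number \<Sigma> = Sup {enat k | k.
     \<exists>D :: nat \<Rightarrow> int ^ 'n \<Rightarrow> int. (\<forall>i<k. cartier_divisor \<Sigma> (D i)) \<and>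
       (\<forall>c :: nat \<Rightarrow> int. principal_divisor \<Sigma> (\<lambda>v. \<Sum>i<k. c i * D i v) \<longrightarrow> (\<forall>i<k. c i = 0))}"

definition fake_weighted_projective_plane :: "(real ^ 2) set set \<Rightarrow> bool" where
  "fake_weighted_projective_plane \<Sigma> \<longleftrightarrow>
     fan \<Sigma> \<and> q_factorial_fan \<Sigma> \<and> projective_fan \<Sigma> \<and> picard_number \<Sigma> = 1"

text \<open>
  Intersection numbers \<open>B v w = D\<^sub>v \<cdot> D\<^sub>w\<close> of the invariant prime divisors of a complete toric
  surface: distinct divisors meet iff their rays span a cone, in a point of multiplicity the index of
  the sublattice generated by \<open>v\<close> and \<open>w\<close>; principal divisors are numerically trivial.
\<close>

definition intersection_numbers :: "(real ^ 2) set set \<Rightarrow> (int ^ 2 \<Rightarrow> int ^ 2 \<Rightarrow> rat) \<Rightarrow> bool" where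
  "intersection_numbers \<Sigma> B \<longleftrightarrow>
     (\<forall>v\<in>ray_gens \<Sigma>. \<forall>w\<in>ray_gens \<Sigma>. v \<noteq> w \<longrightarrow>
        B v w = (if convex_cone hull {real_vec v, real_vec w} \<in> \<Sigma>
                 then 1 / of_int \<bar>det (vector [v, w] :: int ^ 2 ^ 2)\<bar> else 0)) \<and>
     (\<forall>m. \<forall>v\<in>ray_gens \<Sigma>. (\<Sum>w\<in>ray_gens \<Sigma>. of_int (pairing m w) * B v w) = 0)"

text \<open>The degree is the self-intersection of the canonical divisor \<open>- \<Sum>\<^sub>v D\<^sub>v\<close>.\<close>

definition canonical_degree :: "(real ^ 2) set set \<Rightarrow> rat" where
  "canonical_degree \<Sigma> =
     (THE c. \<exists>B. intersection_numbers \<Sigma> B \<and>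
        c = (\<Sum>v\<in>ray_gens \<Sigma>. \<Sum>w\<in>ray_gens \<Sigma>. (-1) * (-1) * B v w))"


section \<open>Generator matrices and degree matrices\<close>

definition projective_generator_matrix :: "int ^ 'm ^ 'n \<Rightarrow> bool" where
  "projective_generator_matrix P \<longleftrightarrow> CARD('m) = CARD('n) + 1 \<and>
     inj (\<lambda>j. column j P) \<and> (\<forall>j. primitive_vec (column j P)) \<and>
     (\<forall>x :: rat ^ 'n. \<exists>c :: rat ^ 'm. (\<forall>j. c $ j \<ge> 0) \<and>
        x = (\<chi> i. \<Sum>j\<in>UNIV. c $ j * of_int (P $ i $ j)))"

definition fan_of_matrix :: "int ^ 'm ^ 'n \<Rightarrow> (real ^ 'n) set set" where
  "fan_of_matrix P =
     {\<tau>. \<tau> \<noteq> {} \<and> (\<exists>i. \<tau> face_of convex_cone hull ((\<lambda>j. real_vec (column j P)) ` (UNIV - {i})))}"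

text \<open>
  A pair \<open>(\<mu>, q)\<close> stands for the matrix with columns \<open>q\<^sub>i = (u\<^sub>i, \<eta>\<^sub>i)\<close> in \<open>K = \<int> \<oplus> \<int>/\<mu>\<int>\<close>, classes
  modulo \<open>\<mu>\<close> being represented in \<open>{0..<\<mu>}\<close>. For \<open>\<mu> = 1\<close> the second row is zero.
\<close>

type_synonym deg_matrix = "nat \<times> ((int \<times> int) ^ 3)"

definition degree_group :: "nat \<Rightarrow> (int \<times> int) monoid" where
  "degree_group \<mu> = integer_group \<times>\<times> integer_mod_group \<mu>"

definition degree_matrix :: "deg_matrix \<Rightarrow> bool" where
  "degree_matrix Q \<longleftrightarrow> (case Q of (\<mu>, q) \<Rightarrow>
     \<mu> \<ge> 1 \<and>
     (\<forall>i. q $ i \<in> carrier (degree_group \<mu>) \<and> fst (q $ i) > 0) \<and>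
     (\<forall>i j. i \<noteq> j \<longrightarrow> generate (degree_group \<mu>) {q $ i, q $ j} = carrier (degree_group \<mu>)))"

definition fake_weight :: "deg_matrix \<Rightarrow> int ^ 3" where
  "fake_weight Q = (case Q of (\<mu>, q) \<Rightarrow>
     (\<chi> i. int (card (rcosets\<^bsub>degree_group \<mu>\<^esub> (generate (degree_group \<mu>) {q $ i})))))"

definition degree_map :: "deg_matrix \<Rightarrow> int ^ 3 \<Rightarrow> int \<times> int" where
  "degree_map Q x = (case Q of (\<mu>, q) \<Rightarrow>
     (\<Sum>i\<in>UNIV. x $ i * fst (q $ i), (\<Sum>i\<in>UNIV. x $ i * snd (q $ i)) mod int \<mu>))"

text \<open>Exactness of \<open>0 \<rightarrow> \<int>\<^sup>2 \<rightarrow> \<int>\<^sup>3 \<rightarrow> K \<rightarrow> 0\<close>, the first map being the transpose of \<open>P\<close>.\<close>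

definition corresponding :: "int ^ 3 ^ 2 \<Rightarrow> deg_matrix \<Rightarrow> bool" where
  "corresponding P Q \<longleftrightarrow> projective_generator_matrix P \<and> degree_matrix Q \<and>
     inj (\<lambda>m. transpose P *v m) \<and>
     range (\<lambda>m. transpose P *v m) = {x. degree_map Q x = (0, 0)} \<and>
     range (degree_map Q) = carrier (degree_group (fst Q))"

text \<open>Different choices of the corresponding matrix give isomorphic toric varieties.\<close>

definition toric_variety_of_degree_matrix ::
  "deg_matrix \<Rightarrow> ((2, 'k::field) toric_point, 'k) space_with_functions" where
  "toric_variety_of_degree_matrix Q = toric_variety (fan_of_matrix (SOME P. corresponding P Q))"


section \<open>Adjusted and adjacent degree matrices\<close>

definition weight_solutions :: "int \<Rightarrow> (int ^ 3) set" where
  "weight_solutions a =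
     {w. (\<forall>i. w $ i > 0) \<and> (w $ 1 + w $ 2 + w $ 3)\<^sup>2 = a * (w $ 1 * w $ 2 * w $ 3)}"

definition weight_gcd :: "int ^ 3 \<Rightarrow> int" where
  "weight_gcd w = Gcd (range (\<lambda>i. w $ i))"

definition reduced_weight :: "int ^ 3 \<Rightarrow> int ^ 3" where
  "reduced_weight w = (\<chi> i. w $ i div weight_gcd w)"

definition adjusted_weight :: "int \<Rightarrow> int ^ 3 \<Rightarrow> bool" where
  "adjusted_weight a w \<longleftrightarrow> w \<in> weight_solutions a \<and>
     (let \<mu> = weight_gcd w; u = reduced_weight w in
        (\<mu> * a = 9 \<longrightarrow> u $ 1 \<le> u $ 2 \<and> u $ 2 \<le> u $ 3) \<and>
        (\<mu> * a = 8 \<longrightarrow> u $ 1 \<le> u $ 2 \<and> 2 dvd u $ 3) \<and>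
        (\<mu> * a = 6 \<longrightarrow> 2 dvd u $ 2 \<and> 3 dvd u $ 3) \<and>
        (\<mu> * a = 5 \<longrightarrow> u $ 1 \<le> u $ 2 \<and> 5 dvd u $ 3))"

definition adjusted :: "deg_matrix \<Rightarrow> bool" where
  "adjusted Q \<longleftrightarrow> degree_matrix Q \<and>
     (\<exists>a. adjusted_weight a (fake_weight Q) \<and>
        (a \<le> 4 \<longrightarrow>
           (let \<mu> = weight_gcd (fake_weight Q); u = reduced_weight (fake_weight Q) in
              \<exists>\<eta>. 1 \<le> \<eta> \<and> \<eta> < \<mu> \<and>
                Q = (nat \<mu>, vector [(u $ 1, 0), (u $ 2, 1), (u $ 3, \<eta>)]) \<and>
                (u = vector [1, 1, 1] \<longrightarrow> \<eta> = 2) \<and>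
                (u = vector [1, 1, 4] \<longrightarrow> \<eta> \<in> {2, 5}) \<and>
                (u = vector [1, 1, 2] \<longrightarrow> \<eta> \<in> {1, 3, 5}))))"

definition permute_columns :: "(3 \<Rightarrow> 3) \<Rightarrow> deg_matrix \<Rightarrow> deg_matrix" where
  "permute_columns p Q = (fst Q, \<chi> i. snd Q $ p i)"

definition adjacency_matrix :: "int \<Rightarrow> int \<Rightarrow> int \<Rightarrow> int \<Rightarrow> int \<Rightarrow> int ^ 4 ^ 3" where
  "adjacency_matrix l1 l2 d0 d1 d2 =
     vector [vector [-1, -1, l1,  0],
             vector [-1, -1,  0, l2],
             vector [ 0, d0, d1, d2]]"

text \<open>
  With \<open>l1, d1\<close> and \<open>l2, d2\<close> interchanged this also yields the second associated matrix.
\<close>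

definition associated_matrix :: "int \<Rightarrow> int \<Rightarrow> int \<Rightarrow> int \<Rightarrow> int \<Rightarrow> int ^ 3 ^ 2" where
  "associated_matrix l1 l2 d0 d1 d2 =
     vector [vector [l1, l1, - l2],
             vector [d1, d1 + l1 * d0, d2]]"

definition adjacency_data :: "int \<Rightarrow> int \<Rightarrow> int \<Rightarrow> int \<Rightarrow> int \<Rightarrow> bool" where
  "adjacency_data l1 l2 d0 d1 d2 \<longleftrightarrow>
     projective_generator_matrix (adjacency_matrix l1 l2 d0 d1 d2) \<and>
     1 \<le> d1 \<and> d1 \<le> l1 \<and> l1 \<le> l2 \<and> gcd l1 d1 = 1 \<and> gcd l2 d2 = 1 \<and>
     of_int d0 + of_int d1 / of_int l1 + of_int d2 / of_int l2 < (0::rat) \<and>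
     (0::rat) < of_int d1 / of_int l1 + of_int d2 / of_int l2"

definition adjacent :: "deg_matrix \<Rightarrow> deg_matrix \<Rightarrow> bool" where
  "adjacent Q1 Q2 \<longleftrightarrow> degree_matrix Q1 \<and> degree_matrix Q2 \<and>
     (\<exists>l1 l2 d0 d1 d2. \<exists>P1 P2. adjacency_data l1 l2 d0 d1 d2 \<and>
        corresponding P1 Q1 \<and> corresponding P2 Q2 \<and>
        (P1 = associated_matrix l1 l2 d0 d1 d2 \<and> P2 = associated_matrix l2 l1 d0 d2 d1 \<or>
         P2 = associated_matrix l1 l2 d0 d1 d2 \<and> P1 = associated_matrix l2 l1 d0 d2 d1)) \<and>
     (fake_weight Q1 $ 1 = fake_weight Q2 $ 1 \<and> fake_weight Q1 $ 2 = fake_weight Q2 $ 2 \<and>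
      fake_weight Q1 $ 1 \<le> fake_weight Q1 $ 2) \<and>
     (\<exists>p. bij p \<and> adjusted (permute_columns p Q1)) \<and>
     (\<exists>p. bij p \<and> adjusted (permute_columns p Q2))"

end

theory Submission
  imports Defs
begin

text \<open>
  A fake weighted projective plane is given by three primitive vectors \<open>v\<^sub>0, v\<^sub>1, v\<^sub>2\<close> spanning the plane
  as a cone. With \<open>w\<^sub>i = \<bar>det (v\<^sub>j, v\<^sub>k)\<bar>\<close> one has \<open>\<Sum> w\<^sub>i v\<^sub>i = 0\<close> and the degree is
  \<open>a = (w\<^sub>0 + w\<^sub>1 + w\<^sub>2)\<^sup>2 / (w\<^sub>0 w\<^sub>1 w\<^sub>2)\<close>. Write \<open>w = \<mu> u\<close> with \<open>u\<close> primitive. Vieta descent applied to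
  \<open>(u\<^sub>0 + u\<^sub>1 + u\<^sub>2)\<^sup>2 = \<mu> a u\<^sub>0 u\<^sub>1 u\<^sub>2\<close> gives \<open>\<mu> a \<in> {5, 6, 8, 9}\<close> and shows that the residues of \<open>u\<close> modulo
  the primes dividing \<open>\<mu> a\<close> are those of the minimal solution.

  Let \<open>g\<close> be the lattice length of the segment from \<open>v\<^sub>0\<close> to \<open>v\<^sub>1\<close> and \<open>L\<close> the lattice distance of its line
  from the origin. If \<open>v\<^sub>2\<close> is the vertex singled out by the residues, then \<open>L\<close> divides \<open>g\<close>, and this is
  precisely what is needed to bring \<open>[v\<^sub>0, v\<^sub>1, v\<^sub>2]\<close> by a unimodular map into the shape of one of the two
  matrices associated with an adjacency matrix. The other associated matrix has the weights \<open>w\<^sub>0, w\<^sub>1\<close>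
  and \<open>(w\<^sub>0 + w\<^sub>1)\<^sup>2 / w\<^sub>2\<close>, hence the same degree. The residues finally allow every degree matrix of
  integral degree to be normalised to an adjusted one.
\<close>


section \<open>The equation \<open>(x + y + z)\<^sup>2 = b x y z\<close>\<close>

text \<open>The shape of the associated matrices explains the condition that L divides g. Their
  first two columns (l1, d1) and (l1, d1 + l1 d0) lie at height l1 and differ by l1 d0, so the edge
  length is a multiple of the height. Conversely, g = L D allows d0 = -D, and the only freedom left,
  a shear along the edge, achieves 1 \<le> d1 \<le> l1 for the smaller of the two heights.
  Adjustedness is a condition on Q, adjacency one on P. They do not interfere: adjusting uses
  automorphisms of \<int> \<oplus> \<int>/\<mu>\<int> applied to all columns of Q, and these leave
  the exact sequence, hence P, untouched. A permutation of columns is allowed by the definition of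
  adjacency itself. Since the variety of a degree matrix is defined through an arbitrary choice of
  P, it is also needed that two choices differ by a unimodular matrix and that such a matrix induces
  an isomorphism of spaces with functions. The same fact absorbs the change of coordinates that
  brings the triangle into normal form.\<close>

definition residue_pattern :: "int \<Rightarrow> int \<Rightarrow> int \<Rightarrow> int \<Rightarrow> bool" where
  "residue_pattern b x y z \<longleftrightarrow>
     b = 9 \<and> x mod 3 = 1 \<and> y mod 3 = 1 \<and> z mod 3 = 1 \<or>
     b = 8 \<and> odd x \<and> odd y \<and> even z \<or>
     b = 6 \<and> x mod 6 = 1 \<and> y mod 6 = 2 \<and> z mod 6 = 3 \<or>
     b = 5 \<and> x mod 5 = 1 \<and> y mod 5 = 4 \<and> z mod 5 = 0"

text \<open>The minimal solutions are (1,1,1), (1,1,2), (1,2,3), (1,4,5) for b = 9, 8, 6, 5. The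
  last slot of \<open>residue_pattern\<close> marks the special vertex, so the order matters there;
  the descent reorders entries, so it is forgotten here.\<close>

definition residue_type :: "int \<Rightarrow> int \<Rightarrow> int \<Rightarrow> int \<Rightarrow> bool" where
  "residue_type b x y z \<longleftrightarrow>
     residue_pattern b x y z \<or> residue_pattern b x z y \<or> residue_pattern b y x z \<or>
     residue_pattern b y z x \<or> residue_pattern b z x y \<or> residue_pattern b z y x"

lemma residue_type_swap:
  "residue_type b x y z \<longleftrightarrow> residue_type b y x z"
  "residue_type b x y z \<longleftrightarrow> residue_type b x z y"
  unfolding residue_type_def by blast+

text \<open>
  Exchanging one root of the equation, quadratic in \<open>z\<close>, for the other keeps all residues.
\<close>

lemma residue_pattern_mutation:
  assumes "z + z' = b * x * y - 2 * (x + y)"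
  shows "residue_pattern b x y z' \<Longrightarrow> residue_pattern b x y z"
    and "residue_pattern b x z' y \<Longrightarrow> residue_pattern b x z y"
    and "residue_pattern b z' x y \<Longrightarrow> residue_pattern b z x y"
proof -
  have z: "z = b * (x * y) - 2 * (x + y) - z'"
    using assms by (simp add: algebra_simps)
  have "(m * k * p - 2 * (x + y) - z') mod m = (- 2 * (x mod m + y mod m) - z' mod m) mod m" for m k p
  proof -
    have "m * k * p - 2 * ((m * i + r) + (m * j + s)) - (m * l + t) =
        (- 2 * (r + s) - t) + m * (k * p - 2 * i - 2 * j - l)" for i j l r s t
      by (simp add: algebra_simps)
    from this[of "x div m" "x mod m" "y div m" "y mod m" "z' div m" "z' mod m"]
    show ?thesis by (metis mod_mult_self2 mult_div_mod_eq)
  qed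
  \<comment> \<open>The modulus m divides b = m k, so z = -2(x + y) - z' modulo m. The patterns
    modulo 6, 5 and 3 have entry sums s with 2s = 0 modulo m, so the right side is again the residue
    of z'. For b = 8 only parity is tracked.\<close>
  from this[of 6 1] this[of 5 1] this[of 3 3] have mods:
    "(6 * p - 2 * (x + y) - z') mod 6 = (- 2 * (x mod 6 + y mod 6) - z' mod 6) mod 6"
    "(5 * p - 2 * (x + y) - z') mod 5 = (- 2 * (x mod 5 + y mod 5) - z' mod 5) mod 5"
    "(9 * p - 2 * (x + y) - z') mod 3 = (- 2 * (x mod 3 + y mod 3) - z' mod 3) mod 3"
    "even (8 * p - 2 * (x + y) - z') = even z'" for p
    by simp_all
  show "residue_pattern b x y z' \<Longrightarrow> residue_pattern b x y z"
       "residue_pattern b x z' y \<Longrightarrow> residue_pattern b x z y"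
       "residue_pattern b z' x y \<Longrightarrow> residue_pattern b z x y"
    unfolding residue_pattern_def z by (elim disjE conjE; simp only: mods; simp)+
qed

text \<open>The finite search behind \<open>minimal_solutions\<close>. The range of b x and the
  bound on y are the inequalities derived there; they keep the evaluation small.\<close>

lemma minimal_solutions_check:
  "list_all (\<lambda>(b, x). list_all (\<lambda>y. list_all (\<lambda>z.
     (x + y + z)\<^sup>2 = b * x * y * z \<longrightarrow> gcd (gcd x y) z = 1 \<longrightarrow>
     (b, x, y, z) \<in> set [(9, 1, 1, 1), (8, 1, 1, 2), (6, 1, 2, 3), (5, 1, 4, 5)]) [y..x + y]) [x..5 * x div (b * x - 4)])
   (filter (\<lambda>(b, x). 5 \<le> b * x \<and> b * x \<le> 9) (List.product [1..9] [1..9 :: int]))"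
  by code_simp

text \<open>On y \<le> z \<le> x + y the quotient (x + y + z)^2 / z, which equals b x y, decreases
  in z. The endpoint z = x + y gives 4(x + y) \<le> b x y, hence b x \<ge> 5. The endpoint z = y
  gives b x y^2 \<le> (x + 2y)^2, hence b x \<le> 9 and a bound on y.\<close>

lemma minimal_solutions:
  fixes b x y z :: int
  assumes eq: "(x + y + z)\<^sup>2 = b * x * y * z" and pos: "0 < x" and ord: "x \<le> y" "y \<le> z" "z \<le> x + y"
    and gcd1: "gcd (gcd x y) z = 1"
  shows "(b, x, y, z) \<in> {(9, 1, 1, 1), (8, 1, 1, 2), (6, 1, 2, 3), (5, 1, 4, 5)}"
proof -
  have y: "0 < y" and z: "0 < z" using pos ord by auto
  \<comment> \<open>The product equals (x + 2y)^2 z - (x + y + z)^2 y.\<close>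
  have "0 \<le> (z - y) * ((x + y)\<^sup>2 - y * z)"
    using ord y z pos by (intro mult_nonneg_nonneg) (auto simp: power2_eq_square intro!: mult_mono)
  hence "(x + y + z)\<^sup>2 * y \<le> (x + 2 * y)\<^sup>2 * z"
    by (simp add: power2_eq_square algebra_simps)
  moreover have "(x + y + z)\<^sup>2 * y = (b * x * y\<^sup>2) * z"
    unfolding eq by (simp add: power2_eq_square)
  ultimately have "(b * x * y\<^sup>2) * z \<le> (x + 2 * y)\<^sup>2 * z" by simp
  hence le: "b * x * y\<^sup>2 \<le> (x + 2 * y)\<^sup>2"
    using z by simp
  also have "\<dots> \<le> (3 * y)\<^sup>2"
    using ord pos by (intro power_mono) auto
  also have "\<dots> = 9 * y\<^sup>2" by (simp add: power2_eq_square)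
  finally have bx9: "b * x \<le> 9" using y by simp
  have "0 \<le> (x + y - z)\<^sup>2" by simp
  hence "4 * (x + y) * z \<le> b * x * y * z"
    unfolding eq[symmetric] by (simp add: power2_eq_square algebra_simps)
  hence ge: "4 * (x + y) \<le> b * x * y" using z by simp
  hence "4 * y < (b * x) * y" using pos by (simp add: algebra_simps)
  hence bx5: "5 \<le> b * x" using y by (simp add: mult_less_cancel_right)
  have "0 < b" using bx5 pos by (metis less_le_trans zero_less_mult_pos2 zero_less_numeral)
  have "b * 1 \<le> b * x" "1 * x \<le> b * x"
    using \<open>0 < b\<close> pos by (intro mult_left_mono mult_right_mono; simp)+
  hence "b \<le> 9" "x \<le> 9" using bx9 by auto
  have "(b * x - 4) * y * y \<le> x * x + 4 * x * y"
    using le by (simp add: power2_eq_square algebra_simps)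
  also have "\<dots> \<le> 5 * x * y" using ord pos mult_left_mono[of x y x] by simp
  finally have "(b * x - 4) * y \<le> 5 * x" using y by (simp add: mult_le_cancel_right)
  hence "(b * x - 4) * y div (b * x - 4) \<le> 5 * x div (b * x - 4)"
    using bx5 by (intro zdiv_mono1) auto
  hence "y \<le> 5 * x div (b * x - 4)" using bx5 by simp
  hence "(b, x, y, z) \<in> set [(9, 1, 1, 1), (8, 1, 1, 2), (6, 1, 2, 3), (5, 1, 4, 5)]"
    using minimal_solutions_check[unfolded list_all_iff, rule_format, of "(b, x)", simplified case_prod_conv, rule_format, of y z]
      ord eq gcd1 \<open>0 < b\<close> \<open>b \<le> 9\<close> \<open>x \<le> 9\<close> pos bx5 bx9 by simp
  thus ?thesis by simp
qed

text \<open>For sorted p \<le> q \<le> r the second root r' satisfies r r' = (p + q)^2, so it is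
  smaller than r exactly when r > p + q. The descent therefore stops precisely where
  \<open>minimal_solutions\<close> applies.\<close>

lemma primitive_solution_residues:
  fixes b x y z :: int
  assumes "(x + y + z)\<^sup>2 = b * x * y * z" "0 < x" "0 < y" "0 < z" "gcd (gcd x y) z = 1"
  shows "residue_type b x y z"
  using assms
proof (induction "nat (x + y + z)" arbitrary: x y z rule: less_induct)
  case less
  have sorted: "residue_type b p q r"
    if pqr: "p \<le> q" "q \<le> r" "0 < p" "(p + q + r)\<^sup>2 = b * p * q * r"
      "gcd (gcd p q) r = 1" and sum: "p + q + r = x + y + z" for p q r
  proof (cases "r \<le> p + q")
    case True
    show ?thesis
      using minimal_solutions[OF pqr(4) pqr(3) pqr(1,2) True pqr(5)]
      by (elim insertE emptyE) (simp_all add: residue_type_def residue_pattern_def)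
  next
    case False
    define r' where "r' = b * p * q - 2 * (p + q) - r"
    have prod: "r * r' = (p + q)\<^sup>2"
      using pqr(4) by (simp add: r'_def power2_eq_square algebra_simps)
    have "0 < r'"
      using prod pqr by (metis add_pos_pos less_le_trans zero_less_mult_pos zero_less_power)
    have "r' < r"
    proof (rule ccontr)
      assume "\<not> r' < r"
      hence "(p + q) * (p + q) < r * r'"
        using False pqr by (intro mult_strict_mono) auto
      thus False using prod by (simp add: power2_eq_square)
    qed
    have "(p + q + r')\<^sup>2 = b * p * q * r'"
      using prod by (simp add: r'_def power2_eq_square algebra_simps)
    moreover have "gcd (gcd p q) r' = 1"
    proof -
      have r: "r = b * p * q - 2 * (p + q) - r'" by (simp add: r'_def)
      have dvd: "gcd (gcd p q) r' dvd p" "gcd (gcd p q) r' dvd q" by (meson dvd_trans gcd_dvd1 gcd_dvd2)+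
      hence "gcd (gcd p q) r' dvd r" by (subst r) (intro dvd_diff dvd_mult dvd_add; simp)
      hence "gcd (gcd p q) r' dvd gcd (gcd p q) r" using dvd by simp
      thus ?thesis using pqr(5) by simp
    qed
    ultimately have "residue_type b p q r'"
      using less.hyps[of p q r'] sum pqr \<open>0 < r'\<close> \<open>r' < r\<close> by auto
    thus ?thesis
      using residue_pattern_mutation[of r r' b p q] residue_pattern_mutation[of r r' b q p]
      unfolding residue_type_def r'_def by (auto simp: algebra_simps)
  qed
  have perm:
    "(x + z + y)\<^sup>2 = b * x * z * y" "gcd (gcd x z) y = 1"
    "(y + x + z)\<^sup>2 = b * y * x * z" "gcd (gcd y x) z = 1"
    "(y + z + x)\<^sup>2 = b * y * z * x" "gcd (gcd y z) x = 1"
    "(z + x + y)\<^sup>2 = b * z * x * y" "gcd (gcd z x) y = 1"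
    "(z + y + x)\<^sup>2 = b * z * y * x" "gcd (gcd z y) x = 1"
    using less.prems(1,5) by (simp_all add: algebra_simps gcd.commute gcd.left_commute)
  consider "x \<le> y" "y \<le> z" | "x \<le> z" "z \<le> y" | "y \<le> x" "x \<le> z" | "y \<le> z" "z \<le> x" | "z \<le> x" "x \<le> y" | "z \<le> y" "y \<le> x"
    by linarith
  hence "residue_type b x y z \<or> residue_type b x z y \<or> residue_type b y x z \<or>
      residue_type b y z x \<or> residue_type b z x y \<or> residue_type b z y x"
    using sorted[of x y z] sorted[of x z y] sorted[of y x z] sorted[of y z x] sorted[of z x y] sorted[of z y x]
      perm less.prems by cases simp_all
  thus ?case
    using residue_type_swap by blast
qed


section \<open>Divisibility at a special vertex\<close>

lemma small_divisor_cases: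
  fixes h :: int assumes "0 < h" 
  shows "h dvd 5 \<Longrightarrow> h \<in> {1, 5}" "h dvd 6 \<Longrightarrow> h \<in> {1, 2, 3, 6}" "h dvd 8 \<Longrightarrow> h \<in> {1, 2, 4, 8}"
    "h dvd 9 \<Longrightarrow> h \<in> {1, 3, 9}"
proof -
  have le: "h \<in> {1..int n}" if "h dvd int n" "n > 0" for n
    using assms zdvd_imp_le[OF that(1)] that(2) by auto
  have e: "{1..int 5} = {1,2,3,4,5}" "{1..int 6} = {1,2,3,4,5,6}" "{1..int 8} = {1,2,3,4,5,6,7,8}" "{1..int 9} = {1,2,3,4,5,6,7,8,9}"
    by auto
  show "h dvd 5 \<Longrightarrow> h \<in> {1, 5}" "h dvd 6 \<Longrightarrow> h \<in> {1, 2, 3, 6}" "h dvd 8 \<Longrightarrow> h \<in> {1, 2, 4, 8}"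
    "h dvd 9 \<Longrightarrow> h \<in> {1, 3, 9}"
    using le[of 5, unfolded e] le[of 6, unfolded e] le[of 8, unfolded e] le[of 9, unfolded e] by auto
qed

text \<open>Modulo 3: l^2 k = 1 gives k = 1, and m = -l turns l z + m y = 1 into z = y + l. Since y
  is neither 0 nor l k = l, it is -l, and so z = 0.\<close>

lemma no_residues_mod_3:
  fixes l m k y z :: int
  assumes "l \<in> {0,1,2}" "m \<in> {0,1,2}" "k \<in> {0,1,2}" "y \<in> {0,1,2}" "z \<in> {0,1,2}"
    "l * l mod 3 * k mod 3 = 1" "(l + m) mod 3 = 0" "(l * z mod 3 + m * y mod 3) mod 3 = 1" "(y - l * k mod 3) mod 3 \<noteq> 0" "y \<noteq> 0" "z \<noteq> 0"
  shows False
proof -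
  have "(l, m, k) \<in> {(1, 2, 1), (2, 1, 1)}"
    using assms(1-3,6,7) by auto
  thus False using assms(4,5,8-) by auto
qed
lemma residue_mod_3_cases: "x mod 3 \<in> {0, 1, 2 :: int}"
  using pos_mod_bound[of 3 x] pos_mod_sign[of 3 x] unfolding insert_iff empty_iff by linarith

text \<open>
  In suitable lattice coordinates the triangle has vertices \<open>(L, y)\<close>, \<open>(L, y - g)\<close> and \<open>(- M, z)\<close>, and its
  weights are \<open>\<mu> u\<^sub>0, \<mu> u\<^sub>1, \<mu> u\<^sub>2\<close>. The conclusion \<open>L dvd g\<close> says that the cone over the first two
  vertices is a T-singularity. A prime can violate it only if it divides \<open>h = gcd L M\<close>, hence \<open>\<mu>\<close>.
\<close>

lemma special_vertex_divides:
  fixes L M g y z a \<mu> u0 u1 u2 :: int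
  assumes pos: "0 < L" "0 < M" "0 < g" "0 < \<mu>" "0 < a"
    and prim: "gcd L y = 1" "gcd L (y - g) = 1" "gcd M z = 1"
    and w0: "\<mu> * u0 = g * M - (L * z + M * y)"
    and w1: "\<mu> * u1 = L * z + M * y"
    and w2: "\<mu> * u2 = g * L"
    and gcd1: "gcd (gcd u0 u1) u2 = 1"
    and eq: "(\<mu> * u0 + \<mu> * u1 + \<mu> * u2)\<^sup>2 = a * (\<mu> * u0) * (\<mu> * u1) * (\<mu> * u2)"
    and special: "residue_pattern (\<mu> * a) u0 u1 u2"
  shows "L dvd g"
proof -
  define h where "h = gcd L M"
  have "0 < h" using pos by (simp add: h_def)
  obtain L' M' where L: "L = h * L'" and M: "M = h * M'" and cop: "coprime L' M'"
    using gcd_coprime_exists[of L M] pos unfolding h_def by (metis gcd_eq_0_iff less_irrefl mult.commute)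
  have copsum: "coprime L' (L' + M')" using cop by (simp add: coprime_iff_gcd_eq_1)
  \<comment> \<open>Each weight is an integral combination of L and M, so h divides all of them and
    therefore their greatest common divisor \<mu>.\<close>
  have "h dvd \<mu> * u0" "h dvd \<mu> * u1" "h dvd \<mu> * u2"
    unfolding w0 w1 w2 L M by (simp_all add: dvd_add dvd_diff)
  hence "h dvd gcd (gcd (\<mu> * u0) (\<mu> * u1)) (\<mu> * u2)" by simp
  also have "\<dots> = \<mu>" using gcd1 pos by (simp add: gcd_mult_distrib_int[symmetric] abs_mult)
  finally obtain r where r: "\<mu> = h * r" by (auto elim: dvdE)
  hence "0 < r" using pos \<open>0 < h\<close> by (simp add: zero_less_mult_iff)
  have "h * (r * u1) = h * (L' * z + M' * y)" using w1 by (simp add: r L M algebra_simps)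
  hence t1: "r * u1 = L' * z + M' * y" using \<open>0 < h\<close> by simp
  have "h * (r * u0) = h * (g * M' - r * u1)" using w0 by (simp add: r L M t1 algebra_simps)
  hence t0: "r * u0 = g * M' - r * u1" using \<open>0 < h\<close> by simp
  \<comment> \<open>The weights add up to g(L + M), so the equation can be divided by g h^2. That L'
    divides g is then immediate, as L' is coprime to L' + M'; only the factor h is at stake.\<close>
  have "g * h * (g * (h * (L' + M')\<^sup>2)) = (\<mu> * u0 + \<mu> * u1 + \<mu> * u2)\<^sup>2"
    unfolding w0 w1 w2 L M by (simp add: power2_eq_square algebra_simps)
  also have "\<dots> = a * (\<mu> * u0) * (\<mu> * u1) * (g * L)"
    using eq by (simp only: w2)
  also have "\<dots> = g * h * (h * (a * (r * u0) * (r * u1) * h * L'))"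
    by (simp add: r L mult_ac)
  finally have key: "g * (L' + M')\<^sup>2 = a * (r * u0) * (r * u1) * h * L'"
    using \<open>0 < h\<close> pos by simp
  hence "L' dvd g * (L' + M')\<^sup>2" by simp
  hence "L' dvd g" using copsum by (simp add: coprime_dvd_mult_left_iff)
  then obtain k where k: "g = L' * k" by (auto elim: dvdE)
  have "L' \<noteq> 0" using pos L by auto
  have star: "k * (L' + M')\<^sup>2 = a * (r * u0) * (r * u1) * h"
    using key \<open>L' \<noteq> 0\<close> unfolding k by (simp add: mult_ac)
  have "h * (r * u2) = h * (L' * L' * k)" using w2 by (simp add: r L k algebra_simps)
  hence t2: "r * u2 = L' * L' * k" using \<open>0 < h\<close> by simp
  have not_dvd: "\<not> p dvd y" "\<not> p dvd y - g" "\<not> p dvd z" if "p dvd h" "\<not> is_unit p" for p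
    using that prim L M by (metis dvd_mult2 gcd_greatest)+
  have hk: "p dvd k" if "prime p" "p dvd h" "p dvd u2 \<or> p dvd L'" for p
  proof (rule ccontr)
    assume "\<not> p dvd k"
    have "p dvd r * u2 \<or> p dvd L'" using that by auto
    hence "p dvd L'" using \<open>\<not> p dvd k\<close> that(1) unfolding t2 by (auto simp: prime_dvd_mult_iff)
    moreover have "p dvd k * (L' + M')\<^sup>2" unfolding star using that by simp
    hence "p dvd L' + M'" using \<open>\<not> p dvd k\<close> that(1) by (auto simp: prime_dvd_mult_iff prime_dvd_power_iff)
    ultimately show False using copsum that(1) not_coprimeI not_prime_unit by blast
  qed
  have cop_case: "h dvd k" if "coprime h (L' + M')"
  proof -
    have "h dvd k * (L' + M')\<^sup>2" unfolding star by simp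
    thus ?thesis using that by (simp add: coprime_dvd_mult_left_iff)
  qed
  have hra: "\<mu> * a = h * (r * a)" by (simp add: r)
  \<comment> \<open>With L = h L' and g = L' k this is the claim. As h divides \<mu> a, each pattern
    leaves few values of h; \<open>star\<close> alone suffices when h is coprime to L' + M'.\<close>
  have "h dvd k"
    using special unfolding residue_pattern_def
  proof (elim disjE conjE)
    assume 9: "\<mu> * a = 9" and u: "u0 mod 3 = 1" "u1 mod 3 = 1" "u2 mod 3 = 1"
    have "h dvd 9" using 9 hra by (metis dvd_triv_left)
    hence h: "h \<in> {1, 3, 9}" using small_divisor_cases(4) \<open>0 < h\<close> by blast
    show "h dvd k"
    proof (cases "3 dvd L' + M' \<and> h \<noteq> 1")
      case False
      have "prime (3 :: int)" by simp
      hence "h = 1 \<or> coprime 3 (L' + M')" using False prime_imp_coprime by blast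
      moreover have "coprime 9 (L' + M')" if "coprime 3 (L' + M')"
        using that coprime_power_left_iff[of 3 2 "L' + M'"] by simp
      ultimately show ?thesis using cop_case h by auto
    next
      case True
      hence "3 dvd h" using h by auto
      have "\<not> 3 dvd L'"
      proof
        assume "3 dvd L'"
        thus False using copsum True not_coprimeI[of 3 L' "L' + M'"] by simp
      qed
      \<comment> \<open>If 3 divides r, then h r a = 9 leaves h = 3, and \<open>t2\<close> makes 3
        divide k because it does not divide L'. Otherwise r = 1, and the residues modulo 3
        contradict each other.\<close>
      show ?thesis
      proof (cases "3 dvd r")
        case True
        have "h \<noteq> 9"
        proof
          assume "h = 9"
          hence "r * a = 1" using 9 hra by simp
        thus False using True zmult_eq_1_iff by auto
        qed
        hence "h = 3" using h \<open>3 dvd h\<close> by auto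
        have "3 dvd L' * L' * k" using True t2 by (metis dvd_mult2)
        moreover have "prime (3 :: int)" by simp
        ultimately have "3 dvd k" using \<open>\<not> 3 dvd L'\<close> by (metis prime_dvd_mult_iff)
        thus ?thesis using \<open>h = 3\<close> by simp
      next
        case False
        have "r dvd 9" using 9 hra by (metis dvd_triv_left dvd_mult2 mult.left_commute)
        hence "r = 1" using small_divisor_cases(4)[of r] \<open>0 < r\<close> False by auto
        have y: "y mod 3 \<noteq> 0" "z mod 3 \<noteq> 0" "(y - g) mod 3 \<noteq> 0"
          using not_dvd[of 3] \<open>3 dvd h\<close> by (simp_all add: mod_eq_0_iff_dvd)
        have m1: "((L' mod 3) * (L' mod 3) mod 3) * (k mod 3) mod 3 = 1"
          using u(3) t2 \<open>r = 1\<close> by (simp only: mod_mult_eq mult_1)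
        have m2: "((L' mod 3) * (z mod 3) mod 3 + (M' mod 3) * (y mod 3) mod 3) mod 3 = 1"
          using u(2) t1 \<open>r = 1\<close> by (simp only: mod_mult_eq mod_add_eq mult_1)
        have m3: "(y mod 3 - (L' mod 3) * (k mod 3) mod 3) mod 3 \<noteq> 0"
          using y(3) k by (simp only: mod_mult_eq mod_diff_eq not_False_eq_True)
        have "(L' mod 3 + M' mod 3) mod 3 = 0"
          using True by (simp only: mod_add_eq dvd_imp_mod_0)
        hence False
          by (rule no_residues_mod_3[OF residue_mod_3_cases residue_mod_3_cases residue_mod_3_cases residue_mod_3_cases residue_mod_3_cases m1 _ m2 m3 y(1,2)])
        thus ?thesis ..
      qed
    qed
  next
    assume 8: "\<mu> * a = 8" and u: "odd u0" "odd u1" "even u2"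
    have "h dvd 8" using 8 hra by (metis dvd_triv_left)
    show "h dvd k"
    proof (cases "even (L' + M') \<and> h \<noteq> 1")
      case False
      hence "h = 1 \<or> coprime 8 (L' + M')" using coprime_power_left_iff[of 2 3 "L' + M'"] by auto
      thus ?thesis using cop_case \<open>h dvd 8\<close> coprime_divisors[of h 8 "L' + M'"] by auto
    next
      case True
      \<comment> \<open>Primitivity makes y and z odd, so r u1 is even and r is even. This is used
        twice: 4 divides r u2 and hence k, and h r a = 8 forces h to divide 4.\<close>
      have "odd L'" "odd M'" using True cop by (auto simp: coprime_def)
      have "even h" using True small_divisor_cases(3)[OF \<open>0 < h\<close> \<open>h dvd 8\<close>] by auto
      hence "odd y" "odd z" using not_dvd[of 2] by auto
      hence "even (r * u1)" unfolding t1 using \<open>odd L'\<close> \<open>odd M'\<close> by simp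
      hence "even r" using u by simp
      hence "4 dvd r * u2" using u by (auto elim!: evenE)
      hence "4 dvd L' * L' * k" unfolding t2 .
      moreover have "coprime 4 (L' * L')" using \<open>odd L'\<close> coprime_power_left_iff[of 2 2 "L' * L'"] by simp
      ultimately have "4 dvd k" by (simp add: coprime_dvd_mult_right_iff)
      moreover have "h dvd 4"
      proof -
        obtain r' where "r = 2 * r'" using \<open>even r\<close> by (auto elim: evenE)
        hence "4 = h * (r' * a)" using 8 hra by (simp add: mult_ac)
        thus ?thesis by (metis dvd_triv_left)
      qed
      ultimately show ?thesis by (rule dvd_trans[rotated])
    qed
  next
    assume 6: "\<mu> * a = 6" and u: "u0 mod 6 = 1" "u1 mod 6 = 2" "u2 mod 6 = 3"
    have "h dvd 6" using 6 hra by (metis dvd_triv_left)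
    hence h: "h \<in> {1, 2, 3, 6}" using small_divisor_cases(2) \<open>0 < h\<close> by blast
    have "3 dvd u2" using u(3) by presburger
    hence 3: "3 dvd k" if "3 dvd h" using hk[of 3] that by simp
    \<comment> \<open>Here u2 is odd, so the factor 2 has another source: y and y - g are both odd,
      hence g = L' k is even, and an even L' is covered by \<open>hk\<close>.\<close>
    have 2: "2 dvd k" if "2 dvd h"
    proof -
      have "odd y" "odd (y - g)" using that not_dvd[of 2] by auto
      hence "even g" by simp
      thus ?thesis using hk[of 2] that unfolding k by auto
    qed
    have "even k \<Longrightarrow> 3 dvd k \<Longrightarrow> 6 dvd k" by presburger
    thus ?thesis using h 2 3 by auto
  next
    assume 5: "\<mu> * a = 5" and u: "u2 mod 5 = 0"
    have "h dvd 5" using 5 hra by (metis dvd_triv_left)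
    hence "h \<in> {1, 5}" using small_divisor_cases(1) \<open>0 < h\<close> by blast
    thus ?thesis using hk[of 5] u by (auto simp: mod_eq_0_iff_dvd)
  qed
  thus ?thesis unfolding L k by (simp add: mult.commute)
qed


section \<open>Degree matrices\<close>

lemma carrier_degree_group:
  "1 \<le> \<mu> \<Longrightarrow> carrier (degree_group \<mu>) = UNIV \<times> {0..<int \<mu>}"
  by (simp add: degree_group_def DirProd_def integer_mod_group_def integer_group_def)

lemma mult_degree_group:
  "1 \<le> \<mu> \<Longrightarrow> p \<otimes>\<^bsub>degree_group \<mu>\<^esub> q = (fst p + fst q, (snd p + snd q) mod int \<mu>)"
  by (cases p; cases q) (simp add: degree_group_def DirProd_def integer_mod_group_def integer_group_def)

lemma one_degree_group: "1 \<le> \<mu> \<Longrightarrow> \<one>\<^bsub>degree_group \<mu>\<^esub> = (0, 0)"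
  by (simp add: degree_group_def DirProd_def integer_mod_group_def integer_group_def)

lemma group_degree_group: "group (degree_group \<mu>)"
  unfolding degree_group_def by (intro DirProd_group) auto

lemma inv_degree_group:
  assumes "1 \<le> \<mu>" "p \<in> carrier (degree_group \<mu>)"
  shows "inv\<^bsub>degree_group \<mu>\<^esub> p = (- fst p, (- snd p) mod int \<mu>)"
  using assms
  by (intro group.inv_equality[OF group_degree_group])
     (auto simp: carrier_degree_group mult_degree_group one_degree_group mod_simps)

lemma generate_pair:
  assumes "1 \<le> \<mu>" "p \<in> carrier (degree_group \<mu>)" "q \<in> carrier (degree_group \<mu>)"
  shows "generate (degree_group \<mu>) {p, q} =
    {(x * fst p + y * fst q, (x * snd p + y * snd q) mod int \<mu>) | x y. True}"
proof (intro subset_antisym subsetI)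
  fix g assume "g \<in> generate (degree_group \<mu>) {p, q}"
  thus "g \<in> {(x * fst p + y * fst q, (x * snd p + y * snd q) mod int \<mu>) | x y. True}"
  proof (induction rule: generate.induct)
    case one
    show ?case using assms by (auto simp: one_degree_group intro!: exI[of _ 0])
  next
    case (incl h)
    hence "h = (1 * fst p + 0 * fst q, (1 * snd p + 0 * snd q) mod int \<mu>) \<or>
           h = (0 * fst p + 1 * fst q, (0 * snd p + 1 * snd q) mod int \<mu>)"
      using assms by (auto simp: carrier_degree_group mem_Times_iff prod_eq_iff)
    thus ?case by blast
  next
    case (inv h)
    hence "inv\<^bsub>degree_group \<mu>\<^esub> h = ((-1) * fst p + 0 * fst q, ((-1) * snd p + 0 * snd q) mod int \<mu>) \<or>
           inv\<^bsub>degree_group \<mu>\<^esub> h = (0 * fst p + (-1) * fst q, (0 * snd p + (-1) * snd q) mod int \<mu>)"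
      using assms by (auto simp: inv_degree_group)
    thus ?case by blast
  next
    case (eng h1 h2)
    then obtain x y x' y' where h: "h1 = (x * fst p + y * fst q, (x * snd p + y * snd q) mod int \<mu>)"
      "h2 = (x' * fst p + y' * fst q, (x' * snd p + y' * snd q) mod int \<mu>)" by blast
    have "h1 \<otimes>\<^bsub>degree_group \<mu>\<^esub> h2 =
      ((x + x') * fst p + (y + y') * fst q, ((x + x') * snd p + (y + y') * snd q) mod int \<mu>)"
      unfolding h mult_degree_group[OF assms(1)] by (simp add: mod_add_eq) (simp add: algebra_simps)
    thus ?case by blast
  qed
next
  have mem: "(x * fst r, (x * snd r) mod int \<mu>) \<in> generate (degree_group \<mu>) {p, q}"
    if "r \<in> {p, q}" for r x
  proof (induction x rule: int_induct[of _ 0])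
    case base
    show ?case using generate.one[of "degree_group \<mu>" "{p, q}"] assms by (simp add: one_degree_group)
  next
    case (step1 i)
    have "(i * fst r, (i * snd r) mod int \<mu>) \<otimes>\<^bsub>degree_group \<mu>\<^esub> r \<in> generate (degree_group \<mu>) {p, q}"
      using step1(2) generate.incl[OF that] by (rule generate.eng)
    thus ?case using assms by (simp add: mult_degree_group algebra_simps mod_simps)
  next
    case (step2 i)
    have "(i * fst r, (i * snd r) mod int \<mu>) \<otimes>\<^bsub>degree_group \<mu>\<^esub> inv\<^bsub>degree_group \<mu>\<^esub> r
        \<in> generate (degree_group \<mu>) {p, q}"
      using step2(2) generate.inv[OF that] by (rule generate.eng)
    thus ?case using assms that by (auto simp: mult_degree_group inv_degree_group algebra_simps mod_simps)
  qed
  fix g assume "g \<in> {(x * fst p + y * fst q, (x * snd p + y * snd q) mod int \<mu>) | x y. True}"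
  then obtain x y where g: "g = (x * fst p + y * fst q, (x * snd p + y * snd q) mod int \<mu>)" by blast
  have "(x * fst p, (x * snd p) mod int \<mu>) \<otimes>\<^bsub>degree_group \<mu>\<^esub> (y * fst q, (y * snd q) mod int \<mu>)
      \<in> generate (degree_group \<mu>) {p, q}"
    by (intro generate.eng mem) auto
  thus "g \<in> generate (degree_group \<mu>) {p, q}"
    using assms by (simp add: g mult_degree_group mod_simps)
qed

text \<open>Reaching (1, 0) forces coprime first components. The combinations of p and q with first
  component 0 are then the multiples of the one with coefficients -fst q and fst p, whose torsion
  part is the 2x2 minor; that minor has to be a unit modulo \<mu>.\<close>

lemma generate_pair_eq_carrier_iff:
  assumes "1 \<le> \<mu>" "p \<in> carrier (degree_group \<mu>)" "q \<in> carrier (degree_group \<mu>)" "0 < fst p"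
  shows "generate (degree_group \<mu>) {p, q} = carrier (degree_group \<mu>) \<longleftrightarrow>
    coprime (fst p) (fst q) \<and> coprime (fst p * snd q - fst q * snd p) (int \<mu>)"
proof
  assume gen: "generate (degree_group \<mu>) {p, q} = carrier (degree_group \<mu>)"
  have "(1, 0) \<in> generate (degree_group \<mu>) {p, q}"
    unfolding gen using assms by (simp add: carrier_degree_group)
  then obtain x y where "1 = x * fst p + y * fst q"
    unfolding generate_pair[OF assms(1-3)] by blast
  hence cop: "coprime (fst p) (fst q)" by (metis coprimeI dvd_add dvd_mult)
  moreover have "(0, 1 mod int \<mu>) \<in> generate (degree_group \<mu>) {p, q}"
    unfolding gen using assms by (simp add: carrier_degree_group)
  then obtain x y where xy: "0 = x * fst p + y * fst q" "1 mod int \<mu> = (x * snd p + y * snd q) mod int \<mu>"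
    unfolding generate_pair[OF assms(1-3)] by blast
  have "y * fst q = fst p * (- x)" using xy(1) by (simp add: algebra_simps)
  hence "fst p dvd y * fst q" by simp
  hence "fst p dvd y" using cop by (simp add: coprime_dvd_mult_left_iff)
  then obtain k where k: "y = fst p * k" by (auto elim: dvdE)
  hence "fst p * (x + fst q * k) = 0" using xy(1) by (simp add: algebra_simps)
  hence "x = - (fst q * k)" using assms(4) by simp
  hence "1 mod int \<mu> = (k * (fst p * snd q - fst q * snd p)) mod int \<mu>"
    using xy(2) by (simp add: k algebra_simps)
  hence "int \<mu> dvd 1 - k * (fst p * snd q - fst q * snd p)"
    by (simp add: mod_eq_dvd_iff)
  then obtain l where "1 - k * (fst p * snd q - fst q * snd p) = int \<mu> * l" ..
  hence l: "1 = k * (fst p * snd q - fst q * snd p) + int \<mu> * l" by simp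
  have "coprime (fst p * snd q - fst q * snd p) (int \<mu>)"
    by (rule coprimeI) (metis l dvd_add dvd_mult dvd_mult2)
  ultimately show "coprime (fst p) (fst q) \<and> coprime (fst p * snd q - fst q * snd p) (int \<mu>)" by blast
next
  assume cop: "coprime (fst p) (fst q) \<and> coprime (fst p * snd q - fst q * snd p) (int \<mu>)"
  obtain x y where xy: "x * fst p + y * fst q = 1"
    using cop by (metis bezout_int coprime_iff_gcd_eq_1)
  obtain k l where kl: "k * (fst p * snd q - fst q * snd p) + l * int \<mu> = 1"
    using cop by (metis bezout_int coprime_iff_gcd_eq_1)
  have kD: "k * (fst p * snd q - fst q * snd p) = 1 - l * int \<mu>" using kl by simp
  have "g \<in> generate (degree_group \<mu>) {p, q}" if mem: "g \<in> carrier (degree_group \<mu>)" for g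
  proof -
    obtain a s where g: "g = (a, s)" "0 \<le> s" "s < int \<mu>"
      using mem unfolding carrier_degree_group[OF assms(1)] by (cases g) auto
    \<comment> \<open>The coefficients a x, a y produce the first component a. Adding e times (-fst
      q, fst p) preserves it and shifts the torsion part by e times the minor, whose inverse modulo
      \<mu> is k.\<close>
    define e where "e = (s - a * (x * snd p + y * snd q)) * k"
    have "(a * x - e * fst q) * fst p + (a * y + e * fst p) * fst q = a * (x * fst p + y * fst q)"
      by (simp add: algebra_simps)
    moreover have "(a * x - e * fst q) * snd p + (a * y + e * fst p) * snd q =
        a * (x * snd p + y * snd q) + (s - a * (x * snd p + y * snd q)) * (k * (fst p * snd q - fst q * snd p))"
      by (simp add: e_def algebra_simps)
    moreover have "\<dots> = s - int \<mu> * (l * (s - a * (x * snd p + y * snd q)))"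
      unfolding kD by (simp add: algebra_simps)
    ultimately have "g = ((a * x - e * fst q) * fst p + (a * y + e * fst p) * fst q,
        ((a * x - e * fst q) * snd p + (a * y + e * fst p) * snd q) mod int \<mu>)"
      using g xy by (simp add: mod_diff_eq[symmetric])
    thus ?thesis unfolding generate_pair[OF assms(1-3)] by blast
  qed
  moreover have "generate (degree_group \<mu>) {p, q} \<subseteq> carrier (degree_group \<mu>)"
    using assms by (intro group.generate_incl[OF group_degree_group]) auto
  ultimately show "generate (degree_group \<mu>) {p, q} = carrier (degree_group \<mu>)" by blast
qed

lemma degree_matrix_iff:
  "degree_matrix (\<mu>, q) \<longleftrightarrow> 1 \<le> \<mu> \<and> (\<forall>i. 0 < fst (q $ i) \<and> 0 \<le> snd (q $ i) \<and> snd (q $ i) < int \<mu>) \<and>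
     (\<forall>i j. i \<noteq> j \<longrightarrow> coprime (fst (q $ i)) (fst (q $ j)) \<and>
        coprime (fst (q $ i) * snd (q $ j) - fst (q $ j) * snd (q $ i)) (int \<mu>))"
proof (cases "1 \<le> \<mu> \<and> (\<forall>i. 0 < fst (q $ i) \<and> 0 \<le> snd (q $ i) \<and> snd (q $ i) < int \<mu>)")
  case True
  hence "q $ i \<in> carrier (degree_group \<mu>)" for i
    by (auto simp: carrier_degree_group mem_Times_iff)
  thus ?thesis
    using True by (simp add: degree_matrix_def generate_pair_eq_carrier_iff)
next
  case False
  thus ?thesis by (auto simp: degree_matrix_def carrier_degree_group mem_Times_iff)
qed

text \<open>The box of pairs (X, T) with 0 \<le> X < u and 0 \<le> T < \<mu> is a transversal of the
  cosets: a multiple of the column (u, s) reduces X modulo u, and two elements of the box in one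
  coset differ by the zero multiple.\<close>

lemma fake_weight_eq:
  assumes "degree_matrix (\<mu>, q)"
  shows "fake_weight (\<mu>, q) = (\<chi> i. int \<mu> * fst (q $ i))"
proof -
  let ?G = "degree_group \<mu>"
  interpret group ?G by (rule group_degree_group)
  have \<mu>: "1 \<le> \<mu>" using assms by (simp add: degree_matrix_iff)
  have "card (rcosets\<^bsub>?G\<^esub> generate ?G {q $ i}) = nat (int \<mu> * fst (q $ i))" for i
  proof -
    define u s H where "u = fst (q $ i)" and "s = snd (q $ i)" and "H = generate ?G {q $ i}"
    have u: "0 < u" and qi: "q $ i \<in> carrier ?G"
      using assms by (auto simp: degree_matrix_iff u_def carrier_degree_group mem_Times_iff)
    have H: "H = {((x + y) * u, ((x + y) * s) mod int \<mu>) | x y. True}"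
      using generate_pair[OF \<mu> qi qi] by (simp add: H_def u_def s_def distrib_right)
    have Hx: "g \<in> H \<longleftrightarrow> (\<exists>x. g = (x * u, (x * s) mod int \<mu>))" for g
      unfolding H by (auto intro: exI[of _ 0]) (metis add_0)
    have sub: "subgroup H ?G" unfolding H_def using qi by (intro generate_is_subgroup) auto
    let ?R = "{0..<u} \<times> {0..<int \<mu>}"
    have R: "?R \<subseteq> carrier ?G" using \<mu> by (auto simp: carrier_degree_group)
    have "inj_on (\<lambda>g. H #>\<^bsub>?G\<^esub> g) ?R"
    proof (rule inj_onI)
      fix g g' assume g: "g \<in> ?R" "g' \<in> ?R" and eq: "H #>\<^bsub>?G\<^esub> g = H #>\<^bsub>?G\<^esub> g'"
      have "g \<in> H #>\<^bsub>?G\<^esub> g'" using eq rcos_self[OF _ sub, of g] g R by auto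
      then obtain x where x: "g = (x * u, (x * s) mod int \<mu>) \<otimes>\<^bsub>?G\<^esub> g'"
        using Hx by (auto simp: r_coset_def)
      hence "fst g = x * u + fst g'" using \<mu> by (simp add: mult_degree_group)
      moreover have "0 \<le> fst g" "fst g < u" "0 \<le> fst g'" "fst g' < u" using g by auto
      ultimately have "x = 0"
      proof -
        have "x = (fst g) div u - (fst g') div u" using \<open>fst g = x * u + fst g'\<close> u by simp
        thus ?thesis using \<open>0 \<le> fst g\<close> \<open>fst g < u\<close> \<open>0 \<le> fst g'\<close> \<open>fst g' < u\<close> by simp
      qed
      thus "g = g'" using x g \<mu> by (auto simp: mult_degree_group)
    qed
    moreover have "(\<lambda>g. H #>\<^bsub>?G\<^esub> g) ` ?R = rcosets\<^bsub>?G\<^esub> H"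
    proof (intro subset_antisym subsetI)
      fix C assume "C \<in> (\<lambda>g. H #>\<^bsub>?G\<^esub> g) ` ?R"
      thus "C \<in> rcosets\<^bsub>?G\<^esub> H" using R unfolding RCOSETS_def by blast
    next
      fix C assume "C \<in> rcosets\<^bsub>?G\<^esub> H"
      then obtain X T where C: "C = H #>\<^bsub>?G\<^esub> (X, T)" and XT: "(X, T) \<in> carrier ?G"
        unfolding RCOSETS_def by force
      define x where "x = X div u"
      define r where "r = (X mod u, (T - x * s) mod int \<mu>)"
      have rR: "r \<in> ?R" using u \<mu> by (simp add: r_def)
      have "(X, T) = (x * u, (x * s) mod int \<mu>) \<otimes>\<^bsub>?G\<^esub> r"
        using \<mu> XT by (simp add: mult_degree_group r_def x_def mod_simps carrier_degree_group)
      hence "(X, T) \<in> H #>\<^bsub>?G\<^esub> r" using Hx by (auto simp: r_coset_def)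
      hence "C = H #>\<^bsub>?G\<^esub> r"
        unfolding C using repr_independence[OF _ _ sub] rR R by auto
      thus "C \<in> (\<lambda>g. H #>\<^bsub>?G\<^esub> g) ` ?R" using rR by blast
    qed
    ultimately have "card (rcosets\<^bsub>?G\<^esub> H) = card ?R" by (metis card_image)
    thus ?thesis unfolding H_def[symmetric] u_def[symmetric]
      using u by (simp add: card_cartesian_product nat_mult_distrib mult.commute)
  qed
  thus ?thesis
    using assms by (simp add: fake_weight_def vec_eq_iff degree_matrix_iff less_imp_le)
qed

text \<open>The automorphisms \<open>(x, t) \<mapsto> (x, e t + c x)\<close> of \<open>\<int> \<oplus> \<int>/\<mu>\<int>\<close>, applied to all columns.\<close>

definition twist :: "int \<Rightarrow> int \<Rightarrow> deg_matrix \<Rightarrow> deg_matrix" where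
  "twist e c Q = (fst Q,
     \<chi> i. (fst (snd Q $ i), (e * snd (snd Q $ i) + c * fst (snd Q $ i)) mod int (fst Q)))"

lemma twist_twist: "twist e' c' (twist e c Q) = twist (e' * e) (e' * c + c') Q"
proof -
  have "(e' * (x mod m) + y) mod m = (e' * x + y) mod m" for x y m :: int
    by (metis mod_add_left_eq mod_mult_right_eq)
  thus ?thesis unfolding twist_def by (simp add: vec_eq_iff) (simp add: algebra_simps)
qed

lemma permute_twist: "permute_columns p (twist e c Q) = twist e c (permute_columns p Q)"
  by (simp add: twist_def permute_columns_def vec_eq_iff)

lemma permute_permute: "permute_columns p' (permute_columns p Q) = permute_columns (p \<circ> p') Q"
  by (simp add: permute_columns_def)

text \<open>In each 2x2 minor the terms with c cancel and e factors out, so minors prime to \<mu>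
  stay prime to \<mu>.\<close>

lemma degree_matrix_twist:
  assumes "degree_matrix Q" "coprime e (int (fst Q))"
  shows "degree_matrix (twist e c Q)"
proof -
  obtain \<mu> q where Q: "Q = (\<mu>, q)" by (cases Q)
  have \<mu>: "int \<mu> \<noteq> 0" "0 < \<mu>" using assms by (auto simp: Q degree_matrix_iff)
  have "coprime (fst (q $ i) * ((e * snd (q $ j) + c * fst (q $ j)) mod int \<mu>) -
      fst (q $ j) * ((e * snd (q $ i) + c * fst (q $ i)) mod int \<mu>)) (int \<mu>)" (is "coprime ?x _") if "i \<noteq> j" for i j
  proof -
    have "(fst (q $ i) * ((e * snd (q $ j) + c * fst (q $ j)) mod int \<mu>) -
        fst (q $ j) * ((e * snd (q $ i) + c * fst (q $ i)) mod int \<mu>)) mod int \<mu> =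
      (fst (q $ i) * (e * snd (q $ j) + c * fst (q $ j)) -
        fst (q $ j) * (e * snd (q $ i) + c * fst (q $ i))) mod int \<mu>"
      by (intro mod_diff_cong mod_mult_cong mod_mod_trivial refl)
    also have "\<dots> = (e * (fst (q $ i) * snd (q $ j) - fst (q $ j) * snd (q $ i))) mod int \<mu>" (is "_ = ?y mod _")
      by (simp add: algebra_simps)
    finally have eq: "?x mod int \<mu> = ?y mod int \<mu>" .
    have "coprime ?y (int \<mu>)"
      using assms that by (simp add: Q degree_matrix_iff)
    thus ?thesis using eq coprime_mod_left_iff[OF \<mu>(1)] by metis
  qed
  thus ?thesis
    using assms \<mu> by (auto simp: Q twist_def degree_matrix_iff)
qed

lemma degree_matrix_permute:
  assumes "degree_matrix Q" "bij p"
  shows "degree_matrix (permute_columns p Q)"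
proof -
  obtain \<mu> q where Q: "Q = (\<mu>, q)" by (cases Q)
  have "p i \<noteq> p j" if "i \<noteq> j" for i j using assms(2) that by (metis bij_pointE)
  thus ?thesis using assms(1) by (simp add: Q permute_columns_def degree_matrix_iff)
qed

lemma prod_3: "prod f (UNIV :: 3 set) = f 1 * f 2 * f 3"
  unfolding UNIV_3 by (simp add: ac_simps)

lemma bij_3I:
  fixes f :: "3 \<Rightarrow> 3"
  assumes "f 1 \<noteq> f 2" "f 2 \<noteq> f 3" "f 1 \<noteq> f 3"
  shows "bij f"
proof -
  have "inj f" unfolding inj_on_def Ball_def forall_3 using assms by simp
  thus ?thesis by (simp add: bij_def finite_UNIV_inj_surj)
qed

text \<open>Translates the six-term disjunctions about orderings of weights into one bijection of
  column indices.\<close>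

lemma permutation_3_exists:
  fixes x :: "3 \<Rightarrow> 'a"
  assumes "P (x 1) (x 2) (x 3) \<or> P (x 1) (x 3) (x 2) \<or> P (x 2) (x 1) (x 3) \<or>
    P (x 2) (x 3) (x 1) \<or> P (x 3) (x 1) (x 2) \<or> P (x 3) (x 2) (x 1)"
  shows "\<exists>p :: 3 \<Rightarrow> 3. bij p \<and> P (x (p 1)) (x (p 2)) (x (p 3))"
proof -
  define f :: "3 \<Rightarrow> 3 \<Rightarrow> 3 \<Rightarrow> 3 \<Rightarrow> 3" where "f a b c i = (if i = 1 then a else if i = 2 then b else c)" for a b c i
  have f: "f a b c 1 = a" "f a b c 2 = b" "f a b c 3 = c" for a b c by (simp_all add: f_def)
  have bij: "bij (f a b c)" if "a \<noteq> b" "b \<noteq> c" "a \<noteq> c" for a b c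
    using that by (intro bij_3I) (simp_all add: f)
  have "\<exists>p :: 3 \<Rightarrow> 3. bij p \<and> P (x (p 1)) (x (p 2)) (x (p 3))"
    if "P (x a) (x b) (x c)" "a \<noteq> b" "b \<noteq> c" "a \<noteq> c" for a b c
    using that bij by (intro exI[of _ "f a b c"]) (simp add: f)
  thus ?thesis using assms by (elim disjE) auto
qed

section \<open>Bringing a degree matrix into adjusted form\<close>

text \<open>Beyond the order and divisibility required by \<open>adjusted_weight\<close>, each
  clause makes x coprime to b. Since \<mu> divides b, the first weight is then invertible modulo
  \<mu>, as \<open>normal_form_exists\<close> demands.\<close>

definition adjusted_pattern :: "int \<Rightarrow> int \<Rightarrow> int \<Rightarrow> int \<Rightarrow> bool" where
  "adjusted_pattern b x y z \<longleftrightarrow>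
     b = 9 \<and> x \<le> y \<and> y \<le> z \<and> coprime x 3 \<or>
     b = 8 \<and> x \<le> y \<and> odd x \<and> even z \<or>
     b = 6 \<and> even y \<and> 3 dvd z \<and> x mod 6 = 1 \<or>
     b = 5 \<and> x \<le> y \<and> coprime x 5 \<and> 5 dvd z"

text \<open>The entries that may have to be sorted, all three for b = 9 and the first two for b = 8
  and b = 5, are all coprime to b, so sorting keeps the first one coprime to b. For b = 6 the
  residues fix the order.\<close>

lemma residue_type_adjusted_pattern:
  assumes "residue_type b x y z"
  shows "adjusted_pattern b x y z \<or> adjusted_pattern b x z y \<or> adjusted_pattern b y x z \<or>
     adjusted_pattern b y z x \<or> adjusted_pattern b z x y \<or> adjusted_pattern b z y x"
proof -
  have c3: "coprime w 3" if "w mod 3 = 1" for w :: int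
    using that by (metis coprime_1_left coprime_mod_left_iff zero_neq_numeral)
  have c5: "coprime w 5" if "w mod 5 = 1 \<or> w mod 5 = 4" for w :: int
  proof -
    have "coprime (1 :: int) 5" "coprime (4 :: int) 5" by (simp_all add: coprime_iff_gcd_eq_1 gcd_non_0_int)
    thus ?thesis using that coprime_mod_left_iff[of 5 w] by (metis zero_neq_numeral)
  qed
  have "adjusted_pattern b p q r \<or> adjusted_pattern b q p r \<or> adjusted_pattern b p r q \<or>
      adjusted_pattern b q r p \<or> adjusted_pattern b r p q \<or> adjusted_pattern b r q p"
    if "residue_pattern b p q r" for p q r
    using that unfolding residue_pattern_def
  proof (elim disjE conjE)
    assume "b = 9" "p mod 3 = 1" "q mod 3 = 1" "r mod 3 = 1"
    thus ?thesis using c3 unfolding adjusted_pattern_def by (simp, linarith)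
  next
    assume "b = 8" "odd p" "odd q" "even r"
    thus ?thesis using linear[of p q] unfolding adjusted_pattern_def by auto
  next
    assume 6: "b = 6" "p mod 6 = 1" "q mod 6 = 2" "r mod 6 = 3"
    have "even q" "3 dvd r" using 6 by presburger+
    thus ?thesis using 6 unfolding adjusted_pattern_def by auto
  next
    assume 5: "b = 5" "p mod 5 = 1" "q mod 5 = 4" "r mod 5 = 0"
    have "5 dvd r" "coprime p 5" "coprime q 5" using 5 c5 by auto
    thus ?thesis using 5 linear[of p q] unfolding adjusted_pattern_def by auto
  qed
  thus ?thesis using assms unfolding residue_type_def by meson
qed

lemma weight_gcd_scaled:
  fixes u :: "int ^ 3"
  assumes "1 \<le> \<mu>" "coprime (u $ 1) (u $ 2)"
  shows "weight_gcd (\<chi> i. int \<mu> * u $ i) = int \<mu>"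
    and "reduced_weight (\<chi> i. int \<mu> * u $ i) = u"
proof -
  have "Gcd (range (\<lambda>i. int \<mu> * u $ i)) = int \<mu>"
    using assms by (simp add: UNIV_3 gcd_mult_distrib_int[symmetric] gcd.assoc[symmetric] coprime_iff_gcd_eq_1)
  thus 1: "weight_gcd (\<chi> i. int \<mu> * u $ i) = int \<mu>" by (simp add: weight_gcd_def)
  show "reduced_weight (\<chi> i. int \<mu> * u $ i) = u"
    unfolding reduced_weight_def 1 using assms by (simp add: vec_eq_iff)
qed

lemma adjustedI:
  fixes a :: int
  assumes Q: "degree_matrix (\<mu>, q)"
    and eq: "(int \<mu> * fst (q $ 1) + int \<mu> * fst (q $ 2) + int \<mu> * fst (q $ 3))\<^sup>2 =
      a * ((int \<mu> * fst (q $ 1)) * (int \<mu> * fst (q $ 2)) * (int \<mu> * fst (q $ 3)))"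
    and pattern: "adjusted_pattern (int \<mu> * a) (fst (q $ 1)) (fst (q $ 2)) (fst (q $ 3))"
    and normal: "a \<le> 4 \<Longrightarrow> 1 \<le> \<eta> \<and> \<eta> < int \<mu> \<and>
      q = vector [(fst (q $ 1), 0), (fst (q $ 2), 1), (fst (q $ 3), \<eta>)] \<and>
      (fst (q $ 1) = 1 \<and> fst (q $ 2) = 1 \<and> fst (q $ 3) = 1 \<longrightarrow> \<eta> = 2) \<and>
      (fst (q $ 1) = 1 \<and> fst (q $ 2) = 1 \<and> fst (q $ 3) = 4 \<longrightarrow> \<eta> \<in> {2, 5}) \<and>
      (fst (q $ 1) = 1 \<and> fst (q $ 2) = 1 \<and> fst (q $ 3) = 2 \<longrightarrow> \<eta> \<in> {1, 3, 5})"
  shows "adjusted (\<mu>, q)"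
proof -
  define u :: "int ^ 3" where "u = (\<chi> i. fst (q $ i))"
  have fw: "fake_weight (\<mu>, q) = (\<chi> i. int \<mu> * u $ i)"
    using fake_weight_eq[OF Q] by (simp add: u_def)
  have \<mu>: "1 \<le> \<mu>" and pos: "\<And>i. 0 < u $ i" and cop: "coprime (u $ 1) (u $ 2)"
    using Q by (auto simp: degree_matrix_iff u_def)
  note gcds = weight_gcd_scaled[OF \<mu> cop]
  have weight: "adjusted_weight a (fake_weight (\<mu>, q))"
    unfolding adjusted_weight_def fw gcds Let_def
    using eq pos \<mu> pattern
    by (auto simp: weight_solutions_def u_def adjusted_pattern_def)
  have "u = vector [x, y, z] \<longleftrightarrow> fst (q $ 1) = x \<and> fst (q $ 2) = y \<and> fst (q $ 3) = z" for x y z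
    by (simp add: u_def vec_eq_iff forall_3)
  hence "\<exists>\<eta>. 1 \<le> \<eta> \<and> \<eta> < int \<mu> \<and>
      (\<mu>, q) = (nat (int \<mu>), vector [(u $ 1, 0), (u $ 2, 1), (u $ 3, \<eta>)]) \<and>
      (u = vector [1, 1, 1] \<longrightarrow> \<eta> = 2) \<and> (u = vector [1, 1, 4] \<longrightarrow> \<eta> \<in> {2, 5}) \<and>
      (u = vector [1, 1, 2] \<longrightarrow> \<eta> \<in> {1, 3, 5})" if "a \<le> 4"
    using normal[OF that] by (intro exI[of _ \<eta>]) (simp add: u_def)
  thus ?thesis
    unfolding adjusted_def fw gcds Let_def using Q weight[unfolded fw] by blast
qed

text \<open>With x inverse to the first weight modulo \<mu>, the shift c0 = -s1 x clears the torsion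
  part of the first column. The minor of the first two columns becomes u1 (s2 + c0 u2) modulo \<mu>,
  so s2 + c0 u2 is a unit, and its inverse e turns it into 1. Writing \<open>1 mod int \<mu>\<close>
  covers \<mu> = 1, where this entry is 0.\<close>

lemma normal_form_exists:
  assumes Q: "degree_matrix (\<mu>, q)" and cop: "coprime (fst (q $ 1)) (int \<mu>)"
  obtains e c \<eta> where "coprime e (int \<mu>)" "0 \<le> \<eta>" "\<eta> < int \<mu>"
    "twist e c (\<mu>, q) = (\<mu>, vector [(fst (q $ 1), 0), (fst (q $ 2), 1 mod int \<mu>), (fst (q $ 3), \<eta>)])"
proof -
  define u s where "u i = fst (q $ i)" and "s i = snd (q $ i)" for i
  have \<mu>: "0 < int \<mu>" using Q by (simp add: degree_matrix_iff)
  obtain x y where "x * u 1 + y * int \<mu> = 1"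
    using cop unfolding u_def by (metis bezout_int coprime_iff_gcd_eq_1)
  define c0 where "c0 = - (s 1 * x)"
  have c0: "s 1 + c0 * u 1 = int \<mu> * (y * s 1)"
    using \<open>x * u 1 + y * int \<mu> = 1\<close> unfolding c0_def
    by (metis (no_types, opaque_lifting) add.commute diff_add_cancel diff_conv_add_uminus distrib_left mult.commute mult.left_commute mult_minus_left mult.right_neutral)
  have cop12: "coprime (u 1 * s 2 - u 2 * s 1) (int \<mu>)"
    using Q by (simp add: degree_matrix_iff u_def s_def)
  have "u 1 * (s 2 + c0 * u 2) = (u 1 * s 2 - u 2 * s 1) + u 2 * (s 1 + c0 * u 1)"
    by (simp add: algebra_simps)
  also have "\<dots> mod int \<mu> = (u 1 * s 2 - u 2 * s 1) mod int \<mu>"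
    unfolding c0 by (metis mod_mult_self2 mult.left_commute)
  finally have "coprime (u 1 * (s 2 + c0 * u 2)) (int \<mu>)"
    using cop12 \<mu> coprime_mod_left_iff[of "int \<mu>"] by (metis less_irrefl)
  hence "coprime (s 2 + c0 * u 2) (int \<mu>)" by (simp add: coprime_mult_left_iff)
  then obtain e f where ef: "e * (s 2 + c0 * u 2) + f * int \<mu> = 1"
    by (metis bezout_int coprime_iff_gcd_eq_1)
  have "coprime e (int \<mu>)"
    by (rule coprimeI) (metis ef dvd_add dvd_mult dvd_mult2)
  moreover have "(e * s 1 + e * c0 * u 1) mod int \<mu> = 0"
    using arg_cong[OF c0, of "\<lambda>x. e * x"] by (simp add: algebra_simps)
  moreover have "e * s 2 + e * c0 * u 2 = 1 - f * int \<mu>"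
    using ef by (simp add: algebra_simps)
  hence "(e * s 2 + e * c0 * u 2) mod int \<mu> = 1 mod int \<mu>"
    by (metis mod_mult_self1 diff_conv_add_uminus mult_minus_left)
  ultimately show thesis
    using that[of e "(e * s 3 + e * c0 * u 3) mod int \<mu>" "e * c0"] \<mu>
    by (simp add: twist_def vec_eq_iff forall_3 u_def s_def)
qed

text \<open>The normal form leaves \<eta> as the only parameter. Further conditions exist for u =
  (1,1,1), (1,1,4), (1,1,2), where equal weights permit column permutations. There the minors
  restrict \<eta> modulo 3 or 2, and each remaining value outside the prescribed list is moved into
  it by a twist followed by a permutation.\<close>

lemma adjusted_twist_exists_sorted:
  fixes a :: int
  assumes Q: "degree_matrix (\<mu>, q)"
    and eq: "(int \<mu> * fst (q $ 1) + int \<mu> * fst (q $ 2) + int \<mu> * fst (q $ 3))\<^sup>2 =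
      a * ((int \<mu> * fst (q $ 1)) * (int \<mu> * fst (q $ 2)) * (int \<mu> * fst (q $ 3)))"
    and pattern: "adjusted_pattern (int \<mu> * a) (fst (q $ 1)) (fst (q $ 2)) (fst (q $ 3))"
  shows "\<exists>e c p. coprime e (int \<mu>) \<and> bij p \<and> adjusted (permute_columns p (twist e c (\<mu>, q)))"
proof -
  define x y z where xyz: "x = fst (q $ 1)" "y = fst (q $ 2)" "z = fst (q $ 3)"
  define b where "b = int \<mu> * a"
  have \<mu>: "0 < int \<mu>" using Q by (simp add: degree_matrix_iff)
  have "coprime x b"
  proof -
    have "coprime x 6" if "x mod 6 = 1" using that coprime_mod_left_iff[of 6 x] by simp
    thus ?thesis
      using pattern coprime_power_right_iff[of x 3 2] coprime_power_right_iff[of x 2 3]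
      unfolding adjusted_pattern_def b_def[symmetric] xyz[symmetric] by auto
  qed
  hence "coprime x (int \<mu>)" unfolding b_def by simp
  then obtain e c \<eta> where e: "coprime e (int \<mu>)" and \<eta>: "0 \<le> \<eta>" "\<eta> < int \<mu>"
    and Q': "twist e c (\<mu>, q) = (\<mu>, vector [(x, 0), (y, 1 mod int \<mu>), (z, \<eta>)])"
    using normal_form_exists[OF Q] unfolding xyz by metis
  have finish: "adjusted (\<mu>, vector [(x, 0), (y, 1 mod int \<mu>), (z, \<theta>)])"
    if "degree_matrix (\<mu>, vector [(x, 0), (y, 1 mod int \<mu>), (z, \<theta>)])"
      and "a \<le> 4 \<Longrightarrow> 2 \<le> \<mu> \<and> 1 \<le> \<theta> \<and> \<theta> < int \<mu> \<and>
      (x = 1 \<and> y = 1 \<and> z = 1 \<longrightarrow> \<theta> = 2) \<and> (x = 1 \<and> y = 1 \<and> z = 4 \<longrightarrow> \<theta> \<in> {2, 5}) \<and>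
      (x = 1 \<and> y = 1 \<and> z = 2 \<longrightarrow> \<theta> \<in> {1, 3, 5})" for \<theta>
    using that eq pattern by (intro adjustedI[where a = a and \<eta> = \<theta>]) (auto simp: xyz)
  have dm: "degree_matrix (\<mu>, vector [(x, 0), (y, 1 mod int \<mu>), (z, \<eta>)])"
    using degree_matrix_twist[OF Q, of e c] e unfolding Q' by simp
  have direct: ?thesis
    if "adjusted (permute_columns p (twist e' c' (\<mu>, vector [(x, 0), (y, 1 mod int \<mu>), (z, \<eta>)])))"
      "bij p" "coprime e' (int \<mu>)" for p e' c'
    using that e unfolding Q'[symmetric] twist_twist by (metis coprime_mult_left_iff)
  have triv: "permute_columns id (twist 1 0 (\<mu>, vector [(x, 0), (y, 1 mod int \<mu>), (z, \<eta>)])) =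
      (\<mu>, vector [(x, 0), (y, 1 mod int \<mu>), (z, \<eta>)])"
    using \<eta> \<mu> by (simp add: permute_columns_def twist_def vec_eq_iff forall_3)
  have plain: ?thesis if "adjusted (\<mu>, vector [(x, 0), (y, 1 mod int \<mu>), (z, \<eta>)])"
    using direct[of id 1 0] that unfolding triv by simp
  show ?thesis
  proof (cases "a \<le> 4")
    case False
    show ?thesis by (rule plain[OF finish[OF dm]]) (use False in auto)
  next
    case True
    have b: "b \<in> {5, 6, 8, 9}" using pattern unfolding adjusted_pattern_def b_def by auto
    \<comment> \<open>The product b = \<mu> a is at least 5 while a \<le> 4, so the torsion part is
      nontrivial and the entry \<open>1 mod int \<mu>\<close> is 1.\<close>
    hence "int \<mu> \<noteq> 1" using True unfolding b_def by auto
    hence \<mu>2: "2 \<le> int \<mu>" using \<mu> by linarith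
    hence dm1: "degree_matrix (\<mu>, vector [(x, 0), (y, 1), (z, \<eta>)])" using dm by simp
    hence "\<forall>i j. i \<noteq> j \<longrightarrow>
        coprime (fst ((vector [(x, 0), (y, 1), (z, \<eta>)] :: (int \<times> int) ^ 3) $ i) *
          snd ((vector [(x, 0), (y, 1), (z, \<eta>)] :: (int \<times> int) ^ 3) $ j) -
          fst ((vector [(x, 0), (y, 1), (z, \<eta>)] :: (int \<times> int) ^ 3) $ j) *
          snd ((vector [(x, 0), (y, 1), (z, \<eta>)] :: (int \<times> int) ^ 3) $ i)) (int \<mu>)"
      by (simp add: degree_matrix_iff)
    \<comment> \<open>These two minors are x \<eta> and y \<eta> - z.\<close>
    from this[rule_format, of 1 3] this[rule_format, of 2 3]
    have cop: "coprime \<eta> (int \<mu>)" "coprime (y * \<eta> - z) (int \<mu>)"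
      by (simp_all add: coprime_mult_left_iff)
    hence \<eta>1: "1 \<le> \<eta>" using \<eta> \<mu>2 by (cases "\<eta> = 0") auto
    have beq: "(x + y + z)\<^sup>2 = b * x * y * z"
    proof -
      have "(int \<mu>)\<^sup>2 * (x + y + z)\<^sup>2 = (int \<mu>)\<^sup>2 * (b * x * y * z)"
        using eq unfolding xyz b_def by (simp add: power2_eq_square algebra_simps)
      thus ?thesis using \<mu> by simp
    qed
    have dvd: "int \<mu> dvd b" by (simp add: b_def)
    have nine: "int \<mu> \<in> {3, 9}" if "b = 9"
      using small_divisor_cases(4)[OF \<mu>] dvd \<mu>2 that by auto
    have eight: "int \<mu> \<in> {2, 4, 8}" if "b = 8"
      using small_divisor_cases(3)[OF \<mu>] dvd \<mu>2 that by auto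
    have three: "\<not> 3 dvd \<eta>" "\<not> 3 dvd y * \<eta> - z" if "3 dvd int \<mu>"
      using cop that not_coprimeI[of "3 :: int"] by auto
    have two: "odd \<eta>" if "even (int \<mu>)"
      using cop that not_coprimeI[of "2 :: int"] by auto
    have bij: "bij (\<lambda>i :: 3. if i = 1 then 1 else if i = 2 then 3 else (2 :: 3))"
       "bij (\<lambda>i :: 3. if i = 1 then 3 else if i = 2 then 1 else (2 :: 3))"
       "bij (\<lambda>i :: 3. if i = 1 then 2 else if i = 2 then 1 else (3 :: 3))"
      by (intro bij_3I; simp)+
    consider (111) "x = 1" "y = 1" "z = 1" | (114) "x = 1" "y = 1" "z = 4" | (112) "x = 1" "y = 1" "z = 2"
      | (other) "\<not> (x = 1 \<and> y = 1 \<and> z \<in> {1, 2, 4})" by auto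
    thus ?thesis
    proof cases
      case other
      show ?thesis by (rule plain[OF finish[OF dm]]) (use other \<mu>2 \<eta> \<eta>1 in auto)
    next
      case 111
      hence "b = 9" using beq by simp
      hence m: "int \<mu> = 3 \<or> int \<mu> = 9" using nine by simp
      hence "\<not> 3 dvd \<eta>" "\<not> 3 dvd \<eta> - 1" using three 111 by auto
      hence "int \<mu> = 3 \<and> \<eta> = 2 \<or> int \<mu> = 9 \<and> (\<eta> = 2 \<or> \<eta> = 5 \<or> \<eta> = 8)"
        using m \<eta> by presburger
      then consider "\<eta> = 2" | "int \<mu> = 9" "\<eta> = 5" | "int \<mu> = 9" "\<eta> = 8" by auto
      thus ?thesis
      proof cases
        case 1
        show ?thesis by (rule plain[OF finish[OF dm]]) (use 1 \<mu>2 \<eta> 111 in auto)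
      next
        case 2
        \<comment> \<open>Doubling the torsion row (0, 1, 5) gives (0, 2, 1) modulo 9; exchanging
          the last two columns yields \<eta> = 2.\<close>
        let ?p = "\<lambda>i :: 3. if i = 1 then 1 else if i = 2 then 3 else (2 :: 3)"
        have P: "permute_columns ?p (twist 2 0 (\<mu>, vector [(x, 0), (y, 1 mod int \<mu>), (z, \<eta>)])) =
            (\<mu>, vector [(x, 0), (y, 1 mod int \<mu>), (z, 2)])"
          using 2 111 by (simp add: permute_columns_def twist_def vec_eq_iff forall_3)
        have cop: "coprime (2 :: int) (int \<mu>)" using 2 by simp
        have "degree_matrix (\<mu>, vector [(x, 0), (y, 1 mod int \<mu>), (z, 2)])"
          unfolding P[symmetric]
          by (rule degree_matrix_permute[OF degree_matrix_twist[OF dm] bij(1)]) (use cop in simp)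
        hence "adjusted (\<mu>, vector [(x, 0), (y, 1 mod int \<mu>), (z, 2)])"
          by (rule finish) (use 2 111 in auto)
        thus ?thesis
          by (intro direct[OF _ bij(1) cop, of 0]) (simp only: P)
      next
        case 3
        \<comment> \<open>Adding the row of weights (1, 1, 1) to (0, 1, 8) gives (1, 2, 0) modulo 9,
          a cyclic rotation of (0, 1, 2).\<close>
        let ?p = "\<lambda>i :: 3. if i = 1 then 3 else if i = 2 then 1 else (2 :: 3)"
        have P: "permute_columns ?p (twist 1 1 (\<mu>, vector [(x, 0), (y, 1 mod int \<mu>), (z, \<eta>)])) =
            (\<mu>, vector [(x, 0), (y, 1 mod int \<mu>), (z, 2)])"
          using 3 111 by (simp add: permute_columns_def twist_def vec_eq_iff forall_3)
        have cop: "coprime (1 :: int) (int \<mu>)" using 3 by simp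
        have "degree_matrix (\<mu>, vector [(x, 0), (y, 1 mod int \<mu>), (z, 2)])"
          unfolding P[symmetric]
          by (rule degree_matrix_permute[OF degree_matrix_twist[OF dm] bij(2)]) (use cop in simp)
        hence "adjusted (\<mu>, vector [(x, 0), (y, 1 mod int \<mu>), (z, 2)])"
          by (rule finish) (use 3 111 in auto)
        thus ?thesis
          by (intro direct[OF _ bij(2) cop, of 1]) (simp only: P)
      qed
    next
      case 114
      hence "b = 9" using beq by simp
      hence m: "int \<mu> = 3 \<or> int \<mu> = 9" using nine by simp
      hence "\<not> 3 dvd \<eta>" "\<not> 3 dvd \<eta> - 4" using three 114 by auto
      hence "int \<mu> = 3 \<and> \<eta> = 2 \<or> int \<mu> = 9 \<and> (\<eta> = 2 \<or> \<eta> = 5 \<or> \<eta> = 8)"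
        using m \<eta> by presburger
      then consider "\<eta> \<in> {2, 5}" | "int \<mu> = 9" "\<eta> = 8" by auto
      thus ?thesis
      proof cases
        case 1
        show ?thesis by (rule plain[OF finish[OF dm]]) (use 1 \<mu>2 \<eta> 114 in auto)
      next
        case 2
        \<comment> \<open>Replacing each torsion part s by u - s exchanges 0 and 1 in the columns of
          weight 1 and sends \<eta> to 4 - \<eta>, here 8 to 5 modulo 9.\<close>
        let ?p = "\<lambda>i :: 3. if i = 1 then 2 else if i = 2 then 1 else (3 :: 3)"
        have P: "permute_columns ?p (twist (-1) 1 (\<mu>, vector [(x, 0), (y, 1 mod int \<mu>), (z, \<eta>)])) =
            (\<mu>, vector [(x, 0), (y, 1 mod int \<mu>), (z, 5)])"
          using 2 114 by (simp add: permute_columns_def twist_def vec_eq_iff forall_3)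
        have cop: "coprime (-1 :: int) (int \<mu>)" using 2 by simp
        have "degree_matrix (\<mu>, vector [(x, 0), (y, 1 mod int \<mu>), (z, 5)])"
          unfolding P[symmetric]
          by (rule degree_matrix_permute[OF degree_matrix_twist[OF dm] bij(3)]) (use cop in simp)
        hence "adjusted (\<mu>, vector [(x, 0), (y, 1 mod int \<mu>), (z, 5)])"
          by (rule finish) (use 2 114 in auto)
        thus ?thesis
          by (intro direct[OF _ bij(3) cop, of 1]) (simp only: P)
      qed
    next
      case 112
      hence "b = 8" using beq by simp
      hence m: "int \<mu> = 2 \<or> int \<mu> = 4 \<or> int \<mu> = 8" using eight by simp
      hence "odd \<eta>" using two by auto
      hence "\<eta> = 1 \<or> \<eta> = 3 \<or> \<eta> = 5 \<or> int \<mu> = 8 \<and> \<eta> = 7"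
        using m \<eta> by presburger
      then consider "\<eta> \<in> {1, 3, 5}" | "int \<mu> = 8" "\<eta> = 7" by auto
      thus ?thesis
      proof cases
        case 1
        show ?thesis by (rule plain[OF finish[OF dm]]) (use 1 \<mu>2 \<eta> 112 in auto)
      next
        case 2
        \<comment> \<open>The same reflection sends \<eta> to 2 - \<eta>, here 7 to 3 modulo
          8.\<close>
        let ?p = "\<lambda>i :: 3. if i = 1 then 2 else if i = 2 then 1 else (3 :: 3)"
        have P: "permute_columns ?p (twist (-1) 1 (\<mu>, vector [(x, 0), (y, 1 mod int \<mu>), (z, \<eta>)])) =
            (\<mu>, vector [(x, 0), (y, 1 mod int \<mu>), (z, 3)])"
          using 2 112 by (simp add: permute_columns_def twist_def vec_eq_iff forall_3)
        have cop: "coprime (-1 :: int) (int \<mu>)" using 2 by simp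
        have "degree_matrix (\<mu>, vector [(x, 0), (y, 1 mod int \<mu>), (z, 3)])"
          unfolding P[symmetric]
          by (rule degree_matrix_permute[OF degree_matrix_twist[OF dm] bij(3)]) (use cop in simp)
        hence "adjusted (\<mu>, vector [(x, 0), (y, 1 mod int \<mu>), (z, 3)])"
          by (rule finish) (use 2 112 in auto)
        thus ?thesis
          by (intro direct[OF _ bij(3) cop, of 1]) (simp only: P)
      qed
    qed
  qed
qed

lemma adjusted_twist_exists:
  fixes a :: int
  assumes Q: "degree_matrix (\<mu>, q)"
    and eq: "(int \<mu> * fst (q $ 1) + int \<mu> * fst (q $ 2) + int \<mu> * fst (q $ 3))\<^sup>2 =
      a * ((int \<mu> * fst (q $ 1)) * (int \<mu> * fst (q $ 2)) * (int \<mu> * fst (q $ 3)))"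
  shows "\<exists>e c p. coprime e (int \<mu>) \<and> bij p \<and> adjusted (permute_columns p (twist e c (\<mu>, q)))"
proof -
  define u :: "3 \<Rightarrow> int" where "u i = fst (q $ i)" for i
  have \<mu>: "0 < int \<mu>" and pos: "\<And>i. 0 < u i" and cop: "coprime (u 1) (u 2)"
    using Q by (auto simp: degree_matrix_iff u_def)
  have "(int \<mu>)\<^sup>2 * (u 1 + u 2 + u 3)\<^sup>2 = (int \<mu>)\<^sup>2 * (int \<mu> * a * u 1 * u 2 * u 3)"
    using eq unfolding u_def by (simp add: power2_eq_square algebra_simps)
  hence "(u 1 + u 2 + u 3)\<^sup>2 = int \<mu> * a * u 1 * u 2 * u 3" using \<mu> by simp
  hence "residue_type (int \<mu> * a) (u 1) (u 2) (u 3)"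
    using pos cop by (intro primitive_solution_residues) (auto simp: coprime_iff_gcd_eq_1)
  from permutation_3_exists[of "adjusted_pattern (int \<mu> * a)" u, OF residue_type_adjusted_pattern[OF this]]
  obtain p :: "3 \<Rightarrow> 3" where p: "bij p" and pat: "adjusted_pattern (int \<mu> * a) (u (p 1)) (u (p 2)) (u (p 3))"
    by blast
  define q' :: "(int \<times> int) ^ 3" where "q' = (\<chi> i. q $ p i)"
  have perm: "permute_columns p (\<mu>, q) = (\<mu>, q')" by (simp add: permute_columns_def q'_def)
  have "degree_matrix (\<mu>, q')" using degree_matrix_permute[OF Q p] by (simp add: perm)
  have sum: "(\<Sum>i\<in>UNIV. f (p i)) = (\<Sum>i\<in>UNIV. f i)" and prod: "(\<Prod>i\<in>UNIV. f (p i)) = (\<Prod>i\<in>UNIV. f i)" for f :: "3 \<Rightarrow> int"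
    using sum.reindex_bij_betw[OF p] prod.reindex_bij_betw[OF p] by auto
  have s3: "int \<mu> * fst (q $ p 1) + int \<mu> * fst (q $ p 2) + int \<mu> * fst (q $ p 3) =
      int \<mu> * fst (q $ 1) + int \<mu> * fst (q $ 2) + int \<mu> * fst (q $ 3)"
    using sum[of "\<lambda>i. int \<mu> * fst (q $ i)"] unfolding sum_3 .
  have p3: "int \<mu> * fst (q $ p 1) * (int \<mu> * fst (q $ p 2)) * (int \<mu> * fst (q $ p 3)) =
      int \<mu> * fst (q $ 1) * (int \<mu> * fst (q $ 2)) * (int \<mu> * fst (q $ 3))"
    using prod[of "\<lambda>i. int \<mu> * fst (q $ i)"] unfolding prod_3 .
  have "(int \<mu> * fst (q' $ 1) + int \<mu> * fst (q' $ 2) + int \<mu> * fst (q' $ 3))\<^sup>2 =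
      a * ((int \<mu> * fst (q' $ 1)) * (int \<mu> * fst (q' $ 2)) * (int \<mu> * fst (q' $ 3)))"
    using eq by (simp only: q'_def vec_lambda_beta s3 p3)
  with adjusted_twist_exists_sorted[OF \<open>degree_matrix (\<mu>, q')\<close> this] pat
  obtain e c p' where "coprime e (int \<mu>)" "bij p'" "adjusted (permute_columns p' (twist e c (\<mu>, q')))"
    unfolding u_def q'_def vec_lambda_beta by blast
  moreover have "permute_columns p' (twist e c (\<mu>, q')) = permute_columns (p \<circ> p') (twist e c (\<mu>, q))"
    unfolding perm[symmetric] permute_twist permute_permute ..
  ultimately show ?thesis using bij_comp[OF \<open>bij p'\<close> p] by metis
qed

section \<open>The degree matrix of a planar generator matrix\<close>

definition matrix_2_3 :: "int \<times> int \<Rightarrow> int \<times> int \<Rightarrow> int \<times> int \<Rightarrow> int ^ 3 ^ 2" where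
  "matrix_2_3 a b c = vector [vector [fst a, fst b, fst c], vector [snd a, snd b, snd c]]"

text \<open>The negative of the usual determinant: the columns (l1, d1), (l1, d1 + l1 d0), (-l2, d2)
  with d0 < 0 run clockwise, and with this sign their weights come out positive.\<close>

definition clockwise :: "int \<times> int \<Rightarrow> int \<times> int \<Rightarrow> int" where
  "clockwise a b = fst b * snd a - fst a * snd b"

text \<open>The three values of \<open>clockwise\<close> are the coefficients of a positive linear
  relation among a, b, c. A vector is first expanded in a and b; a sufficiently large multiple t of
  the relation then makes all coefficients nonnegative.\<close>

lemma projective_generator_matrix_2_3:
  assumes prim: "coprime (fst a) (snd a)" "coprime (fst b) (snd b)" "coprime (fst c) (snd c)"
    and pos: "0 < clockwise a b" "0 < clockwise b c" "0 < clockwise c a"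
  shows "projective_generator_matrix (matrix_2_3 a b c)"
proof -
  let ?P = "matrix_2_3 a b c"
  have "inj (\<lambda>j. column j ?P)"
    using pos unfolding inj_on_def Ball_def
    by (auto simp: forall_3 column_def vec_eq_iff forall_2 matrix_2_3_def clockwise_def mult.commute)
  moreover have "\<forall>j. primitive_vec (column j ?P)"
    using prim by (simp add: forall_3 column_def primitive_vec_def UNIV_2 matrix_2_3_def coprime_iff_gcd_eq_1)
  moreover have "\<exists>k :: rat ^ 3. (\<forall>j. 0 \<le> k $ j) \<and> x = (\<chi> i. \<Sum>j\<in>UNIV. k $ j * of_int (?P $ i $ j))" for x :: "rat ^ 2"
  proof -
    obtain a1 a2 b1 b2 c1 c2 where abc: "a = (a1, a2)" "b = (b1, b2)" "c = (c1, c2)"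
      by (metis surj_pair)
    define A1 A2 B1 B2 C1 C2 :: rat where R: "A1 = of_int a1" "A2 = of_int a2" "B1 = of_int b1" "B2 = of_int b2"
      "C1 = of_int c1" "C2 = of_int c2"
    have "1 \<le> clockwise a b" "1 \<le> clockwise b c" "1 \<le> clockwise c a" using pos by auto
    moreover have "(1 :: rat) \<le> of_int n" if "1 \<le> n" for n using that by simp
    ultimately have "(1 :: rat) \<le> of_int (clockwise a b)" "(1 :: rat) \<le> of_int (clockwise b c)"
      "(1 :: rat) \<le> of_int (clockwise c a)" by blast+
    hence w: "1 \<le> B1 * A2 - A1 * B2" "1 \<le> C1 * B2 - B1 * C2" "1 \<le> A1 * C2 - C1 * A2"
      by (simp_all add: clockwise_def abc R)
    define \<alpha> \<beta> where "\<alpha> = (B1 * x $ 2 - x $ 1 * B2) / (B1 * A2 - A1 * B2)"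
      and "\<beta> = (x $ 1 * A2 - A1 * x $ 2) / (B1 * A2 - A1 * B2)"
    have x1: "x $ 1 = \<alpha> * A1 + \<beta> * B1" and x2: "x $ 2 = \<alpha> * A2 + \<beta> * B2"
      using w(1) unfolding \<alpha>_def \<beta>_def by (simp_all add: divide_simps) (simp_all add: algebra_simps)
    define t where "t = \<bar>\<alpha>\<bar> + \<bar>\<beta>\<bar>"
    define k :: "rat ^ 3" where "k = vector [\<alpha> + t * (C1 * B2 - B1 * C2), \<beta> + t * (A1 * C2 - C1 * A2), t * (B1 * A2 - A1 * B2)]"
    have t: "t \<le> t * w" if "1 \<le> w" for w using that by (simp add: t_def mult_le_cancel_left1)
    have "0 \<le> t" by (simp add: t_def)
    have "- t \<le> \<alpha>" "- t \<le> \<beta>" by (simp_all add: t_def)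
    hence "0 \<le> \<alpha> + t * (C1 * B2 - B1 * C2)" "0 \<le> \<beta> + t * (A1 * C2 - C1 * A2)" "0 \<le> t * (B1 * A2 - A1 * B2)"
      using t[OF w(1)] t[OF w(2)] t[OF w(3)] \<open>0 \<le> t\<close> by linarith+
    hence "\<forall>j. 0 \<le> k $ j"
      unfolding forall_3 k_def by simp
    moreover have "x = (\<chi> i. \<Sum>j\<in>UNIV. k $ j * of_int (?P $ i $ j))"
      unfolding vec_eq_iff forall_2 by (simp add: sum_3 k_def x1 x2 matrix_2_3_def abc R[symmetric]) (simp add: algebra_simps)
    ultimately show ?thesis by blast
  qed
  ultimately show ?thesis unfolding projective_generator_matrix_def by simp
qed

lemma coprime_mod_det:
  "m \<noteq> 0 \<Longrightarrow> coprime (u * (t mod m) - v * (s mod m)) m \<longleftrightarrow> coprime (u * t - v * s) (m :: int)"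
proof -
  assume m: "m \<noteq> 0"
  have "(u * (t mod m) - v * (s mod m)) mod m = (u * t - v * s) mod m"
    by (intro mod_diff_cong mod_mult_cong mod_mod_trivial refl)
  thus ?thesis using coprime_mod_left_iff[OF m] by metis
qed

lemma degree_matrix_vectorI:
  assumes "1 \<le> \<mu>" "0 < u" "0 < v" "0 < w"
    and "coprime u v" "coprime u w" "coprime v w"
    and "coprime (u * t - v * s) (int \<mu>)" "coprime (u * r - w * s) (int \<mu>)" "coprime (v * r - w * t) (int \<mu>)"
  shows "degree_matrix (\<mu>, vector [(u, s mod int \<mu>), (v, t mod int \<mu>), (w, r mod int \<mu>)])"
proof -
  have "coprime (b - a) m" if "coprime (a - b) m" for a b m :: int
    using that by (metis coprime_minus_left_iff minus_diff_eq)
  note this[OF assms(8)] this[OF assms(9)] this[OF assms(10)]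
  moreover have "coprime v u" "coprime w u" "coprime w v"
    using assms by (simp_all add: ac_simps)
  ultimately show ?thesis
    using assms by (simp add: degree_matrix_iff forall_3 coprime_mod_det)
qed

text \<open>The degree map is the projection of \<int>^3 onto its quotient by the row lattice of P,
  computed by hand. In a suitable lattice basis the rows are (1, f, g) and (0, w2, -w1). Dividing by
  the first leaves pairs (y, z), and dividing by m(u2, -u1) then splits off \<int>/m\<int>.\<close>

lemma corresponding_exists:
  assumes prim: "coprime (fst a) (snd a)" "coprime (fst b) (snd b)" "coprime (fst c) (snd c)"
    and pos: "0 < clockwise a b" "0 < clockwise b c" "0 < clockwise c a"
  obtains \<mu> q where "corresponding (matrix_2_3 a b c) (\<mu>, q)" "int \<mu> * fst (q $ 1) = clockwise b c"
    "int \<mu> * fst (q $ 2) = clockwise c a" "int \<mu> * fst (q $ 3) = clockwise a b"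
proof -
  obtain x0 y0 x1 y1 x2 y2 where abc: "a = (x0, y0)" "b = (x1, y1)" "c = (x2, y2)"
    by (metis surj_pair)
  define w0 w1 w2 where w: "w0 = clockwise b c" "w1 = clockwise c a" "w2 = clockwise a b"
  have W: "w0 = x2 * y1 - x1 * y2" "w1 = x0 * y2 - x2 * y0" "w2 = x1 * y0 - x0 * y1"
    by (simp_all add: w abc clockwise_def)
  have wpos: "0 < w0" "0 < w1" "0 < w2" using pos by (simp_all add: w)
  obtain r s where rs: "r * x0 + s * y0 = 1"
    using prim(1) by (metis abc(1) bezout_int coprime_iff_gcd_eq_1 fst_conv snd_conv)
  \<comment> \<open>With v0 = (x0, y0), the vectors v0 and (s, -r) form a lattice basis, in which
    the columns of P are (1, 0), (f, w2), (g, -w1).\<close>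
  define f g where f: "f = r * x1 + s * y1" and g: "g = r * x2 + s * y2"
  have v1: "x1 = f * x0 + w2 * s" "y1 = f * y0 - w2 * r"
    and v2: "x2 = g * x0 - w1 * s" "y2 = g * y0 + w1 * r"
    using arg_cong[OF rs, of "\<lambda>t. t * x1"] arg_cong[OF rs, of "\<lambda>t. t * y1"]
      arg_cong[OF rs, of "\<lambda>t. t * x2"] arg_cong[OF rs, of "\<lambda>t. t * y2"]
    by (simp_all add: f g W algebra_simps)
  define m where "m = gcd w1 w2"
  have m: "0 < m" using wpos by (simp add: m_def)
  obtain u1 u2 where u: "w1 = m * u1" "w2 = m * u2" and cop12: "coprime u1 u2"
    using gcd_coprime_exists[of w1 w2] m unfolding m_def by (metis less_irrefl mult.commute)
  have u12: "0 < u1" "0 < u2" using wpos m unfolding u by (simp_all add: zero_less_mult_iff)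
  obtain \<beta> \<alpha> where ab: "\<beta> * u1 + \<alpha> * u2 = 1"
    using cop12 by (metis bezout_int coprime_iff_gcd_eq_1)
  define u0 where "u0 = - f * u1 - g * u2"
  have "w0 = w0 * (r * x0 + s * y0)" by (simp add: rs)
  also have "\<dots> = - (w1 * f) - w2 * g" by (simp add: W f g algebra_simps)
  also have "\<dots> = m * u0" by (simp add: u u0_def algebra_simps)
  finally have u0: "w0 = m * u0" .
  have u0pos: "0 < u0" using wpos m unfolding u0 by (simp add: zero_less_mult_iff)
  \<comment> \<open>The map (y, z) to (u1 y + u2 z, \<alpha> y - \<beta> z) is unimodular and sends
    (u2, -u1) to (0, 1), so it supplies the last two columns of q. The first column is -f times the
    second minus g times the third, which gives u0 and this \<eta>.\<close>
  define \<eta> where "\<eta> = g * \<beta> - f * \<alpha>"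
  define \<mu> where "\<mu> = nat m"
  have \<mu>: "int \<mu> = m" "1 \<le> \<mu>" using m by (auto simp: \<mu>_def)
  define q :: "(int \<times> int) ^ 3" where
    "q = vector [(u0, \<eta> mod int \<mu>), (u1, \<alpha> mod int \<mu>), (u2, (- \<beta>) mod int \<mu>)]"
  have unit1: "is_unit k" if "k dvd f" "k dvd w2" for k
  proof -
    have "k dvd x1" "k dvd y1" using that by (auto simp: v1)
    thus ?thesis using prim(2) by (auto simp: abc coprime_def)
  qed
  have unit2: "is_unit k" if "k dvd g" "k dvd w1" for k
  proof -
    have "k dvd x2" "k dvd y2" using that by (auto simp: v2)
    thus ?thesis using prim(3) by (auto simp: abc coprime_def)
  qed
  have "coprime u0 u1"
  proof (rule coprimeI)
    fix k assume k: "k dvd u0" "k dvd u1"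
    have "g * u2 = - u0 - f * u1" by (simp add: u0_def)
    hence "k dvd g * u2" using k by simp
    moreover have "coprime k u2" using k(2) cop12 by (meson coprime_divisors dvd_refl)
    ultimately have "k dvd g" by (simp add: coprime_dvd_mult_left_iff)
    thus "is_unit k" using unit2 k(2) by (simp add: u)
  qed
  moreover have "coprime u0 u2"
  proof (rule coprimeI)
    fix k assume k: "k dvd u0" "k dvd u2"
    have "f * u1 = - u0 - g * u2" by (simp add: u0_def)
    hence "k dvd f * u1" using k by simp
    moreover have "coprime k u1" using k(2) cop12 by (meson coprime_commute coprime_divisors dvd_refl)
    ultimately have "k dvd f" by (simp add: coprime_dvd_mult_left_iff)
    thus "is_unit k" using unit1 k(2) by (simp add: u)
  qed
  moreover have "coprime (u0 * \<alpha> - u1 * \<eta>) (int \<mu>)"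
  proof -
    have "u0 * \<alpha> - u1 * \<eta> = - g * (\<beta> * u1 + \<alpha> * u2)" by (simp add: u0_def \<eta>_def algebra_simps)
    moreover have "coprime g m" using unit2 by (intro coprimeI) (simp add: u)
    ultimately show ?thesis by (simp add: ab \<mu>)
  qed
  moreover have "coprime (u0 * (- \<beta>) - u2 * \<eta>) (int \<mu>)"
  proof -
    have "u0 * (- \<beta>) - u2 * \<eta> = f * (\<beta> * u1 + \<alpha> * u2)" by (simp add: u0_def \<eta>_def algebra_simps)
    moreover have "coprime f m" using unit1 by (intro coprimeI) (simp add: u)
    ultimately show ?thesis by (simp add: ab \<mu>)
  qed
  moreover have "coprime (u1 * (- \<beta>) - u2 * \<alpha>) (int \<mu>)"
  proof -
    have "u1 * (- \<beta>) - u2 * \<alpha> = - (\<beta> * u1 + \<alpha> * u2)" by (simp add: algebra_simps)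
    thus ?thesis by (simp add: ab)
  qed
  ultimately have dm: "degree_matrix (\<mu>, q)"
    unfolding q_def using \<mu> u12 u0pos cop12 by (intro degree_matrix_vectorI)
  let ?P = "matrix_2_3 a b c"
  have Pm: "transpose ?P *v v = vector [x0 * v $ 1 + y0 * v $ 2, x1 * v $ 1 + y1 * v $ 2, x2 * v $ 1 + y2 * v $ 2]" for v
    by (simp add: vec_eq_iff forall_3 matrix_vector_mult_def transpose_def sum_2 matrix_2_3_def abc)
  have "inj (\<lambda>v. transpose ?P *v v)"
  proof (rule injI)
    fix v v' assume "transpose ?P *v v = transpose ?P *v v'"
    hence e: "x0 * (v $ 1 - v' $ 1) + y0 * (v $ 2 - v' $ 2) = 0" "x1 * (v $ 1 - v' $ 1) + y1 * (v $ 2 - v' $ 2) = 0"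
      unfolding Pm by (simp_all add: vec_eq_iff forall_3 algebra_simps)
    have "w2 * (v $ 1 - v' $ 1) = y0 * (x1 * (v $ 1 - v' $ 1) + y1 * (v $ 2 - v' $ 2)) - y1 * (x0 * (v $ 1 - v' $ 1) + y0 * (v $ 2 - v' $ 2))"
      "w2 * (v $ 2 - v' $ 2) = x1 * (x0 * (v $ 1 - v' $ 1) + y0 * (v $ 2 - v' $ 2)) - x0 * (x1 * (v $ 1 - v' $ 1) + y1 * (v $ 2 - v' $ 2))"
      by (simp_all add: W algebra_simps)
    thus "v = v'" using wpos unfolding e by (simp add: vec_eq_iff forall_2)
  qed
  moreover have dmap: "degree_map (\<mu>, q) v = (0, 0) \<longleftrightarrow>
      u0 * v $ 1 + u1 * v $ 2 + u2 * v $ 3 = 0 \<and> m dvd v $ 1 * \<eta> + v $ 2 * \<alpha> - v $ 3 * \<beta>" for v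
  proof -
    have "(v $ 1 * (\<eta> mod m) + v $ 2 * (\<alpha> mod m) + v $ 3 * ((- \<beta>) mod m)) mod m =
      (v $ 1 * \<eta> + v $ 2 * \<alpha> + v $ 3 * (- \<beta>)) mod m"
      by (intro mod_add_cong mod_mult_cong mod_mod_trivial refl)
    thus ?thesis
      by (simp add: degree_map_def sum_3 q_def \<mu> mod_eq_0_iff_dvd mult.commute)
  qed
  have "range (\<lambda>v. transpose ?P *v v) = {v. degree_map (\<mu>, q) v = (0, 0)}"
  proof (intro subset_antisym subsetI)
    fix x assume "x \<in> range (\<lambda>v. transpose ?P *v v)"
    then obtain v where x: "x = transpose ?P *v v" by blast
    have "m * (u0 * x $ 1 + u1 * x $ 2 + u2 * x $ 3) = w0 * x $ 1 + w1 * x $ 2 + w2 * x $ 3"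
      by (simp add: u0 u algebra_simps)
    also have "\<dots> = 0" unfolding x Pm W by (simp add: algebra_simps)
    finally have 1: "u0 * x $ 1 + u1 * x $ 2 + u2 * x $ 3 = 0" using m by simp
    have "x $ 1 * \<eta> + x $ 2 * \<alpha> - x $ 3 * \<beta> =
        \<alpha> * ((x1 - f * x0) * v $ 1 + (y1 - f * y0) * v $ 2) - \<beta> * ((x2 - g * x0) * v $ 1 + (y2 - g * y0) * v $ 2)"
      unfolding x Pm by (simp add: \<eta>_def algebra_simps)
    also have "\<dots> = \<alpha> * (w2 * s * v $ 1 - w2 * r * v $ 2) - \<beta> * (- w1 * s * v $ 1 + w1 * r * v $ 2)"
      unfolding v1 v2 by simp
    also have "m dvd \<dots>" unfolding u by (simp add: dvd_diff dvd_add mult.assoc dvd_mult)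
    finally show "x \<in> {v. degree_map (\<mu>, q) v = (0, 0)}" using 1 dmap by simp
  next
    fix x assume "x \<in> {v. degree_map (\<mu>, q) v = (0, 0)}"
    hence 1: "u0 * x $ 1 + u1 * x $ 2 + u2 * x $ 3 = 0" and "m dvd x $ 1 * \<eta> + x $ 2 * \<alpha> - x $ 3 * \<beta>"
      using dmap by auto
    then obtain k where k: "x $ 1 * \<eta> + x $ 2 * \<alpha> - x $ 3 * \<beta> = m * k" by (auto elim: dvdE)
    define y z where "y = x $ 2 - f * x $ 1" and "z = x $ 3 - g * x $ 1"
    have yz: "u1 * y + u2 * z = 0" "\<alpha> * y - \<beta> * z = m * k"
      using 1 k by (simp_all add: y_def z_def u0_def \<eta>_def algebra_simps)
    have "y = (\<beta> * u1 + \<alpha> * u2) * y" by (simp add: ab)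
    also have "\<dots> = \<beta> * (u1 * y + u2 * z) + u2 * (\<alpha> * y - \<beta> * z)" by (simp add: algebra_simps)
    finally have y: "y = w2 * k" unfolding yz u by simp
    have "z = (\<beta> * u1 + \<alpha> * u2) * z" by (simp add: ab)
    also have "\<dots> = \<alpha> * (u1 * y + u2 * z) - u1 * (\<alpha> * y - \<beta> * z)" by (simp add: algebra_simps)
    finally have z: "z = - w1 * k" unfolding yz u by simp
    define v :: "int ^ 2" where "v = vector [x $ 1 * r + k * y0, x $ 1 * s - k * x0]"
    have "x0 * v $ 1 + y0 * v $ 2 = x $ 1 * (r * x0 + s * y0)" by (simp add: v_def algebra_simps)
    moreover have "x1 * v $ 1 + y1 * v $ 2 = f * x $ 1 + y" by (simp add: v_def y f W algebra_simps)
    moreover have "x2 * v $ 1 + y2 * v $ 2 = g * x $ 1 + z" by (simp add: v_def z g W algebra_simps)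
    ultimately have "x = transpose ?P *v v"
      unfolding Pm by (simp add: vec_eq_iff forall_3 rs y_def z_def)
    thus "x \<in> range (\<lambda>v. transpose ?P *v v)" by blast
  qed
  moreover have "range (degree_map (\<mu>, q)) = carrier (degree_group \<mu>)"
  proof (intro subset_antisym subsetI)
    fix d assume "d \<in> range (degree_map (\<mu>, q))"
    thus "d \<in> carrier (degree_group \<mu>)" using \<mu> m by (auto simp: degree_map_def carrier_degree_group)
  next
    fix d assume d: "d \<in> carrier (degree_group \<mu>)"
    have carr: "q $ i \<in> carrier (degree_group \<mu>)" for i using dm by (simp add: degree_matrix_def)
    have "generate (degree_group \<mu>) {q $ 1, q $ 2} = carrier (degree_group \<mu>)"
      using dm by (simp add: degree_matrix_def)
    then obtain x y where "d = (x * fst (q $ 1) + y * fst (q $ 2), (x * snd (q $ 1) + y * snd (q $ 2)) mod int \<mu>)"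
      using d generate_pair[OF \<mu>(2) carr[of 1] carr[of 2]] by blast
    hence "d = degree_map (\<mu>, q) (vector [x, y, 0])" by (simp add: degree_map_def sum_3)
    thus "d \<in> range (degree_map (\<mu>, q))" by blast
  qed
  ultimately have "corresponding ?P (\<mu>, q)"
    unfolding corresponding_def fst_conv using projective_generator_matrix_2_3[OF prim pos] dm by blast
  thus thesis
    using that[of \<mu> q] by (simp add: q_def \<mu> u0 u w[symmetric])
qed


section \<open>Adjacent degree matrices\<close>

text \<open>An automorphism of the degree group changes neither kernel nor surjectivity. Hence Q can
  be adjusted while the generator matrix P stays fixed.\<close>

lemma corresponding_twist:
  assumes "corresponding P Q" "coprime e (int (fst Q))"
  shows "corresponding P (twist e c Q)"
proof -
  obtain \<mu> q where Q: "Q = (\<mu>, q)" by (cases Q)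
  define A S where "A x = (\<Sum>i\<in>UNIV. x $ i * fst (q $ i))" and "S x = (\<Sum>i\<in>UNIV. x $ i * snd (q $ i))" for x
  have dQ: "degree_map Q x = (A x, S x mod int \<mu>)" for x
    by (simp add: degree_map_def Q A_def S_def)
  have dT: "degree_map (twist e c Q) x = (A x, (e * S x + c * A x) mod int \<mu>)" for x
  proof -
    have "(\<Sum>i\<in>UNIV. x $ i * ((e * snd (q $ i) + c * fst (q $ i)) mod int \<mu>)) mod int \<mu> =
        (\<Sum>i\<in>UNIV. x $ i * (e * snd (q $ i) + c * fst (q $ i))) mod int \<mu>"
      unfolding sum_3 by (intro mod_add_cong mod_mult_cong mod_mod_trivial refl)
    also have "(\<Sum>i\<in>UNIV. x $ i * (e * snd (q $ i) + c * fst (q $ i))) = e * S x + c * A x"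
      by (simp add: A_def S_def sum_3 algebra_simps)
    finally show ?thesis by (simp add: degree_map_def twist_def Q A_def)
  qed
  have \<mu>: "1 \<le> \<mu>" using assms by (simp add: corresponding_def Q degree_matrix_iff)
  have kernel: "degree_map (twist e c Q) x = (0, 0) \<longleftrightarrow> degree_map Q x = (0, 0)" for x
  proof -
    have "coprime (int \<mu>) e" using assms(2) by (simp add: Q coprime_commute)
    hence "int \<mu> dvd e * S x \<longleftrightarrow> int \<mu> dvd S x" by (simp add: coprime_dvd_mult_right_iff)
    thus ?thesis unfolding dQ dT by (auto simp: mod_eq_0_iff_dvd)
  qed
  have "range (degree_map (twist e c Q)) = carrier (degree_group \<mu>)"
  proof (intro subset_antisym subsetI)
    fix d assume "d \<in> range (degree_map (twist e c Q))"
    thus "d \<in> carrier (degree_group \<mu>)" using \<mu> by (auto simp: dT carrier_degree_group)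
  next
    fix d assume d: "d \<in> carrier (degree_group \<mu>)"
    obtain X T where XT: "d = (X, T)" "0 \<le> T" "T < int \<mu>"
      using d unfolding carrier_degree_group[OF \<mu>] by (cases d) auto
    obtain f g where fg: "f * e + g * int \<mu> = 1"
      using assms(2) unfolding Q by (metis bezout_int coprime_iff_gcd_eq_1 fst_conv)
    have "(X, (f * (T - c * X)) mod int \<mu>) \<in> range (degree_map Q)"
      using assms(1) \<mu> unfolding corresponding_def Q by (simp add: carrier_degree_group)
    then obtain x where x: "A x = X" "S x mod int \<mu> = (f * (T - c * X)) mod int \<mu>"
      by (metis dQ imageE prod.inject)
    have "(e * S x + c * A x) mod int \<mu> = (e * (f * (T - c * X)) + c * X) mod int \<mu>"
      by (intro mod_add_cong mod_mult_cong) (simp_all add: x)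
    also have "e * (f * (T - c * X)) + c * X = (f * e) * (T - c * X) + c * X" by simp
    also have "f * e = 1 - g * int \<mu>" using fg by simp
    also have "((1 - g * int \<mu>) * (T - c * X) + c * X) mod int \<mu> = T"
    proof -
      have "(1 - g * int \<mu>) * (T - c * X) + c * X = T + int \<mu> * (- g * (T - c * X))"
        by (simp add: algebra_simps)
      thus ?thesis using XT by (metis mod_mult_self2 mod_pos_pos_trivial)
    qed
    finally have "degree_map (twist e c Q) x = d" using x by (simp add: dT XT)
    thus "d \<in> range (degree_map (twist e c Q))" by blast
  qed
  moreover have "degree_matrix (twist e c Q)"
    using assms degree_matrix_twist by (simp add: corresponding_def)
  ultimately show ?thesis
    using assms(1) unfolding corresponding_def kernel by (simp add: twist_def Q)
qed

lemma corresponding_adjusted_exists: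
  fixes d :: int
  assumes prim: "coprime (fst a) (snd a)" "coprime (fst b) (snd b)" "coprime (fst c) (snd c)"
    and pos: "0 < clockwise a b" "0 < clockwise b c" "0 < clockwise c a"
    and eq: "(clockwise b c + clockwise c a + clockwise a b)\<^sup>2 =
      d * (clockwise b c * clockwise c a * clockwise a b)"
  obtains Q p where "corresponding (matrix_2_3 a b c) Q" "fake_weight Q $ 1 = clockwise b c"
    "fake_weight Q $ 2 = clockwise c a" "bij p" "adjusted (permute_columns p Q)"
proof -
  obtain \<mu> q where Q: "corresponding (matrix_2_3 a b c) (\<mu>, q)"
    and w: "int \<mu> * fst (q $ 1) = clockwise b c" "int \<mu> * fst (q $ 2) = clockwise c a"
      "int \<mu> * fst (q $ 3) = clockwise a b"
    using corresponding_exists[OF prim pos] by blast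
  have dm: "degree_matrix (\<mu>, q)" using Q by (simp add: corresponding_def)
  obtain e f p where *: "coprime e (int \<mu>)" "bij p" "adjusted (permute_columns p (twist e f (\<mu>, q)))"
    using adjusted_twist_exists[OF dm, of d] eq unfolding w by blast
  have tw: "twist e f (\<mu>, q) = (\<mu>, snd (twist e f (\<mu>, q)))" by (simp add: twist_def)
  have "degree_matrix (twist e f (\<mu>, q))" using degree_matrix_twist[OF dm] * by simp
  hence "fake_weight (twist e f (\<mu>, q)) = (\<chi> i. int \<mu> * fst (q $ i))"
    by (subst tw, subst fake_weight_eq) (simp_all add: tw[symmetric] twist_def)
  thus thesis
    using that[of "twist e f (\<mu>, q)" p] corresponding_twist[OF Q, of e f] * w by simp
qed

lemma associated_matrix_eq:
  "associated_matrix l1 l2 d0 d1 d2 = matrix_2_3 (l1, d1) (l1, d1 + l1 * d0) (- l2, d2)"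
  by (simp add: associated_matrix_def matrix_2_3_def)

lemma vector_4 [simp]:
  "(vector [w, x, y, z] :: 'a :: zero ^ 4) $ 1 = w" "(vector [w, x, y, z] :: 'a :: zero ^ 4) $ 2 = x"
  "(vector [w, x, y, z] :: 'a :: zero ^ 4) $ 3 = y" "(vector [w, x, y, z] :: 'a :: zero ^ 4) $ 4 = z"
  by (simp_all add: vector_def)

text \<open>The columns satisfy a linear relation with the positive coefficients W0, W1, -D0 L2, -D0
  L1. The difference of the first two columns is vertical, so together with the last two it spans
  the space rationally; a large multiple t of the relation then makes any expansion
  nonnegative.\<close>

lemma projective_adjacency_matrix:
  assumes l: "0 < l1" "0 < l2" and gcds: "gcd l1 d1 = 1" "gcd l2 d2 = 1" and d0: "d0 < 0"
    and w1: "0 < l1 * d2 + l2 * d1" and w0: "l1 * l2 * d0 + l1 * d2 + l2 * d1 < 0"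
  shows "projective_generator_matrix (adjacency_matrix l1 l2 d0 d1 d2)"
proof -
  let ?P = "adjacency_matrix l1 l2 d0 d1 d2"
  have "inj (\<lambda>j. column j ?P)"
    using l d0 unfolding inj_on_def Ball_def
    by (auto simp: forall_4 column_def vec_eq_iff forall_3 adjacency_matrix_def)
  moreover have "\<forall>j. primitive_vec (column j ?P)"
    using gcds by (simp add: forall_4 column_def primitive_vec_def UNIV_3 adjacency_matrix_def)
  moreover have "\<exists>k :: rat ^ 4. (\<forall>j. 0 \<le> k $ j) \<and> x = (\<chi> i. \<Sum>j\<in>UNIV. k $ j * of_int (?P $ i $ j))" for x :: "rat ^ 3"
  proof -
    define L1 L2 D0 D1 D2 :: rat where R: "L1 = of_int l1" "L2 = of_int l2" "D0 = of_int d0" "D1 = of_int d1" "D2 = of_int d2"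
    define W0 W1 where W: "W0 = - (L1 * L2 * D0 + L1 * D2 + L2 * D1)" "W1 = L1 * D2 + L2 * D1"
    have ge1: "(1 :: rat) \<le> of_int n" if "0 < n" for n using that by simp
    have ge: "1 \<le> W0" "1 \<le> W1" "1 \<le> - D0 * L2" "1 \<le> - D0 * L1"
      using ge1[of "- (l1 * l2 * d0 + l1 * d2 + l2 * d1)"] ge1[of "l1 * d2 + l2 * d1"] ge1[of "- d0 * l2"] ge1[of "- d0 * l1"]
        w0 w1 l d0 mult_neg_pos[of d0 l1] mult_neg_pos[of d0 l2] by (simp_all add: W R)
    have nz: "L1 \<noteq> 0" "L2 \<noteq> 0" "D0 \<noteq> 0" using l d0 by (simp_all add: R)
    define p q r where "p = x $ 1 / L1" and "q = x $ 2 / L2" and "r = (x $ 3 - p * D1 - q * D2) / D0"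
    have pqr: "x $ 1 = p * L1" "x $ 2 = q * L2" "x $ 3 = p * D1 + q * D2 + r * D0"
      using nz by (simp_all add: p_def q_def r_def)
    define t where "t = \<bar>p\<bar> + \<bar>q\<bar> + \<bar>r\<bar>"
    have t: "t \<le> t * w" if "1 \<le> w" for w using that by (simp add: t_def mult_le_cancel_left1)
    define k :: "rat ^ 4" where "k = vector [- r + t * W0, r + t * W1, p + t * (- D0 * L2), q + t * (- D0 * L1)]"
    have "- t \<le> p" "- t \<le> q" "- t \<le> r" "- t \<le> - r" by (simp_all add: t_def)
    hence "0 \<le> - r + t * W0" "0 \<le> r + t * W1" "0 \<le> p + t * (- D0 * L2)" "0 \<le> q + t * (- D0 * L1)"
      using t[OF ge(1)] t[OF ge(2)] t[OF ge(3)] t[OF ge(4)] by linarith+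
    hence "\<forall>j. 0 \<le> k $ j" unfolding forall_4 k_def by simp
    moreover have "x = (\<chi> i. \<Sum>j\<in>UNIV. k $ j * of_int (?P $ i $ j))"
      unfolding vec_eq_iff forall_3
      by (simp add: sum_4 k_def pqr adjacency_matrix_def R[symmetric]) (simp add: W algebra_simps)
    ultimately show ?thesis by blast
  qed
  ultimately show ?thesis unfolding projective_generator_matrix_def by simp
qed

lemma adjacency_dataI:
  assumes "1 \<le> d1" "d1 \<le> l1" "l1 \<le> l2" "gcd l1 d1 = 1" "gcd l2 d2 = 1" "d0 < 0"
    and w1: "0 < l1 * d2 + l2 * d1" and w0: "l1 * l2 * d0 + l1 * d2 + l2 * d1 < 0"
  shows "adjacency_data l1 l2 d0 d1 d2"
proof -
  have l: "0 < l1" "0 < l2" using assms by auto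
  define r where "r = (of_int l1 * of_int l2 :: rat)"
  have r: "0 < r" using l by (simp add: r_def)
  have "of_int d1 / of_int l1 + of_int d2 / of_int l2 = (of_int (l1 * d2 + l2 * d1) :: rat) / r"
    using l by (simp add: r_def field_simps)
  moreover have "of_int d0 + of_int d1 / of_int l1 + of_int d2 / of_int l2 =
      (of_int (l1 * l2 * d0 + l1 * d2 + l2 * d1) :: rat) / r"
    using l by (simp add: r_def field_simps)
  moreover have "0 < (of_int (l1 * d2 + l2 * d1) :: rat)" "(of_int (l1 * l2 * d0 + l1 * d2 + l2 * d1) :: rat) < 0"
    using w0 w1 by (simp_all only: of_int_0_less_iff of_int_less_0_iff)
  ultimately have "of_int d0 + of_int d1 / of_int l1 + of_int d2 / of_int l2 < (0::rat)"
     "(0::rat) < of_int d1 / of_int l1 + of_int d2 / of_int l2"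
    using r by (simp_all only: divide_pos_pos divide_neg_pos)
  thus ?thesis
    unfolding adjacency_data_def using assms projective_adjacency_matrix[OF l assms(4,5,6) w1 w0] by simp
qed

text \<open>With g = L D the degree equation reduces to D(L + M)^2 = a w0 w1. This is symmetric in L
  and M, so exchanging (L, y) with (M, z) gives a second triangle of the same degree. The smaller of
  L and M has to play l1, so the first triangle may be either of the two associated matrices;
  \<open>normal\<close> records which.\<close>

lemma adjacent_exists:
  fixes L M D y z a :: int
  assumes pos: "0 < L" "0 < M" "0 < D"
    and prim: "coprime L y" "coprime L (y - L * D)" "coprime M z"
    and w1: "w1 = L * z + M * y" "0 < w1" and w0: "w0 = L * M * D - w1" "0 < w0" "w0 \<le> w1"
    and eq: "(w0 + w1 + D * L\<^sup>2)\<^sup>2 = a * (w0 * w1 * (D * L\<^sup>2))"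
    and normal: "L \<le> M \<and> 1 \<le> y \<and> y \<le> L \<or> M \<le> L \<and> 1 \<le> z \<and> z \<le> M"
  shows "\<exists>Q1 Q2. adjacent Q1 Q2 \<and> corresponding (matrix_2_3 (L, y) (L, y - L * D) (- M, z)) Q1"
proof -
  have cl: "clockwise (L, y) (L, y - L * D) = D * L\<^sup>2"
      "clockwise (L, y - L * D) (- M, z) = w0" "clockwise (- M, z) (L, y) = w1"
      "clockwise (M, z) (M, z - M * D) = D * M\<^sup>2"
      "clockwise (M, z - M * D) (- L, y) = w0" "clockwise (- L, y) (M, z) = w1"
    by (simp_all add: clockwise_def w1(1) w0(1) power2_eq_square algebra_simps)
  have cop: "coprime M (z - M * D)"
    using prim(3) by (simp add: coprime_iff_gcd_eq_1) (metis gcd_add_mult gcd.commute diff_conv_add_uminus mult_minus_right add.commute mult.commute)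
  have sum: "w0 + w1 = L * M * D" by (simp add: w0(1))
  have "(D * L * (L + M))\<^sup>2 = a * (w0 * w1 * (D * L\<^sup>2))"
    using eq unfolding sum by (simp add: power2_eq_square algebra_simps)
  hence "(D * L\<^sup>2) * (D * (L + M)\<^sup>2) = (D * L\<^sup>2) * (a * (w0 * w1))"
    by (simp add: power2_eq_square algebra_simps)
  hence red: "D * (L + M)\<^sup>2 = a * (w0 * w1)" using pos by simp
  have eq2: "(w0 + w1 + D * M\<^sup>2)\<^sup>2 = a * (w0 * w1 * (D * M\<^sup>2))"
  proof -
    have "(w0 + w1 + D * M\<^sup>2)\<^sup>2 = D * M\<^sup>2 * (D * (L + M)\<^sup>2)"
      unfolding sum by (simp add: power2_eq_square algebra_simps)
    thus ?thesis unfolding red by simp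
  qed
  have sq: "0 < D * L\<^sup>2" "0 < D * M\<^sup>2" using pos by simp_all
  obtain Q1 p1 where Q1: "corresponding (matrix_2_3 (L, y) (L, y - L * D) (- M, z)) Q1"
    "fake_weight Q1 $ 1 = w0" "fake_weight Q1 $ 2 = w1" "bij p1" "adjusted (permute_columns p1 Q1)"
    by (rule corresponding_adjusted_exists[of "(L, y)" "(L, y - L * D)" "(- M, z)" a])
       (use prim w0 w1 sq eq in \<open>simp_all add: cl\<close>)
  obtain Q2 p2 where Q2: "corresponding (matrix_2_3 (M, z) (M, z - M * D) (- L, y)) Q2"
    "fake_weight Q2 $ 1 = w0" "fake_weight Q2 $ 2 = w1" "bij p2" "adjusted (permute_columns p2 Q2)"
    by (rule corresponding_adjusted_exists[of "(M, z)" "(M, z - M * D)" "(- L, y)" a])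
       (use prim cop w0 w1 sq eq2 in \<open>simp_all add: cl\<close>)
  have P1: "matrix_2_3 (L, y) (L, y - L * D) (- M, z) = associated_matrix L M (- D) y z"
    and P2: "matrix_2_3 (M, z) (M, z - M * D) (- L, y) = associated_matrix M L (- D) z y"
    by (simp_all add: associated_matrix_eq)
  have neg: "L * M * (- D) + L * z + M * y < 0" using w0 by (simp add: w1)
  have "adjacency_data L M (- D) y z \<or> adjacency_data M L (- D) z y"
    using normal
  proof
    assume "L \<le> M \<and> 1 \<le> y \<and> y \<le> L"
    thus ?thesis using prim pos w1 neg
      by (intro disjI1 adjacency_dataI) (auto simp: coprime_iff_gcd_eq_1)
  next
    assume "M \<le> L \<and> 1 \<le> z \<and> z \<le> M"
    thus ?thesis using prim pos w1 neg
      by (intro disjI2 adjacency_dataI) (auto simp: coprime_iff_gcd_eq_1 algebra_simps)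
  qed
  hence "\<exists>l1 l2 d0 d1 d2. \<exists>P1 P2. adjacency_data l1 l2 d0 d1 d2 \<and>
      corresponding P1 Q1 \<and> corresponding P2 Q2 \<and>
      (P1 = associated_matrix l1 l2 d0 d1 d2 \<and> P2 = associated_matrix l2 l1 d0 d2 d1 \<or>
       P2 = associated_matrix l1 l2 d0 d1 d2 \<and> P1 = associated_matrix l2 l1 d0 d2 d1)"
    using Q1(1) Q2(1) unfolding P1 P2 by metis
  moreover have "degree_matrix Q1" "degree_matrix Q2" using Q1(1) Q2(1) by (simp_all add: corresponding_def)
  ultimately have "adjacent Q1 Q2"
    unfolding adjacent_def using Q1 Q2 w0 by auto
  thus ?thesis using Q1(1) by blast
qed


section \<open>Fans of fake weighted projective planes\<close>

definition cross :: "real ^ 2 \<Rightarrow> real ^ 2 \<Rightarrow> real" where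
  "cross x y = x $ 1 * y $ 2 - x $ 2 * y $ 1"

lemma cross_simps [simp]:
  "cross x x = 0" "cross (x + y) z = cross x z + cross y z" "cross x (y + z) = cross x y + cross x z"
  "cross (c *\<^sub>R x) y = c * cross x y" "cross x (c *\<^sub>R y) = c * cross x y"
  "cross 0 x = 0" "cross x 0 = 0" "cross (- x) y = - cross x y" "cross x (- y) = - cross x y"
  by (simp_all add: cross_def algebra_simps)

lemma cross_swap: "cross y x = - cross x y"
  by (simp add: cross_def)

lemma cross_expand:
  assumes "cross v w \<noteq> 0"
  shows "x = (cross x w / cross v w) *\<^sub>R v + (cross v x / cross v w) *\<^sub>R w"
  using assms unfolding vec_eq_iff forall_2
  by (simp add: divide_simps) (simp add: cross_def algebra_simps)

lemma cross_eq_0D: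
  assumes "cross v x = 0" "v \<noteq> 0"
  obtains c where "x = c *\<^sub>R v"
proof -
  have "(v $ 1)\<^sup>2 + (v $ 2)\<^sup>2 \<noteq> 0" using assms(2) by (simp add: vec_eq_iff forall_2 sum_power2_eq_zero_iff)
  hence "x = ((v $ 1 * x $ 1 + v $ 2 * x $ 2) / ((v $ 1)\<^sup>2 + (v $ 2)\<^sup>2)) *\<^sub>R v"
    using assms(1) unfolding vec_eq_iff forall_2 cross_def
    by (simp add: divide_simps power2_eq_square) (simp add: algebra_simps)
  thus thesis by (rule that)
qed

lemma convex_cone_hull_empty: "convex_cone hull {} = {0 :: 'a :: real_vector}"
  by (rule hull_unique) (auto simp: convex_cone_contains_0)

lemma convex_cone_hull_singleton:
  "convex_cone hull {x :: 'a :: real_vector} = {c *\<^sub>R x | c. 0 \<le> c}"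
proof (rule hull_unique)
  show "{x} \<subseteq> {c *\<^sub>R x | c. 0 \<le> c}" by (auto intro: exI[of _ 1])
  show "convex_cone {c *\<^sub>R x | c. 0 \<le> c}"
    unfolding convex_cone_iff
  proof (intro conjI ballI allI impI)
    show "0 \<in> {c *\<^sub>R x | c. 0 \<le> c}" by (auto intro: exI[of _ 0])
  next
    fix y z assume "y \<in> {c *\<^sub>R x | c. 0 \<le> c}" "z \<in> {c *\<^sub>R x | c. 0 \<le> c}"
    then obtain c d where "0 \<le> c" "0 \<le> d" "y = c *\<^sub>R x" "z = d *\<^sub>R x" by auto
    hence "0 \<le> c + d" "y + z = (c + d) *\<^sub>R x" by (simp_all add: scaleR_left_distrib)
    thus "y + z \<in> {c *\<^sub>R x | c. 0 \<le> c}" by blast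
  next
    fix y and d :: real assume "y \<in> {c *\<^sub>R x | c. 0 \<le> c}" "0 \<le> d"
    then obtain c where "0 \<le> c" "y = c *\<^sub>R x" by auto
    hence "0 \<le> d * c" "d *\<^sub>R y = (d * c) *\<^sub>R x" using \<open>0 \<le> d\<close> by simp_all
    thus "d *\<^sub>R y \<in> {c *\<^sub>R x | c. 0 \<le> c}" by blast
  qed
qed (auto simp: convex_cone_scaleR)

lemma convex_cone_hull_pair:
  "convex_cone hull {x, y :: 'a :: real_vector} = {c *\<^sub>R x + d *\<^sub>R y | c d. 0 \<le> c \<and> 0 \<le> d}"
  unfolding insert_is_Un[of x "{y}"] convex_cone_hull_Un convex_cone_hull_singleton by blast

lemma mem_convex_cone_hull_pair:
  assumes "0 < cross v w"
  shows "x \<in> convex_cone hull {v, w} \<longleftrightarrow> 0 \<le> cross v x \<and> 0 \<le> cross x w"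
proof
  assume "x \<in> convex_cone hull {v, w}"
  thus "0 \<le> cross v x \<and> 0 \<le> cross x w" using assms by (auto simp: convex_cone_hull_pair)
next
  assume "0 \<le> cross v x \<and> 0 \<le> cross x w"
  thus "x \<in> convex_cone hull {v, w}"
    using cross_expand[of v w x] assms divide_nonneg_pos unfolding convex_cone_hull_pair mem_Collect_eq
    by (metis less_irrefl)
qed

lemma pointed_cone_subset: "pointed_cone \<sigma> \<Longrightarrow> \<tau> \<subseteq> \<sigma> \<Longrightarrow> pointed_cone \<tau>"
  unfolding pointed_cone_def by blast

text \<open>Generators are added one at a time. A new x lies in the cone so far, replaces one of its
  boundary rays, or spans a second ray next to a single one. The remaining positions would put both
  x and -x, or v and -v, into the cone, which pointedness forbids for nonzero vectors.\<close>

lemma pointed_planar_cone_cases: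
  fixes F :: "(real ^ 2) set"
  assumes "finite F" "pointed_cone (convex_cone hull F)"
  shows "convex_cone hull F = {0} \<or> (\<exists>v\<in>F. v \<noteq> 0 \<and> convex_cone hull F = convex_cone hull {v}) \<or>
    (\<exists>v\<in>F. \<exists>w\<in>F. 0 < cross v w \<and> convex_cone hull F = convex_cone hull {v, w})"
  using assms
proof (induction F rule: finite_induct)
  case empty
  show ?case by (simp add: convex_cone_hull_empty)
next
  case (insert x F)
  have eq: "convex_cone hull insert x F = convex_cone hull insert x G"
    if "convex_cone hull F = convex_cone hull G" for G
    using hull_insert[of convex_cone x F] hull_insert[of convex_cone x G] that by simp
  have "pointed_cone (convex_cone hull F)"
    using insert.prems by (rule pointed_cone_subset) (rule hull_mono, blast)
  then consider "convex_cone hull F = {0}"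
    | v where "v \<in> F" "v \<noteq> 0" "convex_cone hull F = convex_cone hull {v}"
    | v w where "v \<in> F" "w \<in> F" "0 < cross v w" "convex_cone hull F = convex_cone hull {v, w}"
    using insert.IH by blast
  thus ?case
  proof cases
    case 1
    hence 1: "convex_cone hull insert x F = convex_cone hull {x}"
      using eq[of "{}"] by (simp add: convex_cone_hull_empty)
    show ?thesis
    proof (cases "x = 0")
      case True
      thus ?thesis unfolding 1 by (auto simp: convex_cone_hull_singleton)
    qed (use 1 in blast)
  next
    case (2 v)
    note hull = eq[OF 2(3)]
    consider "0 < cross x v" | "0 < cross v x" | "cross v x = 0" using cross_swap[of x v] by linarith
    thus ?thesis
    proof cases
      case 1
      thus ?thesis unfolding hull using 2(1) by blast
    next
      case 2
      thus ?thesis unfolding hull insert_commute[of x v] using \<open>v \<in> F\<close> by blast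
    next
      case 3
      then obtain c where c: "x = c *\<^sub>R v" using cross_eq_0D 2(2) by blast
      have "0 \<le> c"
      proof (rule ccontr)
        assume "\<not> 0 \<le> c"
        hence "- v = (- 1 / c) *\<^sub>R x" "0 \<le> - 1 / c" by (auto simp: c divide_simps)
        hence "- v \<in> convex_cone hull {x, v}"
          by (metis convex_cone_hull_mul hull_inc insertI1)
        moreover have "v \<in> convex_cone hull {x, v}" by (simp add: hull_inc)
        ultimately show False using insert.prems 2(2) unfolding hull pointed_cone_def by blast
      qed
      hence "x \<in> convex_cone hull {v}" unfolding convex_cone_hull_singleton c by blast
      hence "convex_cone hull {x, v} = convex_cone hull {v}" by (rule hull_redundant)
      thus ?thesis unfolding hull using 2 by blast
    qed
  next
    case (3 v w)
    note hull = eq[OF 3(4)]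
    define \<alpha> \<beta> where "\<alpha> = cross x w / cross v w" and "\<beta> = cross v x / cross v w"
    have x: "x = \<alpha> *\<^sub>R v + \<beta> *\<^sub>R w" unfolding \<alpha>_def \<beta>_def using 3(3) by (intro cross_expand) simp
    consider "0 \<le> \<alpha>" "0 \<le> \<beta>" | "0 < \<alpha>" "\<beta> < 0" | "\<alpha> < 0" "0 < \<beta>" | "\<alpha> \<le> 0" "\<beta> \<le> 0" "\<alpha> < 0 \<or> \<beta> < 0"
      by linarith
    thus ?thesis
    proof cases
      case 1
      hence "x \<in> convex_cone hull {v, w}" unfolding x convex_cone_hull_pair by blast
      thus ?thesis using hull hull_redundant[of x convex_cone "{v, w}"] 3 by auto
    next
      case 2
      have "v = (1 / \<alpha>) *\<^sub>R x + (- \<beta> / \<alpha>) *\<^sub>R w" using 2 by (simp add: x algebra_simps)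
      moreover have "0 \<le> 1 / \<alpha>" "0 \<le> - \<beta> / \<alpha>" using 2 by (simp_all add: divide_simps)
      ultimately have "v \<in> convex_cone hull {x, w}" unfolding convex_cone_hull_pair by blast
      hence "convex_cone hull insert v {x, w} = convex_cone hull {x, w}" by (rule hull_redundant)
      moreover have "0 < cross x w" using 2 3(3) by (simp add: x)
      ultimately show ?thesis using hull 3(2) by (auto simp: insert_commute)
    next
      case 3
      have "w = (- \<alpha> / \<beta>) *\<^sub>R v + (1 / \<beta>) *\<^sub>R x" using 3 by (simp add: x algebra_simps)
      moreover have "0 \<le> 1 / \<beta>" "0 \<le> - \<alpha> / \<beta>" using 3 by (simp_all add: divide_simps)
      ultimately have "w \<in> convex_cone hull {v, x}" unfolding convex_cone_hull_pair by blast
      hence "convex_cone hull insert w {v, x} = convex_cone hull {v, x}" by (rule hull_redundant)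
      moreover have "0 < cross v x" using 3 \<open>0 < cross v w\<close> by (simp add: x)
      ultimately show ?thesis using hull \<open>v \<in> F\<close> by (auto simp: insert_commute)
    next
      case 4
      have "- x = (- \<alpha>) *\<^sub>R v + (- \<beta>) *\<^sub>R w" by (simp add: x)
      moreover have "0 \<le> - \<alpha>" "0 \<le> - \<beta>" using 4 by simp_all
      ultimately have "- x \<in> convex_cone hull {v, w}" unfolding convex_cone_hull_pair by blast
      hence "- x \<in> convex_cone hull insert x F"
        unfolding hull using hull_mono[of "{v, w}" "insert x {v, w}" convex_cone] by blast
      moreover have "x \<in> convex_cone hull insert x F" by (simp add: hull_inc)
      ultimately have "x = 0" using insert.prems unfolding pointed_cone_def by blast
      hence "\<alpha> = 0" "\<beta> = 0" unfolding \<alpha>_def \<beta>_def by simp_all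
      thus ?thesis using 4 by simp
    qed
  qed
qed

lemma ray_face_of_cone:
  assumes "0 < cross v w"
  shows "convex_cone hull {v} face_of convex_cone hull {v, w}"
    and "convex_cone hull {w} face_of convex_cone hull {v, w}"
proof -
  note mem = mem_convex_cone_hull_pair[OF assms]
  \<comment> \<open>Both supporting lines are zero sets of cross products, rewritten as inner
    products with rotated vectors.\<close>
  have inner: "vector [- v $ 2, v $ 1] \<bullet> x = cross v x" "vector [w $ 2, - w $ 1] \<bullet> x = cross x w" for x
    by (simp_all add: inner_vec_def sum_2 cross_def)
  have "convex_cone hull {v} = convex_cone hull {v, w} \<inter> {x. vector [- v $ 2, v $ 1] \<bullet> x = 0}"
    unfolding inner
  proof (intro subset_antisym subsetI IntI CollectI)
    fix x assume x: "x \<in> convex_cone hull {v, w} \<inter> {x. cross v x = 0}"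
    then obtain c d where "x = c *\<^sub>R v + d *\<^sub>R w" "0 \<le> c" by (auto simp: convex_cone_hull_pair)
    moreover from this x assms have "d = 0" by simp
    ultimately show "x \<in> convex_cone hull {v}" by (auto simp: convex_cone_hull_singleton)
  next
    fix x assume "x \<in> convex_cone hull {v}"
    then obtain c where "0 \<le> c" "x = c *\<^sub>R v" by (auto simp: convex_cone_hull_singleton)
    thus "x \<in> convex_cone hull {v, w}" "cross v x = 0" using assms by (simp_all add: mem)
  qed
  thus "convex_cone hull {v} face_of convex_cone hull {v, w}"
    using face_of_Int_supporting_hyperplane_ge[of "convex_cone hull {v, w}" 0 "vector [- v $ 2, v $ 1]"]
    by (simp add: convex_convex_cone_hull mem inner)
  have "convex_cone hull {w} = convex_cone hull {v, w} \<inter> {x. vector [w $ 2, - w $ 1] \<bullet> x = 0}"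
    unfolding inner
  proof (intro subset_antisym subsetI IntI CollectI)
    fix x assume x: "x \<in> convex_cone hull {v, w} \<inter> {x. cross x w = 0}"
    then obtain c d where "x = c *\<^sub>R v + d *\<^sub>R w" "0 \<le> d" by (auto simp: convex_cone_hull_pair)
    moreover from this x assms have "c = 0" by simp
    ultimately show "x \<in> convex_cone hull {w}" by (auto simp: convex_cone_hull_singleton)
  next
    fix x assume "x \<in> convex_cone hull {w}"
    then obtain c where "0 \<le> c" "x = c *\<^sub>R w" by (auto simp: convex_cone_hull_singleton)
    thus "x \<in> convex_cone hull {v, w}" "cross x w = 0" using assms by (simp_all add: mem)
  qed
  thus "convex_cone hull {w} face_of convex_cone hull {v, w}"
    using face_of_Int_supporting_hyperplane_ge[of "convex_cone hull {v, w}" 0 "vector [w $ 2, - w $ 1]"]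
    by (simp add: convex_convex_cone_hull mem inner)
qed

lemma zero_face_of_ray: "{0} face_of convex_cone hull {v :: 'a :: euclidean_space}"
proof -
  have "{0} = convex_cone hull {v} \<inter> {x. v \<bullet> x = 0}"
    by (auto simp: convex_cone_hull_singleton)
  moreover have "\<And>x. x \<in> convex_cone hull {v} \<Longrightarrow> 0 \<le> v \<bullet> x" by (auto simp: convex_cone_hull_singleton)
  ultimately show ?thesis
    using face_of_Int_supporting_hyperplane_ge[of "convex_cone hull {v}" 0 v]
    by (simp add: convex_convex_cone_hull)
qed

section \<open>Primitive vectors and rational cones\<close>

definition icross :: "int ^ 2 \<Rightarrow> int ^ 2 \<Rightarrow> int" where
  "icross v w = v $ 1 * w $ 2 - v $ 2 * w $ 1"

lemma cross_real_vec: "cross (real_vec v) (real_vec w) = of_int (icross v w)"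
  by (simp add: cross_def icross_def real_vec_def)

lemma icross_swap: "icross w v = - icross v w" and icross_self [simp]: "icross v v = 0"
  by (simp_all add: icross_def)

lemma primitive_vec_2: "primitive_vec (v :: int ^ 2) \<longleftrightarrow> coprime (v $ 1) (v $ 2)"
  by (simp add: primitive_vec_def UNIV_2 coprime_iff_gcd_eq_1)

lemma primitive_vec_nonzero: "primitive_vec (v :: int ^ 2) \<Longrightarrow> real_vec v \<noteq> 0"
  by (auto simp: primitive_vec_2 vec_eq_iff forall_2 real_vec_def)

lemma primitive_multiple:
  fixes v :: "int ^ 2"
  assumes "real_vec v \<noteq> 0"
  obtains v' r where "primitive_vec v'" "0 < r" "real_vec v = r *\<^sub>R real_vec v'"
proof -
  have "gcd (v $ 1) (v $ 2) \<noteq> 0" using assms by (auto simp: vec_eq_iff forall_2 real_vec_def)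
  then obtain a b where ab: "v $ 1 = a * gcd (v $ 1) (v $ 2)" "v $ 2 = b * gcd (v $ 1) (v $ 2)" "coprime a b"
    using gcd_coprime_exists by blast
  have "real_of_int (v $ 1) = of_int (gcd (v $ 1) (v $ 2)) * of_int a"
    "real_of_int (v $ 2) = of_int (gcd (v $ 1) (v $ 2)) * of_int b"
    unfolding of_int_mult[symmetric] of_int_eq_iff using ab by (simp_all add: mult.commute)
  hence "real_vec v = of_int (gcd (v $ 1) (v $ 2)) *\<^sub>R real_vec (vector [a, b])"
    by (simp add: vec_eq_iff forall_2 real_vec_def)
  moreover have "(0 :: real) < of_int (gcd (v $ 1) (v $ 2))"
    using \<open>gcd (v $ 1) (v $ 2) \<noteq> 0\<close> by (simp add: order_less_le)
  moreover have "primitive_vec (vector [a, b] :: int ^ 2)" using ab(3) by (simp add: primitive_vec_2)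
  ultimately show thesis by (intro that)
qed

lemma primitive_parallel:
  fixes v w :: "int ^ 2"
  assumes "primitive_vec v" "primitive_vec w" "icross v w = 0"
  shows "w = v \<or> w = - v"
proof -
  have e: "v $ 1 * w $ 2 = v $ 2 * w $ 1" using assms(3) by (simp add: icross_def)
  have cop: "coprime (v $ 1) (v $ 2)" "coprime (w $ 1) (w $ 2)" using assms by (simp_all add: primitive_vec_2)
  obtain r s where rs: "r * v $ 1 + s * v $ 2 = 1" using cop(1) by (metis bezout_int coprime_iff_gcd_eq_1)
  define k where "k = r * w $ 1 + s * w $ 2"
  have "w $ 1 = (r * v $ 1 + s * v $ 2) * w $ 1" by (simp add: rs)
  also have "\<dots> = k * v $ 1" using e by (simp add: k_def algebra_simps)
  finally have w1: "w $ 1 = k * v $ 1" .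
  have "w $ 2 = (r * v $ 1 + s * v $ 2) * w $ 2" by (simp add: rs)
  also have "\<dots> = k * v $ 2" using e by (simp add: k_def algebra_simps)
  finally have w2: "w $ 2 = k * v $ 2" .
  have "is_unit k" using cop(2) unfolding w1 w2 by (simp add: coprime_def)
  hence "k = 1 \<or> k = - 1" by (simp add: zdvd1_eq abs_if split: if_splits)
  thus ?thesis using w1 w2 by (auto simp: vec_eq_iff forall_2)
qed

lemma convex_cone_hull_scaled:
  assumes "0 < r" "0 < s"
  shows "convex_cone hull {r *\<^sub>R x} = convex_cone hull {x :: 'a :: real_vector}"
    and "convex_cone hull {r *\<^sub>R x, s *\<^sub>R y} = convex_cone hull {x, y :: 'a}"
proof -
  have mem: "r *\<^sub>R y \<in> convex_cone hull S" if "y \<in> S" "0 < r" for r S and y :: 'a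
    using that by (intro convex_cone_hull_mul hull_inc) auto
  have unscale: "x \<in> convex_cone hull S" if "r *\<^sub>R x \<in> S" "0 < r" for r S and x :: 'a
    using mem[OF that(1), of "1 / r"] that(2) by simp
  show "convex_cone hull {r *\<^sub>R x} = convex_cone hull {x}"
    using mem[of x "{x}" r] unscale[of r x "{r *\<^sub>R x}"] assms
    by (intro hull_eq[THEN iffD2] subset_antisym hull_minimal; simp add: convex_cone_convex_cone_hull)
  show "convex_cone hull {r *\<^sub>R x, s *\<^sub>R y} = convex_cone hull {x, y}"
    using mem[of x "{x, y}" r] mem[of y "{x, y}" s] unscale[of r x "{r *\<^sub>R x, s *\<^sub>R y}"] unscale[of s y "{r *\<^sub>R x, s *\<^sub>R y}"] assms
    by (intro subset_antisym hull_minimal; simp add: convex_cone_convex_cone_hull)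
qed

lemma rational_pointed_planar_cone_cases:
  assumes "rational_cone \<sigma>" "pointed_cone (\<sigma> :: (real ^ 2) set)"
  shows "\<sigma> = {0} \<or> (\<exists>v. primitive_vec v \<and> \<sigma> = convex_cone hull {real_vec v}) \<or>
    (\<exists>v w. primitive_vec v \<and> primitive_vec w \<and> 0 < icross v w \<and> \<sigma> = convex_cone hull {real_vec v, real_vec w})"
proof -
  obtain F where F: "finite F" "\<sigma> = convex_cone hull (real_vec ` F)"
    using assms(1) unfolding rational_cone_def by blast
  consider "\<sigma> = {0}" | v where "real_vec v \<noteq> 0" "\<sigma> = convex_cone hull {real_vec v}"
    | v w where "0 < cross (real_vec v) (real_vec w)" "\<sigma> = convex_cone hull {real_vec v, real_vec w}"
    using pointed_planar_cone_cases[of "real_vec ` F"] F assms(2) by blast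
  thus ?thesis
  proof cases
    case (2 v)
    obtain v' r where "primitive_vec v'" "0 < r" "real_vec v = r *\<^sub>R real_vec v'"
      using primitive_multiple[OF 2(1)] .
    thus ?thesis using 2(2) convex_cone_hull_scaled(1)[of r r] by metis
  next
    case (3 v w)
    have "real_vec v \<noteq> 0" "real_vec w \<noteq> 0" using 3(1) by auto
    then obtain v' r w' s where v: "primitive_vec v'" "0 < r" "real_vec v = r *\<^sub>R real_vec v'"
      and w: "primitive_vec w'" "0 < s" "real_vec w = s *\<^sub>R real_vec w'"
      using primitive_multiple by metis
    have "0 < r * (s * cross (real_vec v') (real_vec w'))" using 3(1) unfolding v(3) w(3) by (simp add: mult_ac)
    hence "0 < cross (real_vec v') (real_vec w')" using v(2) w(2) by (simp add: zero_less_mult_iff)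
    hence "0 < icross v' w'" by (simp add: cross_real_vec)
    moreover have "\<sigma> = convex_cone hull {real_vec v', real_vec w'}"
      unfolding 3(2) v(3) w(3) using v(2) w(2) by (rule convex_cone_hull_scaled)
    ultimately show ?thesis using v w by blast
  qed blast
qed

section \<open>Complete fans of Picard number one\<close>

lemma fan_ray_cases:
  fixes \<Sigma> :: "(real ^ 2) set set"
  assumes "fan \<Sigma>" "\<sigma> \<in> \<Sigma>"
  obtains "\<sigma> = {0}" | v where "v \<in> ray_gens \<Sigma>" "\<sigma> = convex_cone hull {real_vec v}"
    | v w where "v \<in> ray_gens \<Sigma>" "w \<in> ray_gens \<Sigma>" "0 < icross v w" "\<sigma> = convex_cone hull {real_vec v, real_vec w}"
proof -
  have face: "\<tau> \<in> \<Sigma>" if "\<tau> face_of \<sigma>" "\<tau> \<noteq> {}" for \<tau>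
    using assms that unfolding fan_def by blast
  have "rational_cone \<sigma>" "pointed_cone \<sigma>" using assms unfolding fan_def by blast+
  from rational_pointed_planar_cone_cases[OF this] consider "\<sigma> = {0}"
    | v where "primitive_vec v" "\<sigma> = convex_cone hull {real_vec v}"
    | v w where "primitive_vec v" "primitive_vec w" "0 < icross v w" "\<sigma> = convex_cone hull {real_vec v, real_vec w}"
    by blast
  thus thesis
  proof cases
    case (2 v)
    thus thesis using that(2)[of v] assms(2) by (simp add: ray_gens_def)
  next
    case (3 v w)
    have "convex_cone hull {real_vec v} face_of \<sigma>" "convex_cone hull {real_vec w} face_of \<sigma>"
      unfolding 3(4) using 3(3) by (auto intro!: ray_face_of_cone simp: cross_real_vec)
    hence "convex_cone hull {real_vec v} \<in> \<Sigma>" "convex_cone hull {real_vec w} \<in> \<Sigma>"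
      using face convex_cone_hull_nonempty by auto
    thus thesis using that(3)[of v w] 3 by (simp add: ray_gens_def)
  qed (use that(1) in blast)
qed

text \<open>Given four rays, two of them independent, suitable multiples of the divisors of the
  other two are Cartier by \<open>q_factorial_fan\<close>. They are independent modulo principal
  divisors: a linear form vanishing on the two independent rays is zero. So the Picard number would
  be at least 2.\<close>

lemma ray_gens_card_le_3:
  assumes qf: "q_factorial_fan \<Sigma>" and pic: "picard_number \<Sigma> = 1"
  shows "finite (ray_gens (\<Sigma> :: (real ^ 2) set set))" "card (ray_gens \<Sigma>) \<le> 3"
proof -
  have no_4: False
    if T: "{v, w, p, q} \<subseteq> ray_gens \<Sigma>" "distinct [v, w, p, q]" and indep: "icross v w \<noteq> 0" for v w p q
  proof -
    obtain k l :: int where k: "0 < k" "cartier_divisor \<Sigma> (\<lambda>x. k * (if x = p then 1 else 0))"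
      and l: "0 < l" "cartier_divisor \<Sigma> (\<lambda>x. l * (if x = q then 1 else 0))"
      using qf unfolding q_factorial_fan_def by meson
    define D where "D i = (if i = 0 then (\<lambda>x. k * (if x = p then 1 else 0)) else (\<lambda>x. l * (if x = q then 1 else 0)))" for i :: nat
    have "\<forall>i<2. cartier_divisor \<Sigma> (D i)" using k l by (simp add: D_def)
    moreover have "\<forall>c. principal_divisor \<Sigma> (\<lambda>x. \<Sum>i<2. c i * D i x) \<longrightarrow> (\<forall>i<2. c i = 0)"
    proof (intro allI impI)
      fix c :: "nat \<Rightarrow> int" and i :: nat assume "principal_divisor \<Sigma> (\<lambda>x. \<Sum>i<2. c i * D i x)" and i: "i < 2"
      then obtain m where m: "\<And>x. x \<in> ray_gens \<Sigma> \<Longrightarrow> c 0 * D 0 x + c 1 * D 1 x = pairing m x"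
        unfolding principal_divisor_def by (auto simp: numeral_2_eq_2)
      have "pairing m v = 0" "pairing m w = 0" using m[of v] m[of w] T by (auto simp: D_def)
      hence 0: "m $ 1 * v $ 1 + m $ 2 * v $ 2 = 0" "m $ 1 * w $ 1 + m $ 2 * w $ 2 = 0"
        by (simp_all add: pairing_def sum_2)
      have "m $ 1 * icross v w = w $ 2 * (m $ 1 * v $ 1 + m $ 2 * v $ 2) - v $ 2 * (m $ 1 * w $ 1 + m $ 2 * w $ 2)"
        "m $ 2 * icross v w = v $ 1 * (m $ 1 * w $ 1 + m $ 2 * w $ 2) - w $ 1 * (m $ 1 * v $ 1 + m $ 2 * v $ 2)"
        by (simp_all add: icross_def algebra_simps)
      hence "m = 0" using indep unfolding 0 by (simp add: vec_eq_iff forall_2)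
      hence "c 0 * k = 0" "c 1 * l = 0" using m[of p] m[of q] T by (auto simp: D_def pairing_def)
      thus "c i = 0" using k l i by (auto simp: numeral_2_eq_2 less_Suc_eq)
    qed
    ultimately have "enat 2 \<le> picard_number \<Sigma>"
      unfolding picard_number_def by (intro Sup_upper) blast
    thus False unfolding pic by (simp add: one_enat_def)
  qed
  have "finite (ray_gens \<Sigma>) \<and> card (ray_gens \<Sigma>) \<le> 3"
  proof (rule ccontr)
    assume "\<not> (finite (ray_gens \<Sigma>) \<and> card (ray_gens \<Sigma>) \<le> 3)"
    then obtain T where T: "T \<subseteq> ray_gens \<Sigma>" "card T = 4"
      by (metis infinite_arbitrarily_large obtain_subset_with_card_n not_less_eq_eq numeral_3_eq_3 numeral_nat(2) Suc_numeral semiring_norm(5) semiring_norm(2) semiring_norm(8))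
    then obtain a b c d where abcd: "T = {a, b, c, d}" "distinct [a, b, c, d]"
      by (auto simp: numeral_eq_Suc card_Suc_eq)
    have prim: "primitive_vec x" if "x \<in> T" for x using T that by (auto simp: ray_gens_def)
    have "icross a b \<noteq> 0 \<or> icross a c \<noteq> 0"
      using primitive_parallel[of a b] primitive_parallel[of a c] prim abcd by auto
    thus False
      using no_4[of a b c d] no_4[of a c b d] T abcd by auto
  qed
  thus "finite (ray_gens \<Sigma>)" "card (ray_gens \<Sigma>) \<le> 3" by auto
qed

definition triangle_fan :: "int ^ 2 \<Rightarrow> int ^ 2 \<Rightarrow> int ^ 2 \<Rightarrow> (real ^ 2) set set" where
  "triangle_fan a b c = {\<tau>. \<tau> \<noteq> {} \<and> (\<tau> face_of convex_cone hull {real_vec a, real_vec b} \<or>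
     \<tau> face_of convex_cone hull {real_vec b, real_vec c} \<or> \<tau> face_of convex_cone hull {real_vec c, real_vec a})}"

text \<open>Completeness yields a positive relation among the ray generators, which forces their
  pairwise cross products to share one sign. The cone of the fan containing a + b must then be
  spanned by a and b, and likewise for the other pairs, so the fan is determined.\<close>

lemma fan_with_three_rays:
  fixes \<Sigma> :: "(real ^ 2) set set"
  assumes fan: "fan \<Sigma>" and complete: "\<Union>\<Sigma> = UNIV"
    and rays: "finite (ray_gens \<Sigma>)" "card (ray_gens \<Sigma>) \<le> 3"
  obtains a b c where "ray_gens \<Sigma> = {a, b, c}" "primitive_vec a" "primitive_vec b" "primitive_vec c"
    "0 < icross a b" "0 < icross b c" "0 < icross c a" "\<Sigma> = triangle_fan a b c"
    "convex_cone hull {real_vec a, real_vec b} \<in> \<Sigma>" "convex_cone hull {real_vec b, real_vec c} \<in> \<Sigma>"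
    "convex_cone hull {real_vec c, real_vec a} \<in> \<Sigma>"
proof -
  note conclusion = that
  let ?R = "ray_gens \<Sigma>"
  have cover: "\<exists>\<sigma>\<in>\<Sigma>. x \<in> \<sigma>" for x using complete by blast
  have "?R \<noteq> {}"
  proof
    assume empty: "?R = {}"
    obtain \<sigma> where \<sigma>: "\<sigma> \<in> \<Sigma>" "(vector [1, 0] :: real ^ 2) \<in> \<sigma>" using cover by blast
    from fan_ray_cases[OF fan \<sigma>(1)] empty have "\<sigma> = {0}" by auto
    thus False using \<sigma>(2) by (simp add: vec_eq_iff forall_2)
  qed
  \<comment> \<open>Repetitions among a, b, c are permitted at this point, in case there are fewer
    than three rays; \<open>t \<noteq> 0\<close> excludes them below.\<close>
  then obtain a b c where R: "?R = {a, b, c}"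
  proof -
    have "card ?R \<noteq> 0" using \<open>?R \<noteq> {}\<close> rays by simp
    hence "card ?R = 1 \<or> card ?R = 2 \<or> card ?R = 3" using rays by linarith
    thus thesis using that by (metis card_1_singletonE card_2_iff card_3_iff insert_absorb2)
  qed
  have prim: "primitive_vec a" "primitive_vec b" "primitive_vec c"
    using R by (auto simp: ray_gens_def)
  have span: "\<exists>\<alpha> \<beta> \<gamma>. 0 \<le> \<alpha> \<and> 0 \<le> \<beta> \<and> 0 \<le> \<gamma> \<and> x = \<alpha> *\<^sub>R real_vec a + \<beta> *\<^sub>R real_vec b + \<gamma> *\<^sub>R real_vec c" for x
  proof -
    let ?S = "{\<alpha> *\<^sub>R real_vec a + \<beta> *\<^sub>R real_vec b + \<gamma> *\<^sub>R real_vec c | \<alpha> \<beta> \<gamma>. 0 \<le> \<alpha> \<and> 0 \<le> \<beta> \<and> 0 \<le> \<gamma>}"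
    have S: "r *\<^sub>R real_vec v + s *\<^sub>R real_vec w \<in> ?S" if "0 \<le> r" "0 \<le> s" "v \<in> ?R" "w \<in> ?R" for r s v w
    proof -
      have ind: "r *\<^sub>R real_vec v = (if v = a then r else 0) *\<^sub>R real_vec a + (if v \<noteq> a \<and> v = b then r else 0) *\<^sub>R real_vec b +
          (if v \<noteq> a \<and> v \<noteq> b then r else 0) *\<^sub>R real_vec c" if "v \<in> ?R" for v r
        using that R by auto
      show ?thesis unfolding mem_Collect_eq ind[OF that(3), of r] ind[OF that(4), of s]
        by (rule exI[of _ "(if v = a then r else 0) + (if w = a then s else 0)"],
            rule exI[of _ "(if v \<noteq> a \<and> v = b then r else 0) + (if w \<noteq> a \<and> w = b then s else 0)"],
            rule exI[of _ "(if v \<noteq> a \<and> v \<noteq> b then r else 0) + (if w \<noteq> a \<and> w \<noteq> b then s else 0)"])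
          (use that in \<open>simp add: scaleR_left_distrib algebra_simps\<close>)
    qed
    obtain \<sigma> where \<sigma>: "\<sigma> \<in> \<Sigma>" "x \<in> \<sigma>" using cover by blast
    have "x \<in> ?S"
    proof (rule fan_ray_cases[OF fan \<sigma>(1)])
      assume "\<sigma> = {0}"
      thus ?thesis using S[of 0 0 a a] \<sigma>(2) R by simp
    next
      fix v assume "v \<in> ?R" "\<sigma> = convex_cone hull {real_vec v}"
      then obtain r where "0 \<le> r" "x = r *\<^sub>R real_vec v" using \<sigma>(2) by (auto simp: convex_cone_hull_singleton)
      thus ?thesis using S[of r 0 v v] \<open>v \<in> ?R\<close> by simp
    next
      fix v w assume vw: "v \<in> ?R" "w \<in> ?R" "\<sigma> = convex_cone hull {real_vec v, real_vec w}"
      then obtain r s where "0 \<le> r" "0 \<le> s" "x = r *\<^sub>R real_vec v + s *\<^sub>R real_vec w"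
        using \<sigma>(2) by (auto simp: convex_cone_hull_pair)
      thus ?thesis using S[of r s v w] vw by simp
    qed
    thus ?thesis by blast
  qed
  define A B C where ABC: "A = real_vec a" "B = real_vec b" "C = real_vec c"
  \<comment> \<open>Expanding the negative of the sum and adding 1 to each coefficient gives a
    relation whose coefficients are strictly positive, not merely nonnegative.\<close>
  obtain \<alpha> \<beta> \<gamma> where coef: "0 \<le> \<alpha>" "0 \<le> \<beta>" "0 \<le> \<gamma>" "- (A + B + C) = \<alpha> *\<^sub>R A + \<beta> *\<^sub>R B + \<gamma> *\<^sub>R C"
    using span[of "- (A + B + C)"] unfolding ABC by blast
  define p q r where pqr: "p = \<alpha> + 1" "q = \<beta> + 1" "r = \<gamma> + 1"
  have pos: "0 < p" "0 < q" "0 < r" using coef by (simp_all add: pqr)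
  have "p *\<^sub>R A + q *\<^sub>R B + r *\<^sub>R C = (\<alpha> *\<^sub>R A + \<beta> *\<^sub>R B + \<gamma> *\<^sub>R C) + (A + B + C)"
    by (simp add: pqr scaleR_left_distrib)
  hence rel: "p *\<^sub>R A + q *\<^sub>R B + r *\<^sub>R C = 0" unfolding coef(4)[symmetric] by simp
  define t where "t = cross A B / r"
  have AB: "cross A B = r * t" using pos by (simp add: t_def)
  have "q * cross A B + r * cross A C = 0" using arg_cong[OF rel, of "cross A"] by simp
  hence "r * cross C A = r * (q * t)" using AB cross_swap[of A C] by (auto simp: algebra_simps)
  hence CA: "cross C A = q * t" using pos by simp
  have "p * cross B A + r * cross B C = 0" using arg_cong[OF rel, of "cross B"] by simp
  moreover have "cross B A = - (r * t)" using AB cross_swap[of A B] by simp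
  ultimately have "r * cross B C = r * (p * t)" by (simp add: algebra_simps)
  hence BC: "cross B C = p * t" using pos by simp
  have "t \<noteq> 0"
  proof
    assume "t = 0"
    \<comment> \<open>If t = 0, all rays lie on the line of A, so the vector A rotated by a right
      angle cannot be in their span.\<close>
    define x :: "real ^ 2" where "x = vector [- A $ 2, A $ 1]"
    obtain \<alpha> \<beta> \<gamma> where "x = \<alpha> *\<^sub>R A + \<beta> *\<^sub>R B + \<gamma> *\<^sub>R C" using span[of x] unfolding ABC by blast
    hence "cross A x = 0" using AB CA cross_swap[of A C] \<open>t = 0\<close> by simp
    hence "(A $ 1)\<^sup>2 + (A $ 2)\<^sup>2 = 0" by (simp add: cross_def x_def power2_eq_square)
    thus False using primitive_vec_nonzero[OF prim(1)] unfolding ABC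
      by (simp add: vec_eq_iff forall_2 sum_power2_eq_zero_iff)
  qed
  have main: thesis if R: "?R = {a, b, c}" and prim: "primitive_vec a" "primitive_vec b" "primitive_vec c"
    and or: "0 < icross a b" "0 < icross b c" "0 < icross c a" for a b c
  proof -
    have cone: "convex_cone hull {real_vec a, real_vec b} \<in> \<Sigma>"
      if R: "?R = {a, b, c}" and or: "0 < icross a b" "0 < icross b c" "0 < icross c a" for a b c
    proof -
      have orr: "0 < cross (real_vec a) (real_vec b)" "0 < cross (real_vec b) (real_vec c)" "0 < cross (real_vec c) (real_vec a)"
        using or by (simp_all add: cross_real_vec)
      \<comment> \<open>An interior point of the expected cone. A cone of the fan that contains it
        and is spanned by other rays violates a sign condition.\<close>
      define x where "x = real_vec a + real_vec b"
      have ax: "0 < cross (real_vec a) x" and xb: "0 < cross x (real_vec b)" using orr by (simp_all add: x_def)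
      obtain \<sigma> where \<sigma>: "\<sigma> \<in> \<Sigma>" "x \<in> \<sigma>" using cover by blast
      have "\<sigma> = convex_cone hull {real_vec a, real_vec b}"
      proof (rule fan_ray_cases[OF fan \<sigma>(1)])
        assume "\<sigma> = {0}" thus ?thesis using \<sigma>(2) ax by simp
      next
        fix v assume v: "v \<in> ?R" "\<sigma> = convex_cone hull {real_vec v}"
        then obtain l where l: "0 \<le> l" "x = l *\<^sub>R real_vec v" using \<sigma>(2) by (auto simp: convex_cone_hull_singleton)
        have "v = a \<or> v = b \<or> v = c" using v R by auto
        moreover have "v \<noteq> a" "v \<noteq> b" using l ax xb by auto
        moreover have "v \<noteq> c"
        proof
          assume "v = c"
          hence "cross (real_vec a) x = - (l * cross (real_vec c) (real_vec a))"
            using l cross_swap[of "real_vec c" "real_vec a"] by simp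
          thus False using ax l(1) orr(3) by (simp add: mult_less_0_iff)
        qed
        ultimately show ?thesis by blast
      next
        fix v w assume vw: "v \<in> ?R" "w \<in> ?R" "0 < icross v w" "\<sigma> = convex_cone hull {real_vec v, real_vec w}"
        have mem: "0 \<le> cross (real_vec v) x" "0 \<le> cross x (real_vec w)"
          using mem_convex_cone_hull_pair[of "real_vec v" "real_vec w" x] vw(3,4) \<sigma>(2) by (simp_all add: cross_real_vec)
        have "v = a \<or> v = b \<or> v = c" "w = a \<or> w = b \<or> w = c" using vw R by auto
        moreover have "v \<noteq> b" using mem(1) xb cross_swap[of x "real_vec b"] by auto
        moreover have "w \<noteq> a" using mem(2) ax cross_swap[of x "real_vec a"] by auto
        moreover have "v \<noteq> w" using vw(3) by auto
        moreover have "\<not> (v = c \<and> w = b)" "\<not> (v = a \<and> w = c)"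
          using vw(3) or icross_swap[of b c] icross_swap[of a c] by auto
        ultimately have "v = a \<and> w = b" by blast
        thus ?thesis using vw(4) by simp
      qed
      thus ?thesis using \<sigma>(1) by simp
    qed
    have cones: "convex_cone hull {real_vec a, real_vec b} \<in> \<Sigma>" "convex_cone hull {real_vec b, real_vec c} \<in> \<Sigma>"
      "convex_cone hull {real_vec c, real_vec a} \<in> \<Sigma>"
      using cone[of a b c] cone[of b c a] cone[of c a b] R or by (simp_all add: insert_commute)
    have "\<Sigma> = triangle_fan a b c"
    proof (intro subset_antisym subsetI)
      fix \<tau> assume "\<tau> \<in> triangle_fan a b c"
      thus "\<tau> \<in> \<Sigma>" using cones fan unfolding triangle_fan_def fan_def by blast
    next
      fix \<sigma> assume \<sigma>: "\<sigma> \<in> \<Sigma>"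
      have orr: "0 < cross (real_vec a) (real_vec b)" "0 < cross (real_vec b) (real_vec c)" "0 < cross (real_vec c) (real_vec a)"
        using or by (simp_all add: cross_real_vec)
      note faces = ray_face_of_cone[OF orr(1)] ray_face_of_cone[OF orr(2)] ray_face_of_cone[OF orr(3)]
      have refl: "convex_cone hull {v, w} face_of convex_cone hull {v, w}" for v w :: "real ^ 2"
        by (rule face_of_refl) (rule convex_convex_cone_hull)
      show "\<sigma> \<in> triangle_fan a b c"
      proof (rule fan_ray_cases[OF fan \<sigma>])
        assume "\<sigma> = {0}"
        thus ?thesis
          using face_of_trans[OF zero_face_of_ray faces(1)] by (simp add: triangle_fan_def)
      next
        fix v assume "v \<in> ?R" "\<sigma> = convex_cone hull {real_vec v}"
        thus ?thesis using R faces by (auto simp: triangle_fan_def convex_cone_hull_nonempty)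
      next
        fix v w assume vw: "v \<in> ?R" "w \<in> ?R" "0 < icross v w" "\<sigma> = convex_cone hull {real_vec v, real_vec w}"
        have "v = a \<or> v = b \<or> v = c" "w = a \<or> w = b \<or> w = c" using vw R by auto
        hence "v = a \<and> w = b \<or> v = b \<and> w = c \<or> v = c \<and> w = a"
          using vw(3) or icross_swap[of a b] icross_swap[of b c] icross_swap[of c a] by auto
        thus ?thesis unfolding vw(4) triangle_fan_def
          using refl convex_cone_hull_nonempty by auto
      qed
    qed
    thus thesis using cones by (rule conclusion[OF R prim or])
  qed
  show thesis
  proof (cases "0 < t")
    case True
    hence "0 < cross A B" "0 < cross B C" "0 < cross C A" unfolding AB BC CA using pos by simp_all
    thus thesis using main[of a b c] R prim unfolding ABC cross_real_vec by simp
  next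
    case False
    hence "t < 0" using \<open>t \<noteq> 0\<close> by simp
    hence "cross A B < 0" "cross B C < 0" "cross C A < 0" unfolding AB BC CA using pos by (simp_all add: mult_less_0_iff)
    hence "icross a b < 0" "icross b c < 0" "icross c a < 0" unfolding ABC cross_real_vec by simp_all
    thus thesis using main[of a c b] R prim icross_swap[of a b] icross_swap[of b c] icross_swap[of c a]
      by (simp add: insert_commute)
  qed
qed

section \<open>The degree of a complete fan with three rays\<close>

text \<open>The cones fix the off-diagonal numbers 1/x, 1/y, 1/z. Because x a + y b + z c = 0,
  numerical triviality of principal divisors allows the self-intersections x/(yz), y/(zx), z/(xy)
  and no others. The sum over all pairs is (x + y + z)^2 / (xyz).\<close>

lemma canonical_degree_triangle:
  fixes \<Sigma> :: "(real ^ 2) set set"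
  assumes R: "ray_gens \<Sigma> = {a, b, c}"
    and or: "0 < icross a b" "0 < icross b c" "0 < icross c a"
    and cones: "convex_cone hull {real_vec a, real_vec b} \<in> \<Sigma>" "convex_cone hull {real_vec b, real_vec c} \<in> \<Sigma>"
    "convex_cone hull {real_vec c, real_vec a} \<in> \<Sigma>"
  shows "canonical_degree \<Sigma> = of_int ((icross b c + icross c a + icross a b)\<^sup>2) /
    of_int (icross b c * icross c a * icross a b)"
proof -
  define x y z :: rat where xyz: "x = of_int (icross b c)" "y = of_int (icross c a)" "z = of_int (icross a b)"
  have pos: "0 < x" "0 < y" "0 < z" using or by (simp_all add: xyz)
  have ne: "a \<noteq> b" "b \<noteq> c" "c \<noteq> a" using or by auto
  have det: "det (vector [v, w] :: int ^ 2 ^ 2) = icross v w" for v w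
    by (simp add: det_2 icross_def)
  have sum: "(\<Sum>w\<in>ray_gens \<Sigma>. f w) = f a + f b + f c" for f :: "int ^ 2 \<Rightarrow> rat"
    using ne by (simp add: R add.assoc)
  have off: "(if convex_cone hull {real_vec v, real_vec w} \<in> \<Sigma>
      then 1 / of_int \<bar>det (vector [v, w] :: int ^ 2 ^ 2)\<bar> else 0 :: rat) =
      (if {v, w} = {a, b} then 1 / z else if {v, w} = {b, c} then 1 / x else 1 / y)"
    if "v \<in> {a, b, c}" "w \<in> {a, b, c}" "v \<noteq> w" for v w
    using that cones or ne icross_swap[of a b] icross_swap[of b c] icross_swap[of c a]
    by (auto simp: det xyz doubleton_eq_iff insert_commute)
  have rel: "x * of_int (pairing m a) + y * of_int (pairing m b) + z * of_int (pairing m c) = 0" for m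
  proof -
    have "icross b c * pairing m a + icross c a * pairing m b + icross a b * pairing m c = 0"
      by (simp add: icross_def pairing_def sum_2 algebra_simps)
    thus ?thesis unfolding xyz of_int_mult[symmetric] of_int_add[symmetric] by (simp only: of_int_0)
  qed
  define B where "B v w = (if v = w then (if v = a then x / (y * z) else if v = b then y / (z * x) else z / (x * y))
      else if {v, w} = {a, b} then 1 / z else if {v, w} = {b, c} then 1 / x else 1 / y)" for v w
  have Bvals: "B a a = x / (y * z)" "B b b = y / (z * x)" "B c c = z / (x * y)"
    "B a b = 1 / z" "B b a = 1 / z" "B b c = 1 / x" "B c b = 1 / x" "B c a = 1 / y" "B a c = 1 / y"
    using ne by (auto simp: B_def doubleton_eq_iff)
  have B: "intersection_numbers \<Sigma> B"
    unfolding intersection_numbers_def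
  proof (intro conjI ballI impI allI)
    fix v w assume "v \<in> ray_gens \<Sigma>" "w \<in> ray_gens \<Sigma>" "v \<noteq> w"
    thus "B v w = (if convex_cone hull {real_vec v, real_vec w} \<in> \<Sigma>
        then 1 / of_int \<bar>det (vector [v, w] :: int ^ 2 ^ 2)\<bar> else 0)"
      using off[of v w] unfolding R by (simp add: B_def)
  next
    fix m v assume "v \<in> ray_gens \<Sigma>"
    hence "v = a \<or> v = b \<or> v = c" by (simp add: R)
    thus "(\<Sum>w\<in>ray_gens \<Sigma>. of_int (pairing m w) * B v w) = 0"
      unfolding sum using rel[of m] pos
      by (elim disjE) (simp_all add: Bvals field_simps)
  qed
  have unique: "B' v w = B v w" if B': "intersection_numbers \<Sigma> B'" and vw: "v \<in> {a, b, c}" "w \<in> {a, b, c}" for B' v w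
  proof -
    have offd: "B' v w = B v w" if "v \<in> {a, b, c}" "w \<in> {a, b, c}" "v \<noteq> w" for v w
    proof -
      have "B'' v w = (if convex_cone hull {real_vec v, real_vec w} \<in> \<Sigma>
          then 1 / of_int \<bar>det (vector [v, w] :: int ^ 2 ^ 2)\<bar> else 0)" if "intersection_numbers \<Sigma> B''" for B''
        using that \<open>v \<in> {a, b, c}\<close> \<open>w \<in> {a, b, c}\<close> \<open>v \<noteq> w\<close> unfolding intersection_numbers_def R[symmetric] by blast
      from this[OF B] this[OF B'] show ?thesis by simp
    qed
    have diag: "B' v v = B v v" if "v \<in> {a, b, c}" for v
    proof -
      \<comment> \<open>One character that does not vanish on v determines the self-intersection
        from the mixed numbers; v itself, read as a character, is such a one.\<close>
      have "v \<noteq> 0" using that or by (auto simp: icross_def)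
      hence "pairing v v \<noteq> 0"
        using sum_squares_eq_zero_iff[of "v $ 1" "v $ 2"] by (simp add: pairing_def sum_2 vec_eq_iff forall_2)
      then obtain m where m: "pairing m v \<noteq> 0" ..
      have "(\<Sum>w\<in>ray_gens \<Sigma>. of_int (pairing m w) * B v w) = 0" "(\<Sum>w\<in>ray_gens \<Sigma>. of_int (pairing m w) * B' v w) = 0"
        using that unfolding R[symmetric]
        by (rule B[unfolded intersection_numbers_def, THEN conjunct2, rule_format]
            B'[unfolded intersection_numbers_def, THEN conjunct2, rule_format])+
      hence "(\<Sum>w\<in>{a, b, c}. of_int (pairing m w) * (B v w - B' v w)) = 0"
        unfolding R by (simp add: sum_subtractf right_diff_distrib)
      moreover have "(\<Sum>w\<in>{a, b, c}. of_int (pairing m w) * (B v w - B' v w)) = of_int (pairing m v) * (B v v - B' v v)"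
      proof -
        have "(\<Sum>w\<in>{a, b, c} - {v}. of_int (pairing m w) * (B v w - B' v w)) = 0"
          using that offd by (intro sum.neutral) auto
        thus ?thesis using that sum.remove[of "{a, b, c}" v "\<lambda>w. of_int (pairing m w) * (B v w - B' v w)"] by simp
      qed
      ultimately show ?thesis using m by simp
    qed
    show ?thesis using offd diag vw by metis
  qed
  have total: "(\<Sum>v\<in>ray_gens \<Sigma>. \<Sum>w\<in>ray_gens \<Sigma>. (-1) * (-1) * B v w) = (x + y + z)\<^sup>2 / (x * y * z)"
    unfolding sum using pos by (simp add: Bvals power2_eq_square field_simps)
  have "canonical_degree \<Sigma> = (x + y + z)\<^sup>2 / (x * y * z)"
    unfolding canonical_degree_def
  proof (rule the_equality)
    show "\<exists>B. intersection_numbers \<Sigma> B \<and> (x + y + z)\<^sup>2 / (x * y * z) = (\<Sum>v\<in>ray_gens \<Sigma>. \<Sum>w\<in>ray_gens \<Sigma>. (-1) * (-1) * B v w)"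
      using B total by metis
  next
    fix d assume "\<exists>B. intersection_numbers \<Sigma> B \<and> d = (\<Sum>v\<in>ray_gens \<Sigma>. \<Sum>w\<in>ray_gens \<Sigma>. (-1) * (-1) * B v w)"
    then obtain B' where B': "intersection_numbers \<Sigma> B'" and d: "d = (\<Sum>v\<in>ray_gens \<Sigma>. \<Sum>w\<in>ray_gens \<Sigma>. (-1) * (-1) * B' v w)"
      by blast
    have "d = (\<Sum>v\<in>ray_gens \<Sigma>. \<Sum>w\<in>ray_gens \<Sigma>. (-1) * (-1) * B v w)"
      unfolding d R using unique[OF B'] by (intro sum.cong refl) simp
    thus "d = (x + y + z)\<^sup>2 / (x * y * z)" using total by simp
  qed
  thus ?thesis by (simp add: xyz)
qed


section \<open>Unimodular maps of toric varieties\<close>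

text \<open>
  A unimodular matrix \<open>A\<close> carries a chart point \<open>(\<sigma>, \<gamma>)\<close> to \<open>(A \<sigma>, \<gamma> \<circ> A\<^sup>T)\<close>. Since \<open>\<gamma>\<close> is extensional on the
  cone monoid of \<open>\<sigma>\<close>, composing with \<open>A\<^sup>T\<close> needs no further restriction.
\<close>

definition real_matrix :: "int ^ 'n ^ 'm \<Rightarrow> real ^ 'n ^ 'm" where
  "real_matrix A = (\<chi> i j. real_of_int (A $ i $ j))"

lemma real_vec_mult: "real_vec (A *v v) = real_matrix A *v real_vec v"
  by (simp add: real_vec_def real_matrix_def matrix_vector_mult_def vec_eq_iff)

lemma real_matrix_mult: "real_matrix (A ** B) = real_matrix A ** real_matrix B"
  by (simp add: real_matrix_def matrix_matrix_mult_def vec_eq_iff)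

lemma real_matrix_one: "real_matrix (mat 1) = mat 1"
  by (simp add: real_matrix_def mat_def vec_eq_iff)

text \<open>The inverse is carried along as a second parameter, so each one-sided transport
  statement yields its converse by exchanging A and B.\<close>

locale unimodular_pair =
  fixes A B :: "int ^ 'n ^ 'n"
  assumes AB: "A ** B = mat 1" and BA: "B ** A = mat 1"
begin

definition cone_map :: "(real ^ 'n) set \<Rightarrow> (real ^ 'n) set" where
  "cone_map \<sigma> = (*v) (real_matrix A) ` \<sigma>"

definition point_map :: "(int ^ 'n \<Rightarrow> 'k) \<Rightarrow> int ^ 'n \<Rightarrow> 'k" where
  "point_map \<gamma> = (\<lambda>m. \<gamma> (transpose A *v m))"

definition chart_map :: "(real ^ 'n) set \<times> (int ^ 'n \<Rightarrow> 'k) \<Rightarrow> (real ^ 'n) set \<times> (int ^ 'n \<Rightarrow> 'k)" where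
  "chart_map = map_prod cone_map point_map"

end

lemma unimodular_pair_sym: "unimodular_pair A B \<Longrightarrow> unimodular_pair B A"
  by (simp add: unimodular_pair_def)

context unimodular_pair
begin

interpretation inv: unimodular_pair B A
  using unimodular_pair_axioms by (rule unimodular_pair_sym)

lemmas inverse = unimodular_pair_sym[OF unimodular_pair_axioms]

lemma cone_map_inverse: "inv.cone_map (cone_map \<sigma>) = \<sigma>" "cone_map (inv.cone_map \<sigma>) = \<sigma>"
  by (simp_all add: cone_map_def inv.cone_map_def image_image matrix_vector_mul_assoc
      AB BA real_matrix_one flip: real_matrix_mult)

lemma transpose_inverse: "transpose A *v (transpose B *v m) = m" "transpose B *v (transpose A *v m) = m"
  by (simp_all only: matrix_vector_mul_assoc matrix_transpose_mul[symmetric] AB BA transpose_mat matrix_vector_mul_lid)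

lemma point_map_inverse: "inv.point_map (point_map \<gamma>) = \<gamma>" "point_map (inv.point_map \<gamma>) = \<gamma>"
  by (simp_all add: point_map_def inv.point_map_def transpose_inverse del: transpose_matrix_vector)

lemma chart_map_inverse: "inv.chart_map (chart_map p) = p" "chart_map (inv.chart_map p) = p"
  by (cases p; simp add: chart_map_def inv.chart_map_def cone_map_inverse point_map_inverse)+

lemma cone_monoid_cone_map: "m \<in> cone_monoid (cone_map \<sigma>) \<longleftrightarrow> transpose A *v m \<in> cone_monoid \<sigma>"
proof -
  have "real_vec m \<bullet> (real_matrix A *v x) = real_vec (transpose A *v m) \<bullet> x" for x
  proof -
    have "real_vec (transpose A *v m) = transpose (real_matrix A) *v real_vec m"
      unfolding real_vec_mult by (simp add: real_matrix_def transpose_def vec_eq_iff matrix_vector_mult_def vector_matrix_mult_def)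
    thus ?thesis by (simp add: dot_lmul_matrix)
  qed
  thus ?thesis by (simp add: cone_monoid_def cone_map_def)
qed

lemma point_map_affine_toric_points:
  assumes "\<gamma> \<in> affine_toric_points \<sigma>"
  shows "point_map \<gamma> \<in> affine_toric_points (cone_map \<sigma>)"
  using assms unfolding affine_toric_points_def
  by (auto simp: point_map_def cone_monoid_cone_map PiE_iff extensional_def matrix_vector_right_distrib
      simp del: transpose_matrix_vector)

lemma affine_toric_points_cone_map:
  "affine_toric_points (cone_map \<sigma>) = point_map ` affine_toric_points \<sigma>"
proof (intro subset_antisym subsetI)
  fix \<gamma> assume "\<gamma> \<in> affine_toric_points (cone_map \<sigma>)"
  hence "inv.point_map \<gamma> \<in> affine_toric_points \<sigma>"
    using unimodular_pair.point_map_affine_toric_points[OF inverse] by (metis cone_map_inverse(1))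
  thus "\<gamma> \<in> point_map ` affine_toric_points \<sigma>" by (metis image_eqI point_map_inverse(2))
qed (auto simp: point_map_affine_toric_points)

text \<open>The transpose of A is injective on exponents, so the finite sum of monomials can be
  reindexed, with coefficients looked up through the transpose of B.\<close>

lemma affine_toric_functions_pullback:
  assumes "f \<in> affine_toric_functions (cone_map \<sigma>)"
  shows "f \<circ> point_map \<in> affine_toric_functions \<sigma>"
proof -
  from assms obtain F c where F: "finite F" "F \<subseteq> cone_monoid (cone_map \<sigma>)" and f: "f = (\<lambda>\<gamma>. \<Sum>m\<in>F. c m * \<gamma> m)"
    by (auto simp: affine_toric_functions_def)
  have inj: "inj_on (\<lambda>m. transpose A *v m) F" by (rule inj_on_inverseI) (rule transpose_inverse(2))
  have "f \<circ> point_map = (\<lambda>\<gamma>. \<Sum>m\<in>(\<lambda>m. transpose A *v m) ` F. c (transpose B *v m) * \<gamma> m)"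
    by (simp add: f fun_eq_iff point_map_def sum.reindex[OF inj] transpose_inverse del: transpose_matrix_vector)
  moreover have "(\<lambda>m. transpose A *v m) ` F \<subseteq> cone_monoid \<sigma>" using F(2) cone_monoid_cone_map by blast
  ultimately show ?thesis using F(1) unfolding affine_toric_functions_def mem_Collect_eq
    by (intro exI[of _ "(\<lambda>m. transpose A *v m) ` F"] exI[of _ "\<lambda>m. c (transpose B *v m)"] conjI finite_imageI)
qed

lemma affine_toric_functions_pushforward:
  assumes "f \<in> affine_toric_functions \<sigma>"
  shows "f \<circ> inv.point_map \<in> affine_toric_functions (cone_map \<sigma>)"
  using unimodular_pair.affine_toric_functions_pullback[OF inverse, of f "cone_map \<sigma>"] assms by (simp add: cone_map_inverse)

lemma restrict_point_map:
  "point_map (restrict \<delta> (cone_monoid \<sigma>)) = restrict (point_map \<delta>) (cone_monoid (cone_map \<sigma>))"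
  by (auto simp: point_map_def restrict_def fun_eq_iff cone_monoid_cone_map simp del: transpose_matrix_vector)

lemma cone_map_Int: "cone_map (\<sigma> \<inter> \<tau>) = cone_map \<sigma> \<inter> cone_map \<tau>"
  using cone_map_inverse by (auto simp: cone_map_def inv.cone_map_def) (metis image_eqI imageE IntI matrix_vector_mul_assoc AB BA real_matrix_one real_matrix_mult matrix_vector_mul_lid)

lemma toric_glue_chart_map:
  assumes "(p, q) \<in> toric_glue \<Sigma>"
  shows "(chart_map p, chart_map q) \<in> toric_glue (cone_map ` \<Sigma>)"
proof -
  obtain \<sigma> \<tau> \<delta> where \<sigma>: "\<sigma> \<in> \<Sigma>" "\<tau> \<in> \<Sigma>" and \<delta>: "\<delta> \<in> affine_toric_points (\<sigma> \<inter> \<tau>)"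
    and pq: "p = (\<sigma>, restrict \<delta> (cone_monoid \<sigma>))" "q = (\<tau>, restrict \<delta> (cone_monoid \<tau>))"
    using assms unfolding toric_glue_def by auto
  have "point_map \<delta> \<in> affine_toric_points (cone_map \<sigma> \<inter> cone_map \<tau>)"
    using point_map_affine_toric_points[OF \<delta>] by (simp add: cone_map_Int)
  thus ?thesis
    using \<sigma> unfolding toric_glue_def pq chart_map_def by (auto simp: restrict_point_map)
qed

lemma toric_glue_chart_map_iff:
  "(chart_map p, chart_map q) \<in> toric_glue (cone_map ` \<Sigma>) \<longleftrightarrow> (p, q) \<in> toric_glue \<Sigma>"
proof
  assume "(chart_map p, chart_map q) \<in> toric_glue (cone_map ` \<Sigma>)"
  from unimodular_pair.toric_glue_chart_map[OF inverse this] show "(p, q) \<in> toric_glue \<Sigma>"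
    by (simp add: chart_map_inverse image_image cone_map_inverse)
qed (rule toric_glue_chart_map)

lemma toric_chart_cone_map:
  "toric_chart (cone_map ` \<Sigma>) (cone_map \<sigma>) (point_map \<gamma>) = chart_map ` toric_chart \<Sigma> \<sigma> \<gamma>"
proof -
  let ?p = "(\<sigma>, \<gamma>)"
  have "toric_glue (cone_map ` \<Sigma>) `` {chart_map ?p} = chart_map ` (toric_glue \<Sigma> `` {?p})"
  proof (intro Set.set_eqI iffI)
    fix q assume "q \<in> toric_glue (cone_map ` \<Sigma>) `` {chart_map ?p}"
    hence "(chart_map ?p, chart_map (inv.chart_map q)) \<in> toric_glue (cone_map ` \<Sigma>)"
      by (simp add: chart_map_inverse)
    hence "inv.chart_map q \<in> toric_glue \<Sigma> `` {?p}" unfolding toric_glue_chart_map_iff by simp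
    thus "q \<in> chart_map ` (toric_glue \<Sigma> `` {?p})"
      by (intro image_eqI[of _ _ "inv.chart_map q"]) (simp_all add: chart_map_inverse)
  next
    fix q assume "q \<in> chart_map ` (toric_glue \<Sigma> `` {?p})"
    then obtain r where "q = chart_map r" "(?p, r) \<in> toric_glue \<Sigma>" by blast
    thus "q \<in> toric_glue (cone_map ` \<Sigma>) `` {chart_map ?p}" using toric_glue_chart_map by blast
  qed
  thus ?thesis unfolding toric_chart_def by (simp add: chart_map_def)
qed

abbreviation variety_map :: "((real ^ 'n) set \<times> (int ^ 'n \<Rightarrow> 'k)) set \<Rightarrow> ((real ^ 'n) set \<times> (int ^ 'n \<Rightarrow> 'k)) set" where
  "variety_map p \<equiv> chart_map ` p"

lemma variety_map_inverse: "inv.chart_map ` chart_map ` p = p" "chart_map ` inv.chart_map ` p = p"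
  by (simp_all add: image_image chart_map_inverse)

lemma image_variety_map_inverse: "(`) inv.chart_map ` variety_map ` U = U" "variety_map ` (`) inv.chart_map ` U = U"
  by (simp_all only: image_image chart_map_inverse image_ident)

lemma image_cone_map_inverse: "inv.cone_map ` cone_map ` \<Sigma> = \<Sigma>"
  by (simp only: image_image cone_map_inverse image_ident)

lemma comp_variety_map_inverse: "(`) inv.chart_map \<circ> variety_map = id" "variety_map \<circ> (`) inv.chart_map = id"
  by (simp_all only: fun_eq_iff comp_apply variety_map_inverse id_apply simp_thms)

lemma inj_variety_map: "inj variety_map"
  by (rule inj_on_inverseI[where g = "(`) inv.chart_map"]) (rule variety_map_inverse)

text \<open>The basic open set of f in the chart of a cone goes to the basic open set of f composed
  with the inverse point map. Injectivity of the map carries this through intersections in the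
  generated topology.\<close>

lemma openin_toric_topology_image:
  assumes "openin (toric_topology \<Sigma>) U"
  shows "openin (toric_topology (cone_map ` \<Sigma>)) (variety_map ` (U :: ('n, 'k :: field) toric_point set))"
  using assms unfolding toric_topology_def openin_topology_generated_by_iff
proof (induction rule: generate_topology_on.induct)
  case Empty
  show ?case by (simp add: generate_topology_on.Empty)
next
  case (Int a b)
  thus ?case by (simp add: image_Int[OF inj_variety_map] generate_topology_on.Int)
next
  case (UN K)
  have "generate_topology_on S (\<Union> ((\<lambda>k. variety_map ` k) ` K))"
    if "\<And>k. k \<in> K \<Longrightarrow> generate_topology_on S (variety_map ` k)" for S :: "('n, 'k) toric_point set set"
    using that by (intro generate_topology_on.UN) auto
  thus ?case using UN by (simp add: image_Union)
next
  case (Basis s)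
  then obtain \<sigma> f where \<sigma>: "\<sigma> \<in> \<Sigma>" and f: "f \<in> affine_toric_functions \<sigma>"
    and s: "s = toric_chart \<Sigma> \<sigma> ` {\<gamma> \<in> affine_toric_points \<sigma>. f \<gamma> \<noteq> 0}" by blast
  have "variety_map ` s = toric_chart (cone_map ` \<Sigma>) (cone_map \<sigma>) `
      {\<gamma> \<in> affine_toric_points (cone_map \<sigma>). (f \<circ> inv.point_map) \<gamma> \<noteq> 0}"
    unfolding s affine_toric_points_cone_map
    by (auto simp: image_image toric_chart_cone_map[symmetric] point_map_inverse)
  thus ?case using \<sigma> affine_toric_functions_pushforward[OF f]
    by (intro generate_topology_on.Basis) blast
qed

lemma openin_toric_topology_image_iff:
  "openin (toric_topology (cone_map ` \<Sigma>)) (variety_map ` (U :: ('n, 'k :: field) toric_point set)) \<longleftrightarrow>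
     openin (toric_topology \<Sigma>) U"
proof
  assume "openin (toric_topology (cone_map ` \<Sigma>)) (variety_map ` U)"
  hence "openin (toric_topology (inv.cone_map ` cone_map ` \<Sigma>)) ((`) inv.chart_map ` variety_map ` U)"
    by (rule unimodular_pair.openin_toric_topology_image[OF inverse, where \<Sigma> = "cone_map ` \<Sigma>" and U = "variety_map ` U"])
  thus "openin (toric_topology \<Sigma>) U"
    by (simp only: image_variety_map_inverse image_cone_map_inverse)
qed (rule openin_toric_topology_image)

text \<open>A local fraction f / g on a neighbourhood V in the chart of
  \<open>cone_map \<sigma>\<close> becomes, on the preimage W of V, the fraction of the pulled back
  functions in the chart of \<sigma>.\<close>

lemma toric_regular_pullback:
  assumes "\<phi> \<in> toric_regular (cone_map ` \<Sigma>) (variety_map ` (U :: ('n, 'k :: field) toric_point set))"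
  shows "\<phi> \<circ> variety_map \<in> toric_regular \<Sigma> U"
  unfolding toric_regular_def mem_Collect_eq
proof
  fix p assume "p \<in> U"
  hence "variety_map p \<in> variety_map ` U" by (rule imageI)
  from assms[unfolded toric_regular_def mem_Collect_eq, rule_format, OF this]
  obtain \<sigma>' V f g where \<sigma>': "\<sigma>' \<in> cone_map ` \<Sigma>" and f': "f \<in> affine_toric_functions \<sigma>'"
    and g': "g \<in> affine_toric_functions \<sigma>'"
    and V': "openin (toric_topology (cone_map ` \<Sigma>)) V" "variety_map p \<in> V" "V \<subseteq> variety_map ` U"
      "V \<subseteq> toric_chart (cone_map ` \<Sigma>) \<sigma>' ` affine_toric_points \<sigma>'"
    and val': "\<forall>\<gamma>\<in>affine_toric_points \<sigma>'. toric_chart (cone_map ` \<Sigma>) \<sigma>' \<gamma> \<in> V \<longrightarrow>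
      g \<gamma> \<noteq> 0 \<and> \<phi> (toric_chart (cone_map ` \<Sigma>) \<sigma>' \<gamma>) = f \<gamma> / g \<gamma>"
    by (elim bexE exE conjE) (rule that; assumption)
  from \<sigma>' obtain \<sigma> where \<sigma>: "\<sigma> \<in> \<Sigma>" and eq: "\<sigma>' = cone_map \<sigma>" by (rule imageE)
  note f = f'[unfolded eq] and g = g'[unfolded eq] and V = V'[unfolded eq] and val = val'[unfolded eq, rule_format]
  define W where "W = {p. variety_map p \<in> V}"
  have VW: "V = variety_map ` W"
  proof (intro subset_antisym subsetI)
    fix q assume "q \<in> V"
    hence "inv.chart_map ` q \<in> W" by (simp only: W_def mem_Collect_eq variety_map_inverse)
    thus "q \<in> variety_map ` W" by (rule image_eqI[rotated]) (simp only: variety_map_inverse)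
  qed (auto simp: W_def)
  have "openin (toric_topology \<Sigma>) W"
    using V(1) unfolding VW openin_toric_topology_image_iff .
  moreover have "p \<in> W" using V(2) by (simp add: W_def)
  moreover have "W \<subseteq> U" using V(3) unfolding VW by (simp add: inj_image_subset_iff[OF inj_variety_map])
  moreover have "W \<subseteq> toric_chart \<Sigma> \<sigma> ` affine_toric_points \<sigma>"
  proof
    fix q assume "q \<in> W"
    hence "variety_map q \<in> toric_chart (cone_map ` \<Sigma>) (cone_map \<sigma>) ` point_map ` affine_toric_points \<sigma>"
      using V(4) unfolding affine_toric_points_cone_map W_def by blast
    then obtain \<gamma> where \<gamma>: "\<gamma> \<in> affine_toric_points \<sigma>" "variety_map q = variety_map (toric_chart \<Sigma> \<sigma> \<gamma>)"
      unfolding image_image toric_chart_cone_map by (rule imageE)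
    from \<gamma>(2) have "q = toric_chart \<Sigma> \<sigma> \<gamma>" by (rule injD[OF inj_variety_map])
    thus "q \<in> toric_chart \<Sigma> \<sigma> ` affine_toric_points \<sigma>" using \<gamma>(1) by (rule image_eqI)
  qed
  moreover have "(g \<circ> point_map) \<gamma> \<noteq> 0" "(\<phi> \<circ> variety_map) (toric_chart \<Sigma> \<sigma> \<gamma>) = (f \<circ> point_map) \<gamma> / (g \<circ> point_map) \<gamma>"
    if "\<gamma> \<in> affine_toric_points \<sigma>" "toric_chart \<Sigma> \<sigma> \<gamma> \<in> W" for \<gamma>
    using val[OF point_map_affine_toric_points[OF that(1)]] that(2)
    by (simp_all add: toric_chart_cone_map W_def)
  ultimately show "\<exists>\<sigma>\<in>\<Sigma>. \<exists>V. \<exists>f\<in>affine_toric_functions \<sigma>. \<exists>g\<in>affine_toric_functions \<sigma>.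
      openin (toric_topology \<Sigma>) V \<and> p \<in> V \<and> V \<subseteq> U \<and> V \<subseteq> toric_chart \<Sigma> \<sigma> ` affine_toric_points \<sigma> \<and>
      (\<forall>\<gamma>\<in>affine_toric_points \<sigma>. toric_chart \<Sigma> \<sigma> \<gamma> \<in> V \<longrightarrow>
         g \<gamma> \<noteq> 0 \<and> (\<phi> \<circ> variety_map) (toric_chart \<Sigma> \<sigma> \<gamma>) = f \<gamma> / g \<gamma>)"
    by (intro bexI[of _ \<sigma>] exI[of _ W] bexI[of _ "f \<circ> point_map"] bexI[of _ "g \<circ> point_map"] conjI ballI impI)
      (use \<sigma> affine_toric_functions_pullback[OF f] affine_toric_functions_pullback[OF g] in simp_all)
qed

lemma toric_regular_pullback_iff:
  "\<phi> \<in> toric_regular (cone_map ` \<Sigma>) (variety_map ` (U :: ('n, 'k :: field) toric_point set)) \<longleftrightarrow>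
     \<phi> \<circ> variety_map \<in> toric_regular \<Sigma> U"
proof
  assume *: "\<phi> \<circ> variety_map \<in> toric_regular \<Sigma> U"
  have "(\<phi> \<circ> variety_map) \<circ> (`) inv.chart_map \<in> toric_regular (cone_map ` \<Sigma>) (variety_map ` U)"
    by (rule unimodular_pair.toric_regular_pullback[OF inverse])
      (use * in \<open>simp only: image_variety_map_inverse image_cone_map_inverse comp_assoc comp_variety_map_inverse comp_id\<close>)
  thus "\<phi> \<in> toric_regular (cone_map ` \<Sigma>) (variety_map ` U)"
    by (simp only: comp_assoc comp_variety_map_inverse comp_id)
qed (rule toric_regular_pullback)

lemma isomorphic_toric_varieties:
  "isomorphic_spaces (toric_variety \<Sigma> :: (('n, 'k :: field) toric_point, 'k) space_with_functions)
     (toric_variety (cone_map ` \<Sigma>))"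
proof -
  let ?T = "toric_topology \<Sigma> :: ('n, 'k) toric_point topology"
  let ?T' = "toric_topology (cone_map ` \<Sigma>) :: ('n, 'k) toric_point topology"
  have top: "variety_map ` topspace ?T = topspace ?T'"
  proof (rule subset_antisym)
    show "variety_map ` topspace ?T \<subseteq> topspace ?T'"
      using openin_toric_topology_image openin_subset openin_topspace by metis
    have "openin ?T' (topspace ?T')" by simp
    hence "openin ?T ((`) inv.chart_map ` topspace ?T')"
      using openin_toric_topology_image_iff[of \<Sigma> "(`) inv.chart_map ` topspace ?T'"]
      by (simp only: image_variety_map_inverse)
    hence "variety_map ` (`) inv.chart_map ` topspace ?T' \<subseteq> variety_map ` topspace ?T"
      by (intro image_mono openin_subset)
    thus "topspace ?T' \<subseteq> variety_map ` topspace ?T" by (simp only: image_variety_map_inverse)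
  qed
  \<comment> \<open>Writing V as the image of its own preimage lets the image statements about open
    sets and regular functions apply to it.\<close>
  have preimage: "V = variety_map ` {p \<in> topspace ?T. variety_map p \<in> V}" if "openin ?T' V" for V
  proof -
    have "V \<subseteq> variety_map ` topspace ?T" unfolding top using that by (rule openin_subset)
    thus ?thesis by blast
  qed
  have "homeomorphic_map ?T ?T' variety_map"
  proof (rule bijective_open_imp_homeomorphic_map)
    show "continuous_map ?T ?T' variety_map"
      unfolding continuous_map_def
    proof (intro conjI allI impI)
      show "variety_map \<in> topspace ?T \<rightarrow> topspace ?T'" unfolding top[symmetric] by blast
    next
      fix V assume V: "openin ?T' V"
      hence "openin ?T' (variety_map ` {p \<in> topspace ?T. variety_map p \<in> V})"
        using preimage[OF V] by argo
      thus "openin ?T {p \<in> topspace ?T. variety_map p \<in> V}"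
        unfolding openin_toric_topology_image_iff .
    qed
    show "open_map ?T ?T' variety_map"
      unfolding open_map_def using openin_toric_topology_image by blast
    show "inj_on variety_map (topspace ?T)" using inj_variety_map by (rule inj_on_subset) simp
  qed (rule top)
  moreover have "f \<in> toric_regular (cone_map ` \<Sigma>) V \<longleftrightarrow>
      f \<circ> variety_map \<in> toric_regular \<Sigma> {p \<in> topspace ?T. variety_map p \<in> V}"
    if V: "openin ?T' V" for V f
    using toric_regular_pullback_iff[of f \<Sigma> "{p \<in> topspace ?T. variety_map p \<in> V}"]
    unfolding preimage[OF V, symmetric] .
  ultimately show ?thesis
    unfolding isomorphic_spaces_def toric_variety_def by (intro exI[of _ variety_map]) simp
qed

end


section \<open>Lattice triangles\<close>

lemma icross_mult: "icross (A *v v) (A *v w) = (A $ 1 $ 1 * A $ 2 $ 2 - A $ 1 $ 2 * A $ 2 $ 1) * icross v w"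
  by (simp add: icross_def matrix_vector_mult_def sum_2 algebra_simps)

lemma (in unimodular_pair) primitive_vec_image:
  fixes v :: "int ^ 'n"
  assumes "primitive_vec v"
  shows "primitive_vec (A *v v)"
proof -
  have "Gcd (range (\<lambda>i. (A *v v) $ i)) dvd v $ i" for i
  proof -
    have comp: "(B *v u) $ i = (\<Sum>j\<in>UNIV. B $ i $ j * u $ j)" for u
      by (simp add: matrix_vector_mult_def)
    have "v = B *v (A *v v)" by (simp add: matrix_vector_mul_assoc BA)
    hence "v $ i = (\<Sum>j\<in>UNIV. B $ i $ j * (A *v v) $ j)"
      using comp[of "A *v v"] by metis
    thus ?thesis by (auto intro!: dvd_sum dvd_mult)
  qed
  hence "Gcd (range (\<lambda>i. (A *v v) $ i)) dvd Gcd (range (\<lambda>i. v $ i))" by (auto intro: Gcd_greatest)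
  thus ?thesis using assms by (simp add: primitive_vec_def)
qed

lemma unimodular_pair_mult:
  assumes "unimodular_pair A B" "unimodular_pair C D"
  shows "unimodular_pair (C ** A) (B ** D)"
proof -
  have "(C ** A) ** (B ** D) = C ** (A ** B) ** D" "(B ** D) ** (C ** A) = B ** (D ** C) ** A"
    by (simp_all add: matrix_mul_assoc)
  thus ?thesis using assms by (simp add: unimodular_pair_def)
qed

text \<open>Both matrices have the kernel of the degree map as row lattice, and their rows are bases
  of it because the transposes are injective. This makes the variety of Q independent, up to
  isomorphism, of the chosen generator matrix.\<close>

lemma corresponding_unimodular:
  assumes "corresponding P Q" "corresponding P' Q"
  obtains C D where "unimodular_pair C D" "P' = C ** P"
proof -
  have factor: "\<exists>C. P' = C ** P"
    if "range (\<lambda>m. transpose P' *v m) \<subseteq> range (\<lambda>m. transpose P *v m)" for P P' :: "int ^ 3 ^ 2"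
  proof -
    have "\<exists>m. row i P' = transpose P *v m" for i
    proof -
      have "row i P' = transpose P' *v axis i 1"
        by (simp add: vec_eq_iff row_def matrix_vector_mult_def transpose_def axis_def if_distrib
            del: transpose_matrix_vector cong: if_cong)
      thus ?thesis using that by blast
    qed
    then obtain m where m: "\<And>i. row i P' = transpose P *v m i" by metis
    have "P' = (\<chi> i. m i) ** P"
      unfolding vec_eq_iff
    proof (intro allI)
      fix i j
      have "P' $ i $ j = row i P' $ j" by (simp add: row_def)
      also have "\<dots> = (\<Sum>k\<in>UNIV. m i $ k * P $ k $ j)"
        unfolding m by (simp add: matrix_vector_mult_def transpose_def mult.commute vector_matrix_mult_def)
      finally show "P' $ i $ j = ((\<chi> i. m i) ** P) $ i $ j" by (simp add: matrix_matrix_mult_def)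
    qed
    thus ?thesis by blast
  qed
  \<comment> \<open>Injectivity of the transpose of P permits cancelling P on the right, so the two
    factorisations are mutually inverse.\<close>
  have cancel: "C = mat 1" if "corresponding P Q" "C ** P = P" for C :: "int ^ 2 ^ 2" and P
  proof -
    have "transpose P *v (transpose C *v m) = transpose P *v m" for m
      using arg_cong[OF that(2), of transpose]
      by (simp add: matrix_transpose_mul matrix_vector_mul_assoc del: transpose_matrix_vector)
    moreover have "inj (\<lambda>m. transpose P *v m)" using that(1) by (simp add: corresponding_def del: transpose_matrix_vector)
    ultimately have "transpose C *v m = m" for m by (metis injD)
    hence "transpose C = mat 1" by (simp add: matrix_eq del: transpose_matrix_vector)
    thus ?thesis by (metis transpose_mat transpose_transpose)
  qed
  have ranges: "range (\<lambda>m. transpose P' *v m) = range (\<lambda>m. transpose P *v m)"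
    using assms by (simp add: corresponding_def del: transpose_matrix_vector)
  obtain C where C: "P' = C ** P" using factor[of P' P] ranges by blast
  obtain D where D: "P = D ** P'" using factor[of P P'] ranges by blast
  have "(D ** C) ** P = P" "(C ** D) ** P' = P'"
    using C D by (metis matrix_mul_assoc)+
  hence "D ** C = mat 1" "C ** D = mat 1" using cancel assms by blast+
  hence "unimodular_pair C D" by (simp add: unimodular_pair_def)
  thus thesis using C by (rule that)
qed

lemma cone_image:
  "convex_cone hull {real_vec (A *v v), real_vec (A *v w)} =
     (*v) (real_matrix A) ` (convex_cone hull {real_vec v, real_vec w})"
proof -
  have lin: "c *\<^sub>R (real_matrix A *v x) + d *\<^sub>R (real_matrix A *v y) = real_matrix A *v (c *\<^sub>R x + d *\<^sub>R y)" for c d x y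
    by (simp add: matrix_vector_right_distrib matrix_vector_mult_scaleR)
  show ?thesis unfolding convex_cone_hull_pair real_vec_mult lin by blast
qed

lemma triangle_fan_image:
  assumes "unimodular_pair A B"
  shows "triangle_fan (A *v a) (A *v b) (A *v c) = unimodular_pair.cone_map A ` triangle_fan a b c"
proof -
  interpret unimodular_pair A B by fact
  interpret inv: unimodular_pair B A by (rule inverse)
  let ?f = "(*v) (real_matrix A)"
  have inj: "inj ?f"
  proof (rule injI)
    fix x y assume "?f x = ?f y"
    hence "real_matrix B *v ?f x = real_matrix B *v ?f y" by simp
    thus "x = y" by (simp add: matrix_vector_mul_assoc BA real_matrix_one flip: real_matrix_mult)
  qed
  have face: "\<tau> face_of ?f ` S \<longleftrightarrow> inv.cone_map \<tau> face_of S" for \<tau> S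
  proof -
    have "\<tau> = ?f ` inv.cone_map \<tau>" using cone_map_inverse(2)[of \<tau>] by (simp add: cone_map_def)
    thus ?thesis using face_of_linear_image[OF matrix_vector_mul_linear inj] by metis
  qed
  have empty: "inv.cone_map \<tau> \<noteq> {} \<longleftrightarrow> \<tau> \<noteq> {}" for \<tau> by (simp add: inv.cone_map_def)
  have mem: "\<tau> \<in> triangle_fan (A *v a) (A *v b) (A *v c) \<longleftrightarrow> inv.cone_map \<tau> \<in> triangle_fan a b c" for \<tau>
    unfolding triangle_fan_def cone_image mem_Collect_eq face empty ..
  show ?thesis
  proof (intro subset_antisym subsetI)
    fix \<tau> assume "\<tau> \<in> triangle_fan (A *v a) (A *v b) (A *v c)"
    thus "\<tau> \<in> cone_map ` triangle_fan a b c"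
      unfolding mem by (rule image_eqI[rotated]) (rule cone_map_inverse(2)[symmetric])
  next
    fix \<tau> assume "\<tau> \<in> cone_map ` triangle_fan a b c"
    thus "\<tau> \<in> triangle_fan (A *v a) (A *v b) (A *v c)"
      unfolding mem by (auto simp: cone_map_inverse)
  qed
qed

lemma fan_of_matrix_eq: "fan_of_matrix (P :: int ^ 3 ^ 2) = triangle_fan (column 1 P) (column 2 P) (column 3 P)"
proof -
  have ex3: "(\<exists>i :: 3. P i) \<longleftrightarrow> P 1 \<or> P 2 \<or> P 3" for P
    by (metis exhaust_3)
  have "UNIV - {1} = {2, 3 :: 3}" "UNIV - {2} = {3, 1 :: 3}" "UNIV - {3} = {1, 2 :: 3}"
    unfolding UNIV_3 by auto
  hence "(\<exists>i. \<tau> face_of convex_cone hull ((\<lambda>j. real_vec (column j P)) ` (UNIV - {i}))) \<longleftrightarrow>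
      \<tau> face_of convex_cone hull {real_vec (column 2 P), real_vec (column 3 P)} \<or>
      \<tau> face_of convex_cone hull {real_vec (column 3 P), real_vec (column 1 P)} \<or>
      \<tau> face_of convex_cone hull {real_vec (column 1 P), real_vec (column 2 P)}" for \<tau>
    unfolding ex3 by simp
  thus ?thesis unfolding fan_of_matrix_def triangle_fan_def by blast
qed

lemma column_mult: "column j (A ** P) = A *v column j (P :: int ^ 'm ^ 'n)"
  by (simp add: column_def matrix_matrix_mult_def matrix_vector_mult_def vec_eq_iff)

section \<open>Normal form of a lattice triangle\<close>

definition lattice_triangle :: "int ^ 2 \<Rightarrow> int ^ 2 \<Rightarrow> int ^ 2 \<Rightarrow> bool" where
  "lattice_triangle a b c \<longleftrightarrow> primitive_vec a \<and> primitive_vec b \<and> primitive_vec c \<and>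
     (0 < icross a b \<and> 0 < icross b c \<and> 0 < icross c a \<or> icross a b < 0 \<and> icross b c < 0 \<and> icross c a < 0)"

lemma lattice_triangle_permute:
  "lattice_triangle a b c \<Longrightarrow> lattice_triangle b a c"
  "lattice_triangle a b c \<Longrightarrow> lattice_triangle b c a"
  unfolding lattice_triangle_def using icross_swap[of a b] icross_swap[of b c] icross_swap[of c a] by auto

lemma triangle_fan_permute:
  "triangle_fan b a c = triangle_fan a b c" "triangle_fan b c a = triangle_fan a b c"
  unfolding triangle_fan_def by (auto simp: insert_commute)

definition edge_length :: "int ^ 2 \<Rightarrow> int ^ 2 \<Rightarrow> int" where
  "edge_length a b = gcd (a $ 1 - b $ 1) (a $ 2 - b $ 2)"

text \<open>The first new coordinate is, up to sign, the determinant with the primitive edge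
  direction e, hence constant on the edge. The second is a form with value 1 on e. It is unique up
  to adding multiples k of the first, and this shear is spent on normalising y or z.\<close>

lemma triangle_normal_form:
  assumes tri: "lattice_triangle a b c"
  obtains A B L M y z where "unimodular_pair A B" "0 < L" "0 < M" "0 < edge_length a b"
    "A *v a = vector [L, y]" "A *v b = vector [L, y - edge_length a b]" "A *v c = vector [- M, z]"
    "\<bar>icross a b\<bar> = edge_length a b * L" "\<bar>icross c a\<bar> = L * z + M * y"
    "\<bar>icross b c\<bar> = edge_length a b * M - (L * z + M * y)"
    "L \<le> M \<and> 1 \<le> y \<and> y \<le> L \<or> M \<le> L \<and> 1 \<le> z \<and> z \<le> M"
proof -
  define g where "g = edge_length a b"
  have ab0: "icross a b \<noteq> 0" using tri by (auto simp: lattice_triangle_def)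
  hence "a $ 1 - b $ 1 \<noteq> 0 \<or> a $ 2 - b $ 2 \<noteq> 0" by (auto simp: icross_def)
  hence g: "0 < g" by (auto simp: g_def edge_length_def)
  obtain e1 e2 where e: "a $ 1 - b $ 1 = g * e1" "a $ 2 - b $ 2 = g * e2" "coprime e1 e2"
    using gcd_coprime_exists[of "a $ 1 - b $ 1" "a $ 2 - b $ 2"] g
    unfolding g_def edge_length_def by (metis less_irrefl mult.commute)
  \<comment> \<open>The sign makes the edge lie at positive height for either orientation; the
    resulting matrix A has determinant \<open>- \<sigma>\<close>.\<close>
  define \<sigma> where "\<sigma> = sgn (icross a b)"
  have \<sigma>: "\<sigma> * \<sigma> = 1" using ab0 by (simp add: \<sigma>_def sgn_if)
  have signs: "\<bar>icross a b\<bar> = \<sigma> * icross a b" "\<bar>icross b c\<bar> = \<sigma> * icross b c" "\<bar>icross c a\<bar> = \<sigma> * icross c a"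
    "0 < \<bar>icross a b\<bar>" "0 < \<bar>icross b c\<bar>" "0 < \<bar>icross c a\<bar>"
    using tri by (auto simp: \<sigma>_def lattice_triangle_def sgn_if abs_if)
  define l where "l v = \<sigma> * (e1 * v $ 2 - e2 * v $ 1)" for v :: "int ^ 2"
  have ge: "g * (e1 * v $ 2 - e2 * v $ 1) = icross a v - icross b v" for v
  proof -
    have "g * (e1 * v $ 2 - e2 * v $ 1) = (g * e1) * v $ 2 - (g * e2) * v $ 1" by (simp add: algebra_simps)
    thus ?thesis unfolding e(1,2)[symmetric] by (simp add: icross_def algebra_simps)
  qed
  have gl: "g * l v = \<sigma> * (icross a v - icross b v)" for v
    unfolding l_def ge[symmetric] by simp
  have la: "g * l a = \<bar>icross a b\<bar>" and lb: "g * l b = \<bar>icross a b\<bar>"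
    and lc: "g * l c = - (\<bar>icross b c\<bar> + \<bar>icross c a\<bar>)"
    unfolding gl signs(1-3) using icross_swap[of a b] icross_swap[of c a] by (simp_all add: algebra_simps)
  define L M where "L = l a" and "M = - l c"
  have "0 < g * L" using la signs(4) by (simp add: L_def)
  hence L: "0 < L" using g by (simp add: zero_less_mult_iff)
  have "0 < g * M" using lc signs(5,6) by (simp add: M_def)
  hence M: "0 < M" using g by (simp add: zero_less_mult_iff)
  have "g * l b = g * L" using la lb by (simp add: L_def)
  hence lbL: "l b = L" using g by simp
  obtain r0 s0 where rs0: "r0 * e1 + s0 * e2 = 1" using e(3) by (metis bezout_int coprime_iff_gcd_eq_1)
  define y0 z0 where "y0 = r0 * a $ 1 + s0 * a $ 2" and "z0 = r0 * c $ 1 + s0 * c $ 2"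
  \<comment> \<open>The vertex c lies at height -M, so a shear by k changes y by k L and z by -k M;
    hence the opposite signs. Dividing y0 - 1 or z0 - 1 puts the remainder into 1..L or 1..M, the
    range prescribed for d1.\<close>
  define k where "k = (if L \<le> M then - ((y0 - 1) div L) else (z0 - 1) div M)"
  define r s where "r = r0 - k * \<sigma> * e2" and "s = s0 + k * \<sigma> * e1"
  have rs: "r * e1 + s * e2 = 1" using rs0 by (simp add: r_def s_def algebra_simps)
  have m: "r * v $ 1 + s * v $ 2 = r0 * v $ 1 + s0 * v $ 2 + k * l v" for v :: "int ^ 2"
    by (simp add: r_def s_def l_def algebra_simps)
  define y z where "y = r * a $ 1 + s * a $ 2" and "z = r * c $ 1 + s * c $ 2"
  have yz: "y = y0 + k * L" "z = z0 - k * M"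
    unfolding y_def z_def m by (simp_all add: y0_def z0_def L_def M_def)
  have normal: "L \<le> M \<and> 1 \<le> y \<and> y \<le> L \<or> M \<le> L \<and> 1 \<le> z \<and> z \<le> M"
  proof (cases "L \<le> M")
    case True
    have "y = 1 + (y0 - 1) mod L"
      using True minus_div_mult_eq_mod[of "y0 - 1" L] by (simp add: yz k_def)
    thus ?thesis using True L pos_mod_bound[OF L, of "y0 - 1"] pos_mod_sign[OF L, of "y0 - 1"] by linarith
  next
    case False
    have "z = 1 + (z0 - 1) mod M"
      using False minus_div_mult_eq_mod[of "z0 - 1" M] by (simp add: yz k_def)
    thus ?thesis using False M pos_mod_bound[OF M, of "z0 - 1"] pos_mod_sign[OF M, of "z0 - 1"] by linarith
  qed
  define A :: "int ^ 2 ^ 2" where "A = vector [vector [- \<sigma> * e2, \<sigma> * e1], vector [r, s]]"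
  define B :: "int ^ 2 ^ 2" where "B = vector [vector [- \<sigma> * s, e1], vector [\<sigma> * r, e2]]"
  have \<sigma>2: "\<sigma> * (\<sigma> * x) = x" for x using \<sigma> by (metis mult.assoc mult_1)
  have rs': "e1 * r + e2 * s = 1" using rs by (simp add: algebra_simps)
  have uni: "unimodular_pair A B"
    using rs' by (simp add: unimodular_pair_def A_def B_def matrix_matrix_mult_def mat_def vec_eq_iff forall_2 sum_2
        algebra_simps \<sigma>2)
  have Av: "A *v v = vector [l v, r * v $ 1 + s * v $ 2]" for v
    by (simp add: A_def matrix_vector_mult_def vec_eq_iff forall_2 sum_2 l_def algebra_simps)
  have "r * b $ 1 + s * b $ 2 = y - g * (r * e1 + s * e2)"
  proof -
    have a: "a $ 1 = b $ 1 + g * e1" "a $ 2 = b $ 2 + g * e2" using e(1,2) by simp_all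
    show ?thesis by (simp only: y_def a) (simp add: algebra_simps)
  qed
  hence images: "A *v a = vector [L, y]" "A *v b = vector [L, y - g]" "A *v c = vector [- M, z]"
    unfolding Av lbL by (simp_all add: L_def M_def y_def z_def rs)
  have det: "A $ 1 $ 1 * A $ 2 $ 2 - A $ 1 $ 2 * A $ 2 $ 1 = - \<sigma>"
  proof -
    have "A $ 1 $ 1 * A $ 2 $ 2 - A $ 1 $ 2 * A $ 2 $ 1 = - \<sigma> * (e1 * r + e2 * s)"
      by (simp add: A_def algebra_simps)
    thus ?thesis by (simp add: rs')
  qed
  have "- \<sigma> * icross c a = - (M * y) - z * L"
    using icross_mult[of A c a] unfolding det images by (simp add: icross_def)
  hence 1: "\<bar>icross c a\<bar> = L * z + M * y" unfolding signs by (simp add: algebra_simps)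
  have 2: "\<bar>icross b c\<bar> = g * M - (L * z + M * y)" using lc 1 by (simp add: M_def)
  have 3: "\<bar>icross a b\<bar> = g * L" using la by (simp add: L_def)
  show thesis using that[OF uni L M] g images 1 2 3 normal unfolding g_def by blast
qed

text \<open>As the determinant of the edge is g L up to sign, hypothesis \<open>T\<close> is a
  coordinate-free form of L dividing g. It permits writing g = L D, and then the normal form is an
  associated matrix with d0 = -D.\<close>

lemma triangle_adjacent_exists:
  fixes d :: int
  assumes tri: "lattice_triangle a b c"
    and le: "\<bar>icross b c\<bar> \<le> \<bar>icross c a\<bar>"
    and T: "icross a b dvd (edge_length a b)\<^sup>2"
    and eq: "(\<bar>icross b c\<bar> + \<bar>icross c a\<bar> + \<bar>icross a b\<bar>)\<^sup>2 = d * (\<bar>icross b c\<bar> * \<bar>icross c a\<bar> * \<bar>icross a b\<bar>)"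
  shows "\<exists>Q1 Q2. adjacent Q1 Q2 \<and> isomorphic_spaces
    (toric_variety (triangle_fan a b c) :: ((2, 'k :: field) toric_point, 'k) space_with_functions)
    (toric_variety_of_degree_matrix Q1)"
proof -
  define g where "g = edge_length a b"
  obtain A B L M y z where uni: "unimodular_pair A B" and pos: "0 < L" "0 < M" "0 < g"
    and im: "A *v a = vector [L, y]" "A *v b = vector [L, y - g]" "A *v c = vector [- M, z]"
    and w: "\<bar>icross a b\<bar> = g * L" "\<bar>icross c a\<bar> = L * z + M * y" "\<bar>icross b c\<bar> = g * M - (L * z + M * y)"
    and normal: "L \<le> M \<and> 1 \<le> y \<and> y \<le> L \<or> M \<le> L \<and> 1 \<le> z \<and> z \<le> M"
    using triangle_normal_form[OF tri] unfolding g_def by metis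
  interpret unimodular_pair A B by (rule uni)
  have "\<bar>icross a b\<bar> dvd g * g" using T by (simp add: g_def power2_eq_square)
  hence "L dvd g" using pos unfolding w by simp
  then obtain D where gD: "g = L * D" by (auto elim: dvdE)
  have D: "0 < D" using pos gD by (simp add: zero_less_mult_iff)
  have prim: "primitive_vec (A *v a)" "primitive_vec (A *v b)" "primitive_vec (A *v c)"
    using tri primitive_vec_image by (auto simp: lattice_triangle_def)
  have cop: "coprime L y" "coprime L (y - L * D)" "coprime M z"
    using prim unfolding im by (simp_all add: primitive_vec_2 gD)
  have ab: "\<bar>icross a b\<bar> = D * L\<^sup>2" unfolding w gD by (simp add: power2_eq_square)
  have bc: "\<bar>icross b c\<bar> = L * M * D - \<bar>icross c a\<bar>" unfolding w gD by (simp add: algebra_simps)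
  have wpos: "0 < \<bar>icross b c\<bar>" "0 < \<bar>icross c a\<bar>" using tri by (auto simp: lattice_triangle_def)
  let ?P = "matrix_2_3 (L, y) (L, y - L * D) (- M, z)"
  obtain Q1 Q2 where Q: "adjacent Q1 Q2" "corresponding ?P Q1"
    using adjacent_exists[OF pos(1,2) D cop w(2) wpos(2) bc wpos(1) le eq[unfolded ab] normal] by blast
  define P where "P = (SOME P. corresponding P Q1)"
  \<comment> \<open>P is the matrix selected in the definition of the variety of Q1. Only its
    correspondence to Q1 is known, which already makes it a unimodular multiple of
    \<open>?P\<close>.\<close>
  have "corresponding P Q1" unfolding P_def using Q(2) by (rule someI)
  then obtain C E where CE: "unimodular_pair C E" "P = C ** ?P"
    using corresponding_unimodular[OF Q(2)] by blast
  have cols: "column 1 ?P = A *v a" "column 2 ?P = A *v b" "column 3 ?P = A *v c"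
    unfolding im gD by (simp_all add: column_def matrix_2_3_def vec_eq_iff forall_2)
  have CA: "unimodular_pair (C ** A) (B ** E)" by (rule unimodular_pair_mult[OF uni CE(1)])
  have "fan_of_matrix P = triangle_fan ((C ** A) *v a) ((C ** A) *v b) ((C ** A) *v c)"
    unfolding fan_of_matrix_eq CE(2) column_mult cols by (simp only: matrix_vector_mul_assoc)
  also have "\<dots> = unimodular_pair.cone_map (C ** A) ` triangle_fan a b c"
    by (rule triangle_fan_image[OF CA])
  finally have "isomorphic_spaces
      (toric_variety (triangle_fan a b c) :: ((2, 'k) toric_point, 'k) space_with_functions)
      (toric_variety (fan_of_matrix P))"
    using unimodular_pair.isomorphic_toric_varieties[OF CA, of "triangle_fan a b c"] by simp
  thus ?thesis using Q(1) unfolding toric_variety_of_degree_matrix_def P_def by blast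
qed

lemma special_edge_divides:
  fixes d \<mu> :: int
  assumes tri: "lattice_triangle a b c"
    and eq: "(\<bar>icross b c\<bar> + \<bar>icross c a\<bar> + \<bar>icross a b\<bar>)\<^sup>2 = d * (\<bar>icross b c\<bar> * \<bar>icross c a\<bar> * \<bar>icross a b\<bar>)"
    and pos: "0 < \<mu>" "0 < d"
    and u: "\<bar>icross b c\<bar> = \<mu> * u0" "\<bar>icross c a\<bar> = \<mu> * u1" "\<bar>icross a b\<bar> = \<mu> * u2"
    and gcd1: "gcd (gcd u0 u1) u2 = 1"
    and special: "residue_pattern (\<mu> * d) u0 u1 u2"
  shows "icross a b dvd (edge_length a b)\<^sup>2"
proof -
  define g where "g = edge_length a b"
  obtain A B L M y z where uni: "unimodular_pair A B" and LM: "0 < L" "0 < M" "0 < g"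
    and im: "A *v a = vector [L, y]" "A *v b = vector [L, y - g]" "A *v c = vector [- M, z]"
    and w: "\<bar>icross a b\<bar> = g * L" "\<bar>icross c a\<bar> = L * z + M * y" "\<bar>icross b c\<bar> = g * M - (L * z + M * y)"
    using triangle_normal_form[OF tri] unfolding g_def by metis
  interpret unimodular_pair A B by (rule uni)
  have prim: "primitive_vec (A *v a)" "primitive_vec (A *v b)" "primitive_vec (A *v c)"
    using tri primitive_vec_image by (auto simp: lattice_triangle_def)
  have gcds: "gcd L y = 1" "gcd L (y - g) = 1" "gcd M z = 1"
    using prim unfolding im by (simp_all add: primitive_vec_2 coprime_iff_gcd_eq_1)
  have eq': "(\<mu> * u0 + \<mu> * u1 + \<mu> * u2)\<^sup>2 = d * (\<mu> * u0) * (\<mu> * u1) * (\<mu> * u2)"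
    using eq unfolding u by (simp add: mult.assoc)
  have "L dvd g"
    by (rule special_vertex_divides[OF LM pos gcds w(3)[unfolded u] w(2)[unfolded u] w(1)[unfolded u] gcd1 eq' special])
  hence "\<bar>icross a b\<bar> dvd g\<^sup>2" unfolding w by (simp add: power2_eq_square)
  thus ?thesis by (simp add: g_def)
qed

lemma edge_length_commute: "edge_length a b = edge_length b a"
proof -
  have "gcd (x - y) n = gcd (y - x) n" for x y n :: int by (metis gcd_neg1_int minus_diff_eq)
  thus ?thesis unfolding edge_length_def by (metis gcd.commute)
qed

text \<open>Adjacency requires the first weight not to exceed the second. Exchanging a and b
  arranges this and keeps both the fan and the condition on the edge.\<close>

lemma triangle_special_adjacent_exists:
  fixes d \<mu> :: int
  assumes tri: "lattice_triangle a b c"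
    and eq: "(\<bar>icross b c\<bar> + \<bar>icross c a\<bar> + \<bar>icross a b\<bar>)\<^sup>2 = d * (\<bar>icross b c\<bar> * \<bar>icross c a\<bar> * \<bar>icross a b\<bar>)"
    and T: "icross a b dvd (edge_length a b)\<^sup>2"
  shows "\<exists>Q1 Q2. adjacent Q1 Q2 \<and> isomorphic_spaces
    (toric_variety (triangle_fan a b c) :: ((2, 'k :: field) toric_point, 'k) space_with_functions)
    (toric_variety_of_degree_matrix Q1)"
proof (cases "\<bar>icross b c\<bar> \<le> \<bar>icross c a\<bar>")
  case True
  show ?thesis by (rule triangle_adjacent_exists[OF tri True T eq])
next
  case False
  have abs: "\<bar>icross b a\<bar> = \<bar>icross a b\<bar>" "\<bar>icross a c\<bar> = \<bar>icross c a\<bar>" "\<bar>icross c b\<bar> = \<bar>icross b c\<bar>"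
    using icross_swap[of a b] icross_swap[of c a] icross_swap[of b c] by simp_all
  have T': "icross b a dvd (edge_length b a)\<^sup>2"
    using T icross_swap[of a b] by (simp add: edge_length_commute[of b a])
  have eq': "(\<bar>icross a c\<bar> + \<bar>icross c b\<bar> + \<bar>icross b a\<bar>)\<^sup>2 = d * (\<bar>icross a c\<bar> * \<bar>icross c b\<bar> * \<bar>icross b a\<bar>)"
    unfolding abs using eq by (simp add: ac_simps)
  have le: "\<bar>icross a c\<bar> \<le> \<bar>icross c b\<bar>" unfolding abs using False by simp
  have fan: "triangle_fan a b c = triangle_fan b a c" by (rule triangle_fan_permute(1))
  show ?thesis
    unfolding fan by (rule triangle_adjacent_exists[OF lattice_triangle_permute(1)[OF tri] le T' eq'])
qed

theorem theorem6p9: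
  fixes \<Sigma> :: "(real ^ 2) set set"
  assumes "fake_weighted_projective_plane \<Sigma>"
    and "canonical_degree \<Sigma> \<in> \<int>"
  shows "\<exists>Q1 Q2. adjacent Q1 Q2 \<and>
    isomorphic_spaces
      (toric_variety \<Sigma> :: ((2, 'k::{alg_closed_field, field_char_0}) toric_point, 'k) space_with_functions)
      (toric_variety_of_degree_matrix Q1)"
proof -
  have fan: "fan \<Sigma>" and "q_factorial_fan \<Sigma>" "picard_number \<Sigma> = 1" and complete: "\<Union>\<Sigma> = UNIV"
    using assms(1) by (auto simp: fake_weighted_projective_plane_def projective_fan_def)
  from fan_with_three_rays[OF fan complete ray_gens_card_le_3[OF this(2,3)]]
  obtain a b c where R: "ray_gens \<Sigma> = {a, b, c}" and prim: "primitive_vec a" "primitive_vec b" "primitive_vec c"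
    and or: "0 < icross a b" "0 < icross b c" "0 < icross c a" and \<Sigma>: "\<Sigma> = triangle_fan a b c"
    and cones: "convex_cone hull {real_vec a, real_vec b} \<in> \<Sigma>" "convex_cone hull {real_vec b, real_vec c} \<in> \<Sigma>"
      "convex_cone hull {real_vec c, real_vec a} \<in> \<Sigma>" by blast
  define w where "w p q = \<bar>icross p q\<bar>" for p q
  have w: "w p q = w q p" for p q unfolding w_def by (simp add: icross_swap[of p q])
  have wv: "icross a b = w a b" "icross b c = w b c" "icross c a = w c a" using or by (simp_all add: w_def)
  obtain d where "canonical_degree \<Sigma> = of_int d" using assms(2) by (rule Ints_cases)
  hence "of_int ((w b c + w c a + w a b)\<^sup>2) = (of_int d :: rat) * of_int (w b c * w c a * w a b)"
    using canonical_degree_triangle[OF R or cones] or unfolding wv by (simp add: field_simps)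
  hence eq: "(w b c + w c a + w a b)\<^sup>2 = d * (w b c * w c a * w a b)"
    unfolding of_int_mult[symmetric] of_int_eq_iff .
  have wpos: "0 < w b c" "0 < w c a" "0 < w a b" using or by (simp_all add: w_def)
  have "0 < (w b c + w c a + w a b)\<^sup>2" using wpos by simp
  moreover have "0 < w b c * w c a * w a b" using wpos by simp
  ultimately have d: "0 < d" unfolding eq by (rule zero_less_mult_pos2)
  define \<mu> where "\<mu> = gcd (gcd (w b c) (w c a)) (w a b)"
  have \<mu>: "0 < \<mu>" using wpos by (simp add: \<mu>_def)
  obtain x y z where u: "w b c = \<mu> * x" "w c a = \<mu> * y" "w a b = \<mu> * z"
  proof -
    have "\<mu> dvd w b c" "\<mu> dvd w c a" "\<mu> dvd w a b"
      unfolding \<mu>_def by (meson dvd_trans gcd_dvd1 gcd_dvd2)+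
    thus thesis using that by (auto elim!: dvdE)
  qed
  have upos: "0 < x" "0 < y" "0 < z" using wpos \<mu> unfolding u by (simp_all add: zero_less_mult_iff)
  have "\<mu> * gcd (gcd x y) z = \<mu>"
  proof -
    have "gcd (gcd (\<mu> * x) (\<mu> * y)) (\<mu> * z) = \<mu> * gcd (gcd x y) z"
      using \<mu> by (simp add: gcd_mult_distrib_int[symmetric])
    thus ?thesis unfolding u[symmetric] \<mu>_def[symmetric] by simp
  qed
  hence gcd1: "gcd (gcd x y) z = 1" using \<mu> by simp
  have "\<mu>\<^sup>2 * (x + y + z)\<^sup>2 = \<mu>\<^sup>2 * (\<mu> * d * x * y * z)"
    using eq unfolding u by (simp add: power2_eq_square algebra_simps)
  hence "(x + y + z)\<^sup>2 = \<mu> * d * x * y * z" using \<mu> by simp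
  hence type: "residue_type (\<mu> * d) x y z"
    using upos gcd1 by (rule primitive_solution_residues)
  have tri: "lattice_triangle a b c" using prim or by (simp add: lattice_triangle_def)
  \<comment> \<open>Here p, q, r is a relabelling of a, b, c with the special vertex r last. The
    degree equation is symmetric and carries over; the residues give the divisibility for the edge
    from p to q.\<close>
  have finish: ?thesis
    if tri: "lattice_triangle p q r" and fan: "triangle_fan p q r = triangle_fan a b c"
      and v: "w q r = \<mu> * i" "w r p = \<mu> * j" "w p q = \<mu> * k"
      and ijk: "i + j + k = x + y + z" "i * j * k = x * y * z" "gcd (gcd i j) k = 1"
      and pat: "residue_pattern (\<mu> * d) i j k" for p q r i j k
  proof -
    have "(w q r + w r p + w p q)\<^sup>2 = \<mu>\<^sup>2 * (i + j + k)\<^sup>2" unfolding v by (simp add: power2_eq_square algebra_simps)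
    also have "\<dots> = (w b c + w c a + w a b)\<^sup>2" unfolding ijk(1) u
      by (simp add: power2_eq_square algebra_simps)
    also have "\<dots> = d * (w b c * w c a * w a b)" by (rule eq)
    also have "\<dots> = d * \<mu> ^ 3 * (x * y * z)" unfolding u
      by (simp add: power3_eq_cube algebra_simps)
    also have "\<dots> = d * (w q r * w r p * w p q)" unfolding ijk(2)[symmetric] v
      by (simp add: power3_eq_cube algebra_simps)
    finally have eq': "(w q r + w r p + w p q)\<^sup>2 = d * (w q r * w r p * w p q)" .
    have T: "icross p q dvd (edge_length p q)\<^sup>2"
      by (rule special_edge_divides[OF tri eq'[unfolded w_def] \<mu> d v[unfolded w_def] ijk(3) pat])
    show ?thesis
      unfolding \<Sigma> fan[symmetric] by (rule triangle_special_adjacent_exists[OF tri eq'[unfolded w_def] T])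
  qed
  note perm = lattice_triangle_permute[OF tri] lattice_triangle_permute(2)[OF lattice_triangle_permute(2)[OF tri]]
    lattice_triangle_permute(2)[OF lattice_triangle_permute(1)[OF tri]]
    lattice_triangle_permute(2)[OF lattice_triangle_permute(2)[OF lattice_triangle_permute(1)[OF tri]]]
  have gcds: "gcd (gcd y x) z = 1" "gcd (gcd x z) y = 1" "gcd (gcd y z) x = 1" "gcd (gcd z x) y = 1" "gcd (gcd z y) x = 1"
    using gcd1 by (simp_all add: gcd.commute gcd.left_commute)
  note ws = w[of b a] w[of c b] w[of a c]
  have fans: "triangle_fan b a c = triangle_fan a b c" "triangle_fan b c a = triangle_fan a b c"
    "triangle_fan c a b = triangle_fan a b c" "triangle_fan a c b = triangle_fan a b c" "triangle_fan c b a = triangle_fan a b c"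
    using triangle_fan_permute by metis+
  from type show ?thesis
    unfolding residue_type_def
  proof (elim disjE)
    assume "residue_pattern (\<mu> * d) x y z"
    thus ?thesis using finish[of a b c x y z] tri u gcd1 by simp
  next
    assume "residue_pattern (\<mu> * d) x z y"
    thus ?thesis using finish[of a c b x z y] perm fans u ws gcds by (simp add: ac_simps)
  next
    assume "residue_pattern (\<mu> * d) y x z"
    thus ?thesis using finish[of b a c y x z] perm fans u ws gcds by (simp add: ac_simps)
  next
    assume "residue_pattern (\<mu> * d) y z x"
    thus ?thesis using finish[of b c a y z x] perm fans u ws gcds by (simp add: ac_simps)
  next
    assume "residue_pattern (\<mu> * d) z x y"
    thus ?thesis using finish[of c a b z x y] perm fans u ws gcds by (simp add: ac_simps)
  next
    assume "residue_pattern (\<mu> * d) z y x"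
    thus ?thesis using finish[of c b a z y x] perm fans u ws gcds by (simp add: ac_simps)
  qed
qed

end
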